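(* Let $(X,\mu)$ be a standard Borel space equipped with a non-atomic sigma-finite (finite or infinite) measure $\mu$. The group $\mathrm{Aut}(X,\mu)$ of all measure-preserving automorphisms of $(X,\mu)$, equipped with the strong topology, is extremely amenable.
   Context: $\mathrm{Aut}(X,\mu)$ is the group of all $\mu$-preserving Borel automorphisms of $X$, where two automorphisms that agree $\mu$-almost everywhere are identified. To $T\in \mathrm{Aut}(X,\mu)$ one associates the linear isometry $\Phi(T)$ of $L^2(X,\mu)$ given by $\Phi(T)f(x)=f(T^{-1}x)$. The strong topology on $\mathrm{Aut}(X,\mu)$ is the topology induced, via $\Phi$, by the strong operator topology on the unitary group of $L^2(X,\mu)$ (it is also called the weak topology on $\mathrm{Aut}(X,\mu)$). A topological group $G$ is extremely amenable if every continuous action of $G$ on a (non-empty) compact Hausdorff space has a fixed point. *)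

theory Defs
  imports "HOL-Analysis.Analysis" "HOL-Algebra.Group_Action"
begin

section \<open>Standard Borel spaces and non-atomic measures\<close>

definition standard_borel :: "'a measure \<Rightarrow> bool" where
  "standard_borel M \<longleftrightarrow>
     (\<exists>X :: 'a topology. topspace X = space M \<and> completely_metrizable_space X \<and> separable_space X \<and>
        sets M = sigma_sets (topspace X) {U. openin X U})"

definition nonatomic :: "'a measure \<Rightarrow> bool" where
  "nonatomic M \<longleftrightarrow>
     (\<forall>A\<in>sets M. 0 < emeasure M A \<longrightarrow>
        (\<exists>B\<in>sets M. B \<subseteq> A \<and> 0 < emeasure M B \<and> emeasure M B < emeasure M A))"

section \<open>The group of measure-preserving automorphisms\<close>

text \<open>Elements of \<open>Bij (space M)\<close> are bijections of the space onto itself that are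
  \<open>undefined\<close> outside of it.\<close>

definition mp_automorphisms :: "'a measure \<Rightarrow> ('a \<Rightarrow> 'a) set" where
  "mp_automorphisms M =
     {T \<in> Bij (space M). T \<in> measurable M M \<and> inv_into (space M) T \<in> measurable M M \<and>
        distr M M T = M}"

definition mp_group :: "'a measure \<Rightarrow> ('a \<Rightarrow> 'a) monoid" where
  "mp_group M = BijGroup (space M) \<lparr>carrier := mp_automorphisms M\<rparr>"

definition ae_eq :: "'a measure \<Rightarrow> (('a \<Rightarrow> 'a) \<times> ('a \<Rightarrow> 'a)) set" where
  "ae_eq M =
     {(S, T). S \<in> mp_automorphisms M \<and> T \<in> mp_automorphisms M \<and> (AE x in M. S x = T x)}"

text \<open>The elements of \<open>Aut M\<close> are a.e.-classes of automorphisms; since a.e.-equality is a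
  congruence, the elementwise product of two classes is the class of the product of any
  representatives.\<close>

definition Aut :: "'a measure \<Rightarrow> ('a \<Rightarrow> 'a) set monoid" where
  "Aut M =
     \<lparr>carrier = mp_automorphisms M // ae_eq M,
      mult = set_mult (mp_group M),
      one = ae_eq M `` {\<one>\<^bsub>mp_group M\<^esub>}\<rparr>"

section \<open>The complex Hilbert space of square-integrable functions\<close>

definition L2_functions :: "'a measure \<Rightarrow> ('a \<Rightarrow> complex) set" where
  "L2_functions M = {f \<in> borel_measurable M. integrable M (\<lambda>x. (cmod (f x))\<^sup>2)}"

definition L2_class :: "'a measure \<Rightarrow> ('a \<Rightarrow> complex) \<Rightarrow> ('a \<Rightarrow> complex) set" where
  "L2_class M f = {g \<in> L2_functions M. AE x in M. g x = f x}"

definition L2 :: "'a measure \<Rightarrow> ('a \<Rightarrow> complex) set set" where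
  "L2 M = L2_class M ` L2_functions M"

text \<open>An arbitrary representative of a class. It is used below, for classes of functions as well as
  for classes of automorphisms, only in ways that do not depend on the choice.\<close>

definition rep :: "'b set \<Rightarrow> 'b" where
  "rep F = (SOME f. f \<in> F)"

definition L2_add ::
    "'a measure \<Rightarrow> ('a \<Rightarrow> complex) set \<Rightarrow> ('a \<Rightarrow> complex) set \<Rightarrow> ('a \<Rightarrow> complex) set" where
  "L2_add M F G = L2_class M (\<lambda>x. rep F x + rep G x)"

definition L2_scale ::
    "'a measure \<Rightarrow> complex \<Rightarrow> ('a \<Rightarrow> complex) set \<Rightarrow> ('a \<Rightarrow> complex) set" where
  "L2_scale M c F = L2_class M (\<lambda>x. c * rep F x)"

definition L2_inner ::
    "'a measure \<Rightarrow> ('a \<Rightarrow> complex) set \<Rightarrow> ('a \<Rightarrow> complex) set \<Rightarrow> complex" where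
  "L2_inner M F G = (LINT x|M. rep F x * cnj (rep G x))"

definition L2_dist ::
    "'a measure \<Rightarrow> ('a \<Rightarrow> complex) set \<Rightarrow> ('a \<Rightarrow> complex) set \<Rightarrow> real" where
  "L2_dist M F G = sqrt (LINT x|M. (cmod (rep F x - rep G x))\<^sup>2)"

definition L2_topology :: "'a measure \<Rightarrow> ('a \<Rightarrow> complex) set topology" where
  "L2_topology M = Metric_space.mtopology (L2 M) (L2_dist M)"

section \<open>The strong topology\<close>

definition L2_unitary ::
    "'a measure \<Rightarrow> (('a \<Rightarrow> complex) set \<Rightarrow> ('a \<Rightarrow> complex) set) set" where
  "L2_unitary M =
     {U \<in> Bij (L2 M).
        (\<forall>F\<in>L2 M. \<forall>G\<in>L2 M. U (L2_add M F G) = L2_add M (U F) (U G)) \<and>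
        (\<forall>c. \<forall>F\<in>L2 M. U (L2_scale M c F) = L2_scale M c (U F)) \<and>
        (\<forall>F\<in>L2 M. \<forall>G\<in>L2 M. L2_inner M (U F) (U G) = L2_inner M F G)}"

text \<open>The strong operator topology is the topology of pointwise convergence on vectors, with respect
  to the norm: the trace on the unitary group of a product of copies of the norm topology.\<close>

definition strong_operator_topology ::
    "'a measure \<Rightarrow> (('a \<Rightarrow> complex) set \<Rightarrow> ('a \<Rightarrow> complex) set) topology" where
  "strong_operator_topology M =
     subtopology (product_topology (\<lambda>_. L2_topology M) (L2 M)) (L2_unitary M)"

text \<open>\<open>Koopman M A\<close> is the operator \<open>f \<mapsto> f \<circ> T\<inverse>\<close> on classes, where \<open>T\<close> is any member of \<open>A\<close>.\<close>

definition Koopman ::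
    "'a measure \<Rightarrow> ('a \<Rightarrow> 'a) set \<Rightarrow> ('a \<Rightarrow> complex) set \<Rightarrow> ('a \<Rightarrow> complex) set" where
  "Koopman M A = (\<lambda>F\<in>L2 M. L2_class M (\<lambda>x. rep F (inv_into (space M) (rep A) x)))"

definition Aut_strong_topology :: "'a measure \<Rightarrow> ('a \<Rightarrow> 'a) set topology" where
  "Aut_strong_topology M =
     pullback_topology (carrier (Aut M)) (Koopman M) (strong_operator_topology M)"

section \<open>Extremely amenable topological groups\<close>

definition topological_group :: "('g, 'm) monoid_scheme \<Rightarrow> 'g topology \<Rightarrow> bool" where
  "topological_group G \<tau> \<longleftrightarrow>
     group G \<and> topspace \<tau> = carrier G \<and>
     continuous_map (prod_topology \<tau> \<tau>) \<tau> (\<lambda>(g, h). g \<otimes>\<^bsub>G\<^esub> h) \<and>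
     continuous_map \<tau> \<tau> (\<lambda>g. inv\<^bsub>G\<^esub> g)"

definition continuous_action ::
    "('g, 'm) monoid_scheme \<Rightarrow> 'g topology \<Rightarrow> 'x topology \<Rightarrow> ('g \<Rightarrow> 'x \<Rightarrow> 'x) \<Rightarrow> bool" where
  "continuous_action G \<tau> X \<phi> \<longleftrightarrow>
     group_action G (topspace X) \<phi> \<and>
     continuous_map (prod_topology \<tau> X) X (\<lambda>(g, x). \<phi> g x)"

text \<open>A definition cannot quantify over types, so the type carrying the compact spaces is a parameter.
  Extreme amenability is the statement that this holds for every type \<open>'x\<close>, which is what a theorem
  with a free type variable \<open>'x\<close> asserts.\<close>

definition extremely_amenable ::
    "'x itself \<Rightarrow> ('g, 'm) monoid_scheme \<Rightarrow> 'g topology \<Rightarrow> bool" where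
  "extremely_amenable _ G \<tau> \<longleftrightarrow>
     topological_group G \<tau> \<and>
     (\<forall>(X :: 'x topology) \<phi>.
        compact_space X \<and> Hausdorff_space X \<and> topspace X \<noteq> {} \<and> continuous_action G \<tau> X \<phi> \<longrightarrow>
        (\<exists>x\<in>topspace X. \<forall>g\<in>carrier G. \<phi> g x = x))"

end

(*
The permutations of n pieces of measure 1/N act on the space by automorphisms, and every finite set of
automorphisms is approximated in the strong topology by such permutations as N grows. A function on
the symmetric group that is Lipschitz for the Hamming distance with constant O(1/N) has variance
O(n/N^2) = O(1/N), so it is nearly constant outside a small set. Apply this to orbit maps
p |-> f(p x0) of an action on a compact space, which are uniformly continuous and hence close to
Lipschitz functions: for finitely many f and finitely many group elements g some point x = p x0
satisfies f(g x) ~ f(x) simultaneously. A fixed point then exists by compactness. No restriction on the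
total measure is needed because a strong neighbourhood of the identity only sees finitely many sets
of finite measure.
*)

theory Submission
  imports Defs "HOL-Probability.Distribution_Functions" "HOL-Combinatorics.Permutations"
begin

text \<open>The groups used for different \<open>N\<close> are not nested: each demand (finitely
  many functions and group elements, one tolerance) is met by a single symmetric group chosen after
  it. In the variance bound n is O(N) because all pieces lie in one set of finite measure. Three
  obstacles shape the proof. Permutations of pieces must act by automorphisms, and multiplicatively,
  so the pieces need compatible coordinates; these come from a distribution function, and their
  inverses are Borel because of compact sets on which the coordinate is continuous. An automorphism
  does not carry pieces to pieces; it is imitated only in so far as the test sets can tell, and
  counting labels yields a permutation with a number of errors that does not grow with
  \<open>N\<close>. Finally, compactness compares orbit maps at \<open>p\<close> and
  \<open>q\<close> through p q^-1, which moves as many points as the Hamming distance counts,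
  whereas the translates to be controlled are left translates; these are injective on permutations,
  so a bad set does not grow when it is pulled back.\<close>

section \<open>Concentration of measure on symmetric groups\<close>

text \<open>Induction on \<open>S\<close>: conditioning on the image of the new point splits the variance into the
  variances on the cosets and the variance of the coset means; the latter differ by at most \<open>c\<close>.\<close>

lemma permutation_variance:
  fixes f :: "('a \<Rightarrow> 'a) \<Rightarrow> real" and c :: real
  assumes "finite S"
    and "\<And>p q. p permutes S \<Longrightarrow> q permutes S \<Longrightarrow> card {x. p x \<noteq> q x} \<le> 3 \<Longrightarrow> \<bar>f p - f q\<bar> \<le> c"
  obtains m where "(\<Sum>p | p permutes S. f p) = fact (card S) * m"
    and "(\<Sum>p | p permutes S. (f p - m)\<^sup>2) \<le> fact (card S) * (card S * c\<^sup>2)"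
proof -
  have "\<exists>m. (\<Sum>p | p permutes S. f p) = fact (card S) * m \<and>
      (\<Sum>p | p permutes S. (f p - m)\<^sup>2) \<le> fact (card S) * (card S * c\<^sup>2)"
    using assms
  proof (induction S arbitrary: f rule: finite_induct)
    case empty
    have "{p. p permutes ({}::'a set)} = {id}" by (auto simp: permutes_empty)
    then show ?case by (auto intro!: exI[of _ "f id"])
  next
    case (insert a S)
    let ?n = "card S"
    have card_P: "card {p. p permutes S} = fact ?n"
      using insert.hyps(1) by (rule card_permutations[OF refl])
    have perm: "Transposition.transpose a b \<circ> p permutes insert a S" if "b \<in> insert a S" "p permutes S" for b p
      using that by (intro permutes_compose permutes_swap_id) (auto intro: permutes_subset)
    have "\<exists>m. (\<Sum>p | p permutes S. f (Transposition.transpose a b \<circ> p)) = fact ?n * m \<and>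
      (\<Sum>p | p permutes S. (f (Transposition.transpose a b \<circ> p) - m)\<^sup>2) \<le> fact ?n * (?n * c\<^sup>2)"
      if b: "b \<in> insert a S" for b
    proof (rule insert.IH)
      fix p q assume pq: "p permutes S" "q permutes S" "card {x. p x \<noteq> q x} \<le> 3"
      have "{x. (Transposition.transpose a b \<circ> p) x \<noteq> (Transposition.transpose a b \<circ> q) x} = {x. p x \<noteq> q x}"
        by (auto dest: injD[OF inj_transpose])
      then show "\<bar>f (Transposition.transpose a b \<circ> p) - f (Transposition.transpose a b \<circ> q)\<bar> \<le> c"
        using pq by (intro insert.prems perm b) auto
    qed
    then obtain m where m: "\<And>b. b \<in> insert a S \<Longrightarrow>
        (\<Sum>p | p permutes S. f (Transposition.transpose a b \<circ> p)) = fact ?n * m b"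
      "\<And>b. b \<in> insert a S \<Longrightarrow>
        (\<Sum>p | p permutes S. (f (Transposition.transpose a b \<circ> p) - m b)\<^sup>2) \<le> fact ?n * (?n * c\<^sup>2)"
      by metis
    define N where "N = real (card (insert a S))"
    have N: "N = real ?n + 1" "N > 0" using insert.hyps by (auto simp: N_def)
    define mm where "mm = (\<Sum>b\<in>insert a S. m b) / N"
    have sum_m: "(\<Sum>b\<in>insert a S. m b) = N * mm" using N by (simp add: mm_def)
    have diff: "\<bar>m b - m b'\<bar> \<le> c" if b: "b \<in> insert a S" "b' \<in> insert a S" for b b'
    proof -
      have "\<bar>f (Transposition.transpose a b \<circ> p) - f (Transposition.transpose a b' \<circ> p)\<bar> \<le> c" if p: "p permutes S" for p
      proof (rule insert.prems)
        \<comment> \<open>The transpositions of \<open>a\<close> with \<open>b\<close> and with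
          \<open>b'\<close> can differ only on \<open>a\<close>, \<open>b\<close> and
          \<open>b'\<close>. This is the origin of the 3 in the Lipschitz hypothesis.\<close>
        have "{x. (Transposition.transpose a b \<circ> p) x \<noteq> (Transposition.transpose a b' \<circ> p) x} \<subseteq> inv_into UNIV p ` {a, b, b'}"
        proof
          fix x assume "x \<in> {x. (Transposition.transpose a b \<circ> p) x \<noteq> (Transposition.transpose a b' \<circ> p) x}"
          then have "p x \<in> {a, b, b'}" by (auto simp: Transposition.transpose_def split: if_splits)
          then show "x \<in> inv_into UNIV p ` {a, b, b'}"
            using p by (metis image_eqI permutes_inverses(2))
        qed
        then have "card {x. (Transposition.transpose a b \<circ> p) x \<noteq> (Transposition.transpose a b' \<circ> p) x} \<le> card (inv_into UNIV p ` {a, b, b'})"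
          by (intro card_mono) auto
        also have "\<dots> \<le> card {a, b, b'}" by (rule card_image_le) auto
        also have "\<dots> \<le> 3" by (simp add: card_insert_if)
        finally show "card {x. (Transposition.transpose a b \<circ> p) x \<noteq> (Transposition.transpose a b' \<circ> p) x} \<le> 3" .
      qed (rule perm[OF b(1) p] perm[OF b(2) p])+
      then have "\<bar>\<Sum>p | p permutes S. f (Transposition.transpose a b \<circ> p) - f (Transposition.transpose a b' \<circ> p)\<bar> \<le> (\<Sum>p | p permutes S. c)"
        by (intro order_trans[OF sum_abs] sum_mono) auto
      then have "\<bar>fact ?n * (m b - m b')\<bar> \<le> fact ?n * c"
        using b by (simp add: sum_subtractf m(1) card_P right_diff_distrib)
      then show ?thesis by (simp add: abs_mult)
    qed
    have dev: "(m b - mm)\<^sup>2 \<le> c\<^sup>2" if b: "b \<in> insert a S" for b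
    proof -
      have "(\<Sum>b'\<in>insert a S. m b - m b') = N * (m b - mm)"
        by (simp only: sum_subtractf sum_m) (simp add: N_def right_diff_distrib)
      then have "N * \<bar>m b - mm\<bar> = \<bar>\<Sum>b'\<in>insert a S. m b - m b'\<bar>"
        using N(2) by (simp only: abs_mult)
      also have "\<dots> \<le> (\<Sum>b'\<in>insert a S. c)"
        using diff[OF b] by (intro order_trans[OF sum_abs] sum_mono)
      also have "\<dots> = N * c" by (simp add: N_def)
      finally have "\<bar>m b - mm\<bar> \<le> c" using N by simp
      then show ?thesis by (metis abs_ge_zero power2_abs power_mono)
    qed
    have one: "(\<Sum>p | p permutes S. (f (Transposition.transpose a b \<circ> p) - mm)\<^sup>2) \<le> fact ?n * (N * c\<^sup>2)"
      if b: "b \<in> insert a S" for b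
    proof -
      \<comment> \<open>Expansion around the coset mean \<open>m b\<close>: the cross term sums to
        0, and the square of \<open>m b - mm\<close> adds one \<open>c\<^sup>2\<close> on average,
        which turns the factor \<open>card S\<close> into \<open>N\<close>.\<close>
      have "(\<Sum>p | p permutes S. (f (Transposition.transpose a b \<circ> p) - mm)\<^sup>2) =
        (\<Sum>p | p permutes S. (f (Transposition.transpose a b \<circ> p) - m b)\<^sup>2
           + 2 * (m b - mm) * (f (Transposition.transpose a b \<circ> p) - m b) + (m b - mm)\<^sup>2)"
        by (intro sum.cong) (auto simp: power2_eq_square algebra_simps)
      also have "\<dots> = (\<Sum>p | p permutes S. (f (Transposition.transpose a b \<circ> p) - m b)\<^sup>2) + fact ?n * (m b - mm)\<^sup>2"
        unfolding sum.distrib sum_distrib_left[symmetric] sum_subtractf m(1)[OF b] sum_constant card_P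
        by simp
      also have "\<dots> \<le> fact ?n * (?n * c\<^sup>2) + fact ?n * c\<^sup>2"
        using m(2)[OF b] dev[OF b] by (intro add_mono mult_left_mono) auto
      finally show ?thesis by (simp add: N algebra_simps)
    qed
    have "(\<Sum>p | p permutes insert a S. f p) = fact ?n * (N * mm)"
      unfolding sum_over_permutations_insert[OF insert.hyps] sum_m[symmetric] sum_distrib_left
      by (intro sum.cong m(1) refl)
    moreover have "(\<Sum>p | p permutes insert a S. (f p - mm)\<^sup>2) \<le> (\<Sum>b\<in>insert a S. fact ?n * (N * c\<^sup>2))"
      unfolding sum_over_permutations_insert[OF insert.hyps] by (intro sum_mono one)
    ultimately show ?case
      using insert.hyps by (intro exI[of _ mm]) (auto simp: N_def algebra_simps)
  qed
  then show ?thesis using that by blast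
qed

text \<open>Take a permutation with the most matches. If position i with label v is mismatched, no
  item of label v can sit at a position k wanting another label: exchanging the items at i and k
  would gain a match and lose none. So all items of label v are already well placed, and the unmet
  demand for v is at most \<open>R\<close>.\<close>

lemma permutation_matching:
  fixes \<alpha> \<beta> :: "'i \<Rightarrow> 'v"
  assumes I: "finite I" and V: "finite V" "\<alpha> ` I \<subseteq> V" "\<beta> ` I \<subseteq> V"
    and R: "\<And>v. v \<in> V \<Longrightarrow> card {i\<in>I. \<beta> i = v} \<le> card {i\<in>I. \<alpha> i = v} + R"
  obtains \<sigma> where "\<sigma> permutes I" "card {i\<in>I. \<alpha> (\<sigma> i) \<noteq> \<beta> i} \<le> card V * R"
proof -
  define good where "good \<sigma> = {i\<in>I. \<alpha> (\<sigma> i) = \<beta> i}" for \<sigma>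
  have fin_P: "finite {\<sigma>. \<sigma> permutes I}" using I by (rule finite_permutations)
  \<comment> \<open>If the number of matches is maximal, no transposition can improve it.\<close>
  obtain \<sigma> where \<sigma>: "\<sigma> permutes I" and max: "\<And>\<tau>. \<tau> permutes I \<Longrightarrow> card (good \<tau>) \<le> card (good \<sigma>)"
  proof -
    have "Max ((\<lambda>\<sigma>. card (good \<sigma>)) ` {\<sigma>. \<sigma> permutes I}) \<in> (\<lambda>\<sigma>. card (good \<sigma>)) ` {\<sigma>. \<sigma> permutes I}"
      using fin_P by (intro Max_in) (auto intro: exI[of _ id] permutes_id)
    then obtain \<sigma> where "\<sigma> permutes I"
      and eq: "Max ((\<lambda>\<sigma>. card (good \<sigma>)) ` {\<sigma>. \<sigma> permutes I}) = card (good \<sigma>)" by auto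
    moreover have "card (good \<tau>) \<le> card (good \<sigma>)" if "\<tau> permutes I" for \<tau>
      unfolding eq[symmetric] using fin_P that by (intro Max_ge) auto
    ultimately show ?thesis using that by blast
  qed
  have mem: "\<sigma> i \<in> I \<longleftrightarrow> i \<in> I" for i using \<sigma> by (simp add: permutes_in_image)
  have no_swap: False if ik: "i \<in> I" "k \<in> I" "\<alpha> (\<sigma> i) \<noteq> \<beta> i" "\<alpha> (\<sigma> k) = \<beta> i" "\<beta> k \<noteq> \<beta> i" for i k
  proof -
    let ?\<tau> = "\<sigma> \<circ> Transposition.transpose i k"
    have "?\<tau> permutes I" using \<sigma> ik by (intro permutes_compose permutes_swap_id) auto
    moreover have "insert i (good \<sigma>) \<subseteq> good ?\<tau>"
      using ik by (auto simp: good_def Transposition.transpose_def)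
    then have "card (insert i (good \<sigma>)) \<le> card (good ?\<tau>)"
      using I by (intro card_mono) (auto simp: good_def)
    moreover have "card (insert i (good \<sigma>)) = Suc (card (good \<sigma>))"
      using I ik by (subst card_insert_disjoint) (auto simp: good_def)
    ultimately show False using max[of ?\<tau>] by simp
  qed
  have bad: "card {i\<in>I. \<beta> i = v \<and> \<alpha> (\<sigma> i) \<noteq> v} \<le> R" if v: "v \<in> V" for v
  proof (cases "\<exists>i\<in>I. \<beta> i = v \<and> \<alpha> (\<sigma> i) \<noteq> v")
    case False
    then have "{i\<in>I. \<beta> i = v \<and> \<alpha> (\<sigma> i) \<noteq> v} = {}" by blast
    then show ?thesis by (metis card.empty le0)
  next
    case True
    then obtain i where i: "i \<in> I" "\<beta> i = v" "\<alpha> (\<sigma> i) \<noteq> v" by blast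
    have sub: "{i\<in>I. \<alpha> (\<sigma> i) = v} \<subseteq> {i\<in>I. \<beta> i = v}"
      using no_swap[OF i(1)] i by auto
    have "{i\<in>I. \<alpha> i = v} = \<sigma> ` {i\<in>I. \<alpha> (\<sigma> i) = v}"
    proof (intro equalityI subsetI)
      fix j assume j: "j \<in> {i\<in>I. \<alpha> i = v}"
      have "\<sigma> (inv_into UNIV \<sigma> j) = j" using \<sigma> by (simp add: permutes_inverses)
      then show "j \<in> \<sigma> ` {i\<in>I. \<alpha> (\<sigma> i) = v}"
        using j mem[of "inv_into UNIV \<sigma> j"] by (intro image_eqI[of _ _ "inv_into UNIV \<sigma> j"]) auto
    qed (use mem in auto)
    then have "card {i\<in>I. \<alpha> i = v} = card {i\<in>I. \<alpha> (\<sigma> i) = v}"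
      using card_image[OF permutes_inj_on[OF \<sigma>]] by simp
    moreover have "{i\<in>I. \<beta> i = v \<and> \<alpha> (\<sigma> i) \<noteq> v} = {i\<in>I. \<beta> i = v} - {i\<in>I. \<alpha> (\<sigma> i) = v}" by auto
    ultimately show ?thesis
      using R[OF v] I sub by (simp add: card_Diff_subset)
  qed
  have "{i\<in>I. \<alpha> (\<sigma> i) \<noteq> \<beta> i} = (\<Union>v\<in>V. {i\<in>I. \<beta> i = v \<and> \<alpha> (\<sigma> i) \<noteq> v})"
    using V by auto
  then have "card {i\<in>I. \<alpha> (\<sigma> i) \<noteq> \<beta> i} \<le> (\<Sum>v\<in>V. card {i\<in>I. \<beta> i = v \<and> \<alpha> (\<sigma> i) \<noteq> v})"
    using V(1) by (simp only: card_UN_le)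
  also have "\<dots> \<le> card V * R" using sum_bounded_above[OF bad, of V] by simp
  finally show ?thesis using that \<sigma> by blast
qed

text \<open>Uniform continuity at the one scale \<delta> N gives no Lipschitz constant, so f is
  first regularised. Chebyshev bounds the bad set of each regularised function, and a union bound
  over \<open>F\<close> and the translates leaves a good \<open>p\<close>. The 9 in
  \<open>large\<close> is the square of the 3 in \<open>c = 3 / (\<delta> * N)\<close>; the 4 counts
  the passages from f to its regularisation and on to the mean, at both permutations.\<close>

lemma permutation_concentration:
  fixes \<delta> \<epsilon> N :: real
  assumes I: "finite I" and F: "finite F" and S: "finite \<Sigma>" "\<And>\<sigma>. \<sigma> \<in> \<Sigma> \<Longrightarrow> \<sigma> permutes I"
    and pos: "\<delta> > 0" "\<epsilon> > 0" "N > 0"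
    and range: "\<And>f p. f \<in> F \<Longrightarrow> p permutes I \<Longrightarrow> 0 \<le> f p \<and> f p \<le> 1"
    and unif: "\<And>f p q. f \<in> F \<Longrightarrow> p permutes I \<Longrightarrow> q permutes I \<Longrightarrow> card {x. p x \<noteq> q x} \<le> \<delta> * N \<Longrightarrow> \<bar>f p - f q\<bar> \<le> \<epsilon>"
    and large: "card F * (card \<Sigma> + 1) * card I * 9 < (\<epsilon> * \<delta> * N)\<^sup>2"
  obtains p where "p permutes I" "\<And>f \<sigma>. f \<in> F \<Longrightarrow> \<sigma> \<in> \<Sigma> \<Longrightarrow> \<bar>f (\<sigma> \<circ> p) - f p\<bar> \<le> 4 * \<epsilon>"
proof -
  define P where "P = {p. p permutes I}"
  have P: "finite P" "P \<noteq> {}" using I by (auto simp: P_def finite_permutations intro: exI[of _ id] permutes_id)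
  have card_P: "card P = fact (card I)" unfolding P_def using I by (rule card_permutations[OF refl])
  define D where "D p q = real (card {x. p x \<noteq> q x})" for p q :: "'a \<Rightarrow> 'a"
  have fin: "finite {x. p x \<noteq> q x}" if "p \<in> P" "q \<in> P" for p q
    using that by (intro finite_subset[OF _ I]) (auto simp: P_def permutes_def, metis)
  have D_tri: "D p q \<le> D p r + D r q" if "p \<in> P" "q \<in> P" "r \<in> P" for p q r
  proof -
    have "card {x. p x \<noteq> q x} \<le> card ({x. p x \<noteq> r x} \<union> {x. r x \<noteq> q x})"
      using fin that by (intro card_mono) auto
    also have "\<dots> \<le> card {x. p x \<noteq> r x} + card {x. r x \<noteq> q x}" by (rule card_Un_le)
    finally show ?thesis by (simp add: D_def)
  qed
  \<comment> \<open>the inf-convolution of \<open>f\<close>, which is Lipschitz and within \<open>\<epsilon>\<close> of \<open>f\<close>\<close>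
  define f' where "f' f p = (MIN q\<in>P. f q + D p q / (\<delta> * N))" for f :: "('a \<Rightarrow> 'a) \<Rightarrow> real" and p
  have f'_le: "f' f p \<le> f q + D p q / (\<delta> * N)" if "q \<in> P" for f p q
    unfolding f'_def using P that by (intro Min_le) auto
  have f'_att: "\<exists>q\<in>P. f' f p = f q + D p q / (\<delta> * N)" for f p
  proof -
    have "f' f p \<in> (\<lambda>q. f q + D p q / (\<delta> * N)) ` P" unfolding f'_def using P by (intro Min_in) auto
    then show ?thesis by auto
  qed
  have close: "f' f p \<le> f p \<and> f p \<le> f' f p + \<epsilon>" if f: "f \<in> F" and p: "p \<in> P" for f p
  proof
    show "f' f p \<le> f p" using f'_le[OF p, of f p] by (simp add: D_def)
    obtain q where q: "q \<in> P" "f' f p = f q + D p q / (\<delta> * N)" using f'_att by blast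
    show "f p \<le> f' f p + \<epsilon>"
    proof (cases "D p q \<le> \<delta> * N")
      case True
      then have "\<bar>f p - f q\<bar> \<le> \<epsilon>" using unif[OF f, of p q] p q(1) by (auto simp: D_def P_def)
      moreover have "D p q / (\<delta> * N) \<ge> 0" using pos by (simp add: D_def)
      ultimately show ?thesis using q by linarith
    next
      case False
      \<comment> \<open>A distant minimiser pays a penalty of at least 1, which is no less than
        \<open>f p\<close> since the values lie in [0,1].\<close>
      then have "D p q / (\<delta> * N) \<ge> 1" using pos by (simp add: field_simps)
      moreover have "f p \<le> 1" "0 \<le> f q" using range[OF f, of p] range[OF f, of q] p q(1) by (auto simp: P_def)
      ultimately show ?thesis using q(2) pos(2) by linarith
    qed
  qed
  have lip1: "f' f p \<le> f' f q + 3 / (\<delta> * N)"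
    if pq: "p \<in> P" "q \<in> P" "card {x. p x \<noteq> q x} \<le> 3" for f p q
  proof -
    obtain r where r: "r \<in> P" "f' f q = f r + D q r / (\<delta> * N)" using f'_att by blast
    have "D p r \<le> 3 + D q r" using D_tri[OF pq(1) r(1) pq(2)] pq(3) by (simp add: D_def)
    then have "D p r / (\<delta> * N) \<le> (3 + D q r) / (\<delta> * N)" using pos by (intro divide_right_mono) auto
    then show ?thesis using f'_le[OF r(1), of f p] r(2) by (simp add: add_divide_distrib)
  qed
  define c where "c = 3 / (\<delta> * N)"
  have lip: "\<bar>f' f p - f' f q\<bar> \<le> c" if "p \<in> P" "q \<in> P" "card {x. p x \<noteq> q x} \<le> 3" for f p q
    using lip1[OF that, of f] lip1[of q p f] that by (simp add: c_def eq_commute abs_le_iff)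
  have "\<exists>m. (\<Sum>p\<in>P. (f' f p - m)\<^sup>2) \<le> fact (card I) * (card I * c\<^sup>2)" for f
    by (rule permutation_variance[OF I, of "f' f" c]) (use lip in \<open>auto simp: P_def\<close>)
  then obtain m where m: "\<And>f. (\<Sum>p\<in>P. (f' f p - m f)\<^sup>2) \<le> fact (card I) * (card I * c\<^sup>2)" by metis
  define B where "B f = {p\<in>P. \<epsilon> < \<bar>f' f p - m f\<bar>}" for f
  have cheb: "card (B f) * \<epsilon>\<^sup>2 \<le> fact (card I) * (card I * c\<^sup>2)" for f
  proof -
    have "card (B f) * \<epsilon>\<^sup>2 = (\<Sum>p\<in>B f. \<epsilon>\<^sup>2)" by simp
    also have "\<dots> \<le> (\<Sum>p\<in>B f. (f' f p - m f)\<^sup>2)"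
    proof (intro sum_mono)
      fix p assume "p \<in> B f"
      then have "\<epsilon>\<^sup>2 \<le> \<bar>f' f p - m f\<bar>\<^sup>2" using pos by (intro power_mono) (auto simp: B_def)
      then show "\<epsilon>\<^sup>2 \<le> (f' f p - m f)\<^sup>2" by simp
    qed
    also have "\<dots> \<le> (\<Sum>p\<in>P. (f' f p - m f)\<^sup>2)" using P by (intro sum_mono2) (auto simp: B_def)
    finally show ?thesis using m[of f] by linarith
  qed
  \<comment> \<open>With \<open>id\<close> included, avoiding all bad sets places the values at
    \<open>\<sigma> \<circ> p\<close> and at \<open>p\<close> near the same mean.\<close>
  define S1 where "S1 = insert id \<Sigma>"
  have S1: "finite S1" "card S1 \<le> card \<Sigma> + 1" "\<And>\<sigma>. \<sigma> \<in> S1 \<Longrightarrow> \<sigma> permutes I"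
    using S permutes_id[of I] card_insert_le_m1[of "card \<Sigma> + 1" \<Sigma> id] by (auto simp: S1_def)
  define Bad where "Bad = (\<Union>f\<in>F. \<Union>\<sigma>\<in>S1. {p\<in>P. \<sigma> \<circ> p \<in> B f})"
  \<comment> \<open>Composition with a fixed permutation is injective, so a translate of a bad set
    is no larger than the bad set.\<close>
  have pre: "card {p\<in>P. \<sigma> \<circ> p \<in> B f} \<le> card (B f)" if "\<sigma> \<in> S1" for \<sigma> f
  proof (rule card_inj_on_le)
    show "inj_on ((\<circ>) \<sigma>) {p\<in>P. \<sigma> \<circ> p \<in> B f}"
      using permutes_inj[OF S1(3)[OF that]] by (auto intro!: inj_onI dest: fun.inj_map_strong) (metis fun.inj_map injD)
  qed (use P in \<open>auto simp: B_def\<close>)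
  define b where "b = fact (card I) * (card I * c\<^sup>2) / \<epsilon>\<^sup>2"
  have Bb: "card (B f) \<le> b" for f using cheb[of f] pos by (simp add: b_def field_simps)
  have b0: "b \<ge> 0" by (simp add: b_def)
  have "card Bad \<le> (\<Sum>f\<in>F. card (\<Union>\<sigma>\<in>S1. {p\<in>P. \<sigma> \<circ> p \<in> B f}))"
    unfolding Bad_def using F by (intro card_UN_le)
  also have "\<dots> \<le> (\<Sum>f\<in>F. \<Sum>\<sigma>\<in>S1. card {p\<in>P. \<sigma> \<circ> p \<in> B f})"
    using S1(1) by (intro sum_mono card_UN_le)
  finally have "card Bad \<le> (\<Sum>f\<in>F. \<Sum>\<sigma>\<in>S1. real (card {p\<in>P. \<sigma> \<circ> p \<in> B f}))"
    by (metis (mono_tags, lifting) of_nat_le_iff of_nat_sum sum.cong)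
  also have "\<dots> \<le> (\<Sum>f\<in>F. \<Sum>\<sigma>\<in>S1. b)"
    using pre Bb by (intro sum_mono) (meson of_nat_le_iff order_trans)
  also have "\<dots> = card F * (card S1 * b)" by simp
  also have "\<dots> \<le> card F * ((card \<Sigma> + 1) * b)"
    using S1(2) b0 by (intro mult_left_mono mult_right_mono) (auto simp flip: of_nat_Suc)
  also have "\<dots> = fact (card I) * ((card F * (card \<Sigma> + 1) * card I * 9) / (\<epsilon> * \<delta> * N)\<^sup>2)"
    using pos by (simp add: b_def c_def field_simps)
  also have "\<dots> < fact (card I) * 1" using large pos by (intro mult_strict_left_mono) auto
  finally have "card Bad < card P" by (metis card_P of_nat_fact of_nat_less_iff mult.right_neutral)
  moreover have "Bad \<subseteq> P" by (auto simp: Bad_def)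
  ultimately obtain p where p: "p \<in> P" "p \<notin> Bad" by (metis less_irrefl subsetI subset_antisym)
  have ok: "\<bar>f' f (\<sigma> \<circ> p) - m f\<bar> \<le> \<epsilon>" "\<sigma> \<circ> p \<in> P" if "f \<in> F" "\<sigma> \<in> S1" for f \<sigma>
  proof -
    show "\<sigma> \<circ> p \<in> P" using p S1(3)[OF that(2)] by (auto simp: P_def intro: permutes_compose)
    then show "\<bar>f' f (\<sigma> \<circ> p) - m f\<bar> \<le> \<epsilon>" using p that by (auto simp: Bad_def B_def not_less)
  qed
  show ?thesis
  proof
    show "p permutes I" using p by (simp add: P_def)
    fix f \<sigma> assume f: "f \<in> F" "\<sigma> \<in> \<Sigma>"
    have "id \<in> S1" "\<sigma> \<in> S1" using f by (auto simp: S1_def)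
    then show "\<bar>f (\<sigma> \<circ> p) - f p\<bar> \<le> 4 * \<epsilon>"
      using ok[OF f(1), of \<sigma>] ok[OF f(1), of id] close[OF f(1), of "\<sigma> \<circ> p"] close[OF f(1), of p] p
      unfolding id_comp abs_le_iff by linarith
  qed
qed

section \<open>The group of measure-preserving automorphisms\<close>

abbreviation aut_class :: "'a measure \<Rightarrow> ('a \<Rightarrow> 'a) \<Rightarrow> ('a \<Rightarrow> 'a) set" where
  "aut_class M T \<equiv> ae_eq M `` {T}"

text \<open>Restricted to the space because members of \<open>Bij (space M)\<close> are
  \<open>undefined\<close> elsewhere; this is the inverse in the group, whereas
  \<open>inv_into\<close> alone is not extensional.\<close>

definition mp_inv :: "'a measure \<Rightarrow> ('a \<Rightarrow> 'a) \<Rightarrow> 'a \<Rightarrow> 'a" where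
  "mp_inv M T = restrict (inv_into (space M) T) (space M)"

lemma mp_automorphismD:
  assumes "T \<in> mp_automorphisms M"
  shows "T \<in> Bij (space M)" "T \<in> measurable M M" "inv_into (space M) T \<in> measurable M M" "distr M M T = M"
    "bij_betw T (space M) (space M)" "T \<in> extensional (space M)"
  using assms by (auto simp: mp_automorphisms_def Bij_def)

lemma mp_automorphism_space: "T \<in> mp_automorphisms M \<Longrightarrow> x \<in> space M \<Longrightarrow> T x \<in> space M"
  using mp_automorphismD(2) measurable_space by metis

lemma mp_automorphism_emeasure:
  assumes "T \<in> mp_automorphisms M" "B \<in> sets M"
  shows "emeasure M (T -` B \<inter> space M) = emeasure M B"
  using emeasure_distr[OF mp_automorphismD(2)[OF assms(1)] assms(2)] mp_automorphismD(4)[OF assms(1)] by simp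

text \<open>Measurability of \<open>inv_into\<close> is read off from an explicit inverse
  \<open>R\<close>, which agrees with it on the space and may be arbitrary outside.\<close>

lemma mp_automorphismI:
  assumes T: "T \<in> measurable M M" "T \<in> extensional (space M)" and R: "R \<in> measurable M M"
    and inv: "\<And>p. p \<in> space M \<Longrightarrow> R (T p) = p" "\<And>p. p \<in> space M \<Longrightarrow> T (R p) = p"
    and em: "\<And>B. B \<in> sets M \<Longrightarrow> emeasure M (T -` B \<inter> space M) = emeasure M B"
  shows "T \<in> mp_automorphisms M"
proof -
  have sp: "T p \<in> space M" "R p \<in> space M" if "p \<in> space M" for p
    using that T(1) R by (auto intro: measurable_space)
  have bij: "bij_betw T (space M) (space M)"
    by (rule bij_betw_byWitness[of _ R]) (use inv sp in auto)
  have "inv_into (space M) T p = R p" if "p \<in> space M" for p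
    using bij inv(2) sp(2) that by (metis bij_betw_imp_inj_on inv_into_f_f)
  then have "inv_into (space M) T \<in> measurable M M" using R by (simp cong: measurable_cong)
  moreover have "distr M M T = M"
    using T(1) em by (intro measure_eqI) (auto simp: emeasure_distr)
  ultimately show ?thesis using T bij by (auto simp: mp_automorphisms_def Bij_def)
qed

lemma mp_inv_cancel:
  assumes "T \<in> mp_automorphisms M" "x \<in> space M"
  shows "T (mp_inv M T x) = x" "mp_inv M T (T x) = x"
  using assms mp_automorphismD(5)[OF assms(1)] mp_automorphism_space[OF assms]
  by (auto simp: mp_inv_def bij_betw_inv_into_right bij_betw_inv_into_left)

lemma mp_inv_automorphism:
  assumes T: "T \<in> mp_automorphisms M"
  shows "mp_inv M T \<in> mp_automorphisms M"
proof (rule mp_automorphismI[of _ _ T])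
  have "mp_inv M T \<in> measurable M M \<longleftrightarrow> inv_into (space M) T \<in> measurable M M"
    by (intro measurable_cong) (simp add: mp_inv_def)
  then show meas: "mp_inv M T \<in> measurable M M" using mp_automorphismD(3)[OF T] by simp
  show "mp_inv M T \<in> extensional (space M)" by (simp add: mp_inv_def)
  fix B assume B: "B \<in> sets M"
  have "T -` (mp_inv M T -` B \<inter> space M) \<inter> space M = B"
    using sets.sets_into_space[OF B] mp_inv_cancel[OF T] mp_automorphism_space[OF T] by auto
  then show "emeasure M (mp_inv M T -` B \<inter> space M) = emeasure M B"
    using mp_automorphism_emeasure[OF T measurable_sets[OF meas B]] by simp
qed (simp_all add: T mp_inv_cancel[OF T] mp_automorphismD(2)[OF T])

lemma compose_automorphism:
  assumes S: "S \<in> mp_automorphisms M" and T: "T \<in> mp_automorphisms M"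
  shows "compose (space M) S T \<in> mp_automorphisms M"
proof (rule mp_automorphismI[of _ _ "\<lambda>x. mp_inv M T (mp_inv M S x)"])
  have cong: "compose (space M) S T \<in> measurable M M \<longleftrightarrow> (\<lambda>x. S (T x)) \<in> measurable M M"
    by (intro measurable_cong) (simp add: compose_def)
  then show "compose (space M) S T \<in> measurable M M"
    using measurable_compose[OF mp_automorphismD(2)[OF T] mp_automorphismD(2)[OF S]] by simp
  show "compose (space M) S T \<in> extensional (space M)" by simp
  show "(\<lambda>x. mp_inv M T (mp_inv M S x)) \<in> measurable M M"
    by (rule measurable_compose[OF mp_automorphismD(2)[OF mp_inv_automorphism[OF S]]
          mp_automorphismD(2)[OF mp_inv_automorphism[OF T]]])
  fix B assume B: "B \<in> sets M"
  have "compose (space M) S T -` B \<inter> space M = T -` (S -` B \<inter> space M) \<inter> space M"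
    using mp_automorphism_space[OF T] by (auto simp: compose_def)
  then show "emeasure M (compose (space M) S T -` B \<inter> space M) = emeasure M B"
    using mp_automorphism_emeasure[OF S B]
      mp_automorphism_emeasure[OF T measurable_sets[OF mp_automorphismD(2)[OF S] B]] by simp
qed (use S T in \<open>auto simp: compose_def mp_inv_cancel mp_automorphism_space mp_inv_automorphism\<close>)

lemma id_automorphism: "(\<lambda>x\<in>space M. x) \<in> mp_automorphisms M"
proof (rule mp_automorphismI[of _ _ "\<lambda>x. x"])
  have "(\<lambda>x\<in>space M. x) \<in> measurable M M \<longleftrightarrow> (\<lambda>x. x) \<in> measurable M M"
    by (intro measurable_cong) simp
  then show "(\<lambda>x\<in>space M. x) \<in> measurable M M" by simp
  fix B assume B: "B \<in> sets M"
  then have "(\<lambda>x\<in>space M. x) -` B \<inter> space M = B" using sets.sets_into_space[OF B] by auto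
  then show "emeasure M ((\<lambda>x\<in>space M. x) -` B \<inter> space M) = emeasure M B" by simp
qed auto

lemma AE_automorphism:
  assumes "T \<in> mp_automorphisms M" "AE x in M. P x"
  shows "AE x in M. P (T x)"
proof -
  have "AE x in distr M M T. P x"
    by (subst mp_automorphismD(4)[OF assms(1)]) (rule assms(2))
  then show ?thesis by (rule AE_distrD[OF mp_automorphismD(2)[OF assms(1)]])
qed

lemma carrier_mp_group [simp]: "carrier (mp_group M) = mp_automorphisms M"
  and one_mp_group [simp]: "\<one>\<^bsub>mp_group M\<^esub> = (\<lambda>x\<in>space M. x)"
  by (simp_all add: mp_group_def BijGroup_def)

lemma mult_mp_group:
  "S \<in> mp_automorphisms M \<Longrightarrow> T \<in> mp_automorphisms M \<Longrightarrow> S \<otimes>\<^bsub>mp_group M\<^esub> T = compose (space M) S T"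
  by (simp add: mp_group_def BijGroup_def mp_automorphismD)

lemma inv_BijGroup_eq: "T \<in> mp_automorphisms M \<Longrightarrow> inv\<^bsub>BijGroup (space M)\<^esub> T = mp_inv M T"
  by (simp add: inv_BijGroup mp_automorphismD mp_inv_def)

lemma subgroup_mp: "subgroup (mp_automorphisms M) (BijGroup (space M))"
proof (rule group.subgroupI[OF group_BijGroup])
  show "mp_automorphisms M \<subseteq> carrier (BijGroup (space M))"
    by (auto simp: BijGroup_def mp_automorphismD)
  show "mp_automorphisms M \<noteq> {}" using id_automorphism by blast
  fix S T assume S: "S \<in> mp_automorphisms M" 
  then show "inv\<^bsub>BijGroup (space M)\<^esub> S \<in> mp_automorphisms M"
    by (simp add: inv_BijGroup_eq mp_inv_automorphism)
  assume T: "T \<in> mp_automorphisms M"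
  show "S \<otimes>\<^bsub>BijGroup (space M)\<^esub> T \<in> mp_automorphisms M"
    using S T by (simp add: BijGroup_def mp_automorphismD compose_automorphism)
qed

lemma group_mp_group: "group (mp_group M)"
  unfolding mp_group_def by (rule subgroup.subgroup_is_group[OF subgroup_mp group_BijGroup])

lemma inv_mp_group:
  assumes "T \<in> mp_automorphisms M"
  shows "inv\<^bsub>mp_group M\<^esub> T = mp_inv M T"
proof (rule group.inv_equality[OF group_mp_group])
  show "mp_inv M T \<otimes>\<^bsub>mp_group M\<^esub> T = \<one>\<^bsub>mp_group M\<^esub>"
    using assms by (auto simp: mult_mp_group mp_inv_automorphism compose_def mp_inv_cancel fun_eq_iff)
qed (use assms mp_inv_automorphism in auto)

section \<open>Almost everywhere equality as a quotient by a normal subgroup\<close>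

definition null_automorphisms :: "'a measure \<Rightarrow> ('a \<Rightarrow> 'a) set" where
  "null_automorphisms M = {T \<in> mp_automorphisms M. AE x in M. T x = x}"

text \<open>For normality: T S T^-1 fixes x as soon as S fixes T^-1 x, and since T^-1 preserves the
  measure this holds for almost every x.\<close>

lemma normal_null_automorphisms: "null_automorphisms M \<lhd> mp_group M"
proof -
  interpret group "mp_group M" by (rule group_mp_group)
  have "subgroup (null_automorphisms M) (mp_group M)"
  proof (rule subgroupI)
    show "null_automorphisms M \<subseteq> carrier (mp_group M)" by (auto simp: null_automorphisms_def)
    have "(\<lambda>x\<in>space M. x) \<in> null_automorphisms M"
      using id_automorphism by (auto simp: null_automorphisms_def)
    then show "null_automorphisms M \<noteq> {}" by blast
    fix S T assume S': "S \<in> null_automorphisms M"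
    then have S: "S \<in> mp_automorphisms M" "AE x in M. S x = x" by (auto simp: null_automorphisms_def)
    have "AE x in M. mp_inv M S x = x"
      using S(2) AE_space by eventually_elim (metis mp_inv_cancel(2) S(1))
    then show "inv\<^bsub>mp_group M\<^esub> S \<in> null_automorphisms M"
      using S by (simp add: inv_mp_group null_automorphisms_def mp_inv_automorphism)
    assume "T \<in> null_automorphisms M"
    then have T: "T \<in> mp_automorphisms M" "AE x in M. T x = x" by (auto simp: null_automorphisms_def)
    have "AE x in M. compose (space M) S T x = x"
      using S(2) T(2) AE_space by eventually_elim (simp add: compose_def)
    then show "S \<otimes>\<^bsub>mp_group M\<^esub> T \<in> null_automorphisms M"
      using S T by (simp add: mult_mp_group null_automorphisms_def compose_automorphism)
  qed
  moreover have "T \<otimes>\<^bsub>mp_group M\<^esub> S \<otimes>\<^bsub>mp_group M\<^esub> inv\<^bsub>mp_group M\<^esub> T \<in> null_automorphisms M"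
    if T: "T \<in> carrier (mp_group M)" and "S \<in> null_automorphisms M" for S T
  proof -
    have T: "T \<in> mp_automorphisms M" and S: "S \<in> mp_automorphisms M" "AE x in M. S x = x"
      using that by (auto simp: null_automorphisms_def)
    have "AE x in M. S (mp_inv M T x) = mp_inv M T x"
      by (rule AE_automorphism[OF mp_inv_automorphism[OF T] S(2)])
    then have "AE x in M. compose (space M) (compose (space M) T S) (mp_inv M T) x = x"
      using AE_space
      by eventually_elim
        (simp add: compose_def mp_inv_cancel[OF T] mp_automorphism_space[OF mp_inv_automorphism[OF T]])
    then show ?thesis
      using S T by (simp add: mult_mp_group inv_mp_group null_automorphisms_def compose_automorphism mp_inv_automorphism)
  qed
  ultimately show ?thesis by (simp add: normal_inv_iff)
qed

lemma aut_class_eq_coset: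
  assumes T: "T \<in> mp_automorphisms M"
  shows "aut_class M T = null_automorphisms M #>\<^bsub>mp_group M\<^esub> T"
proof (intro equalityI subsetI)
  fix S assume "S \<in> aut_class M T"
  then have S: "S \<in> mp_automorphisms M" "AE x in M. T x = S x" by (auto simp: ae_eq_def)
  have "AE x in M. T (mp_inv M T x) = S (mp_inv M T x)"
    by (rule AE_automorphism[OF mp_inv_automorphism[OF T] S(2)])
  then have "AE x in M. compose (space M) S (mp_inv M T) x = x"
    using AE_space by eventually_elim (simp add: compose_def mp_inv_cancel[OF T])
  then have "compose (space M) S (mp_inv M T) \<in> null_automorphisms M"
    using S T by (simp add: null_automorphisms_def compose_automorphism mp_inv_automorphism)
  moreover have "S = compose (space M) (compose (space M) S (mp_inv M T)) T"
    using mp_automorphismD(6)[OF S(1)]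
    by (auto simp: compose_def mp_inv_cancel[OF T] mp_automorphism_space[OF T] fun_eq_iff extensional_def)
  then have "S = compose (space M) S (mp_inv M T) \<otimes>\<^bsub>mp_group M\<^esub> T"
    using S(1) T by (simp add: mult_mp_group compose_automorphism mp_inv_automorphism)
  ultimately show "S \<in> null_automorphisms M #>\<^bsub>mp_group M\<^esub> T" by (auto simp: r_coset_def)
next
  fix S assume "S \<in> null_automorphisms M #>\<^bsub>mp_group M\<^esub> T"
  then obtain R where R: "R \<in> mp_automorphisms M" "AE x in M. R x = x" "S = compose (space M) R T"
    using T by (auto simp: r_coset_def null_automorphisms_def mult_mp_group)
  have "AE x in M. R (T x) = T x" by (rule AE_automorphism[OF T R(2)])
  then have "AE x in M. T x = S x" using AE_space by eventually_elim (simp add: R(3) compose_def)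
  then show "S \<in> aut_class M T" using R T by (simp add: ae_eq_def compose_automorphism)
qed

text \<open>The classes are the cosets of the null automorphisms and \<open>set_mult\<close> is the
  product of cosets, so the group laws are those of a quotient group.\<close>

lemma Aut_eq_FactGroup: "Aut M = mp_group M Mod null_automorphisms M"
proof -
  interpret normal "null_automorphisms M" "mp_group M" by (rule normal_null_automorphisms)
  have "mp_automorphisms M // ae_eq M = rcosets\<^bsub>mp_group M\<^esub> null_automorphisms M"
    by (auto simp: quotient_def RCOSETS_def aut_class_eq_coset)
  moreover have "aut_class M \<one>\<^bsub>mp_group M\<^esub> = null_automorphisms M"
    using aut_class_eq_coset[OF id_automorphism, of M] coset_mult_one[OF subset] by simp
  ultimately show ?thesis by (simp add: Aut_def FactGroup_def)
qed

lemma group_Aut: "group (Aut M)"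
  unfolding Aut_eq_FactGroup by (rule normal.factorgroup_is_group[OF normal_null_automorphisms])

lemma carrier_Aut: "carrier (Aut M) = aut_class M ` mp_automorphisms M"
  by (auto simp: Aut_def quotient_def)

lemma one_Aut: "\<one>\<^bsub>Aut M\<^esub> = aut_class M (\<lambda>x\<in>space M. x)"
  by (simp add: Aut_def)

lemma mult_Aut:
  assumes "S \<in> mp_automorphisms M" "T \<in> mp_automorphisms M"
  shows "aut_class M S \<otimes>\<^bsub>Aut M\<^esub> aut_class M T = aut_class M (compose (space M) S T)"
  using assms normal.rcos_sum[OF normal_null_automorphisms, of S M T]
  by (simp add: Aut_eq_FactGroup aut_class_eq_coset mult_mp_group compose_automorphism)

lemma inv_Aut:
  assumes "T \<in> mp_automorphisms M"
  shows "inv\<^bsub>Aut M\<^esub> (aut_class M T) = aut_class M (mp_inv M T)"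
proof (rule group.inv_equality[OF group_Aut])
  have "compose (space M) (mp_inv M T) T = (\<lambda>x\<in>space M. x)"
    using assms by (auto simp: compose_def mp_inv_cancel fun_eq_iff)
  then show "aut_class M (mp_inv M T) \<otimes>\<^bsub>Aut M\<^esub> aut_class M T = \<one>\<^bsub>Aut M\<^esub>"
    using assms by (simp add: mult_Aut mp_inv_automorphism one_Aut)
qed (use assms mp_inv_automorphism in \<open>auto simp: carrier_Aut\<close>)

section \<open>Polish spaces with a finite diffuse measure\<close>

text \<open>Base 3 with digits 0 and 1 leaves a gap: at the first difference n one side gains
  (1/3)^n, while all later digits together contribute at most half of that. In base 2 the tail could
  make up for the digit.\<close>

lemma ternary_expansion_inj:
  fixes a b :: "nat \<Rightarrow> bool"
  assumes "(\<Sum>n. of_bool (a n) * (1/3)^n :: real) = (\<Sum>n. of_bool (b n) * (1/3)^n)"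
  shows "a = b"
proof (rule ccontr)
  have summ: "summable (\<lambda>n. of_bool (c n) * (1/3)^n :: real)" for c :: "nat \<Rightarrow> bool"
    by (rule summable_comparison_test'[of "\<lambda>n. (1/3)^n" 0]) (auto simp: summable_geometric)
  have less: "(\<Sum>n. of_bool (a n) * (1/3)^n :: real) > (\<Sum>n. of_bool (b n) * (1/3)^n)"
    if n: "a n" "\<not> b n" "\<And>k. k < n \<Longrightarrow> a k = b k" for a b :: "nat \<Rightarrow> bool" and n
  proof -
    let ?s = "\<Sum>k<n. of_bool (a k) * (1/3)^k :: real"
    have "(\<Sum>k. of_bool (b k) * (1/3)^k :: real) =
        (\<Sum>k. of_bool (b (k + Suc n)) * (1/3)^(k + Suc n)) + (\<Sum>k<Suc n. of_bool (b k) * (1/3)^k)"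
      by (rule suminf_split_initial_segment[OF summ])
    also have "(\<Sum>k<Suc n. of_bool (b k) * (1/3)^k :: real) = ?s" using n by simp
    also have "(\<Sum>k. of_bool (b (k + Suc n)) * (1/3)^(k + Suc n) :: real) \<le> (\<Sum>k. (1/3)^k * (1/3)^Suc n)"
      using summable_ignore_initial_segment[OF summ, of b "Suc n"]
      by (intro suminf_le) (auto simp: power_add intro!: summable_mult2 summable_geometric)
    also have "\<dots> = (\<Sum>k. (1/3)^k) * (1/3)^Suc n"
      by (rule suminf_mult2[symmetric]) (auto simp: summable_geometric)
    also have "(\<Sum>k. (1/3)^k :: real) = 3 / 2" by (subst suminf_geometric) auto
    also have "3 / 2 * (1/3::real)^Suc n < (1/3)^n" by simp
    also have "(1/3)^n + ?s = (\<Sum>k<Suc n. of_bool (a k) * (1/3)^k :: real)" using n by simp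
    also have "\<dots> \<le> (\<Sum>k. of_bool (a k) * (1/3)^k :: real)"
      by (rule sum_le_suminf[OF summ]) auto
    finally show ?thesis by simp
  qed
  assume "a \<noteq> b"
  then obtain k where "a k \<noteq> b k" by blast
  then have "\<exists>n. a n \<noteq> b n \<and> (\<forall>k<n. a k = b k)"
    by (rule exE[OF exists_least_iff[THEN iffD1], OF exI]) auto
  then obtain n where n: "a n \<noteq> b n" "\<And>k. k < n \<Longrightarrow> a k = b k" by blast
  then show False using less[of a n b] less[of b n a] assms by (cases "a n") auto
qed

section \<open>Coding a Polish space by real numbers\<close>

locale polish_finite_measure = Metric_space S d + finite_measure \<nu>
  for S :: "'a set" and d :: "'a \<Rightarrow> 'a \<Rightarrow> real" and \<nu> :: "'a measure" +
  fixes x :: "nat \<Rightarrow> 'a"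
  assumes complete: "mcomplete"
    and x_mem: "\<And>n. x n \<in> S"
    and x_dense: "\<And>p e. p \<in> S \<Longrightarrow> 0 < e \<Longrightarrow> \<exists>n. d (x n) p < e"
    and sets_eq: "sets \<nu> = sigma_sets S {U. openin mtopology U}"
begin

lemma space_eq: "space \<nu> = S"
proof -
  have "S \<in> sets \<nu>" unfolding sets_eq by (rule sigma_sets_top)
  moreover have "{U. openin mtopology U} \<subseteq> Pow S" using openin_subset[of mtopology] by auto
  then have "A \<subseteq> S" if "A \<in> sets \<nu>" for A
    using that unfolding sets_eq by (rule sigma_sets_into_sp)
  ultimately show ?thesis using sets.sets_into_space sets.top by blast
qed

lemma open_sets: "openin mtopology U \<Longrightarrow> U \<in> sets \<nu>"
  unfolding sets_eq by (auto intro: sigma_sets.Basic)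

lemma closed_sets: "closedin mtopology A \<Longrightarrow> A \<in> sets \<nu>"
proof -
  assume A: "closedin mtopology A"
  then have "space \<nu> - (S - A) \<in> sets \<nu>" by (intro sets.compl_sets open_sets) (simp add: closedin_def)
  moreover have "space \<nu> - (S - A) = A" using closedin_subset[OF A] space_eq by auto
  ultimately show ?thesis by simp
qed

definition cell :: "nat \<Rightarrow> 'a set" where
  "cell n = mball (x (fst (prod_decode n))) (1 / Suc (snd (prod_decode n)))"

lemma cell_encode: "cell (prod_encode (i, j)) = mball (x i) (1 / Suc j)"
  by (simp add: cell_def)

lemma cell_sets: "cell n \<in> sets \<nu>"
  by (simp add: cell_def open_sets)

lemma cell_separates:
  assumes "p \<in> S" "q \<in> S" "p \<noteq> q"
  shows "\<exists>n. p \<in> cell n \<and> q \<notin> cell n"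
proof -
  have "d p q > 0" using assms by simp
  then obtain j where j: "1 / Suc j < d p q / 2" by (metis half_gt_zero nat_approx_posE)
  obtain i where i: "d (x i) p < 1 / Suc j" using x_dense[OF assms(1), of "1 / Suc j"] by auto
  have "d p q \<le> d (x i) p + d (x i) q" using triangle'[of p "x i" q] assms x_mem by (simp add: commute)
  then have "q \<notin> cell (prod_encode (i, j))" using i j by (simp add: cell_encode in_mball)
  moreover have "p \<in> cell (prod_encode (i, j))" using i assms x_mem by (simp add: cell_encode in_mball)
  ultimately show ?thesis by blast
qed

text \<open>A Borel injection into a set of Cantor type: the digits record membership in a countable
  family of balls that separates points. It moves the measure to the line, where it has a
  distribution function.\<close>

definition code :: "'a \<Rightarrow> real" where
  "code p = (\<Sum>n. of_bool (p \<in> cell n) * (1/3)^n)"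

lemma code_inj: "inj_on code S"
proof (rule inj_onI, rule ccontr)
  fix p q assume pq: "p \<in> S" "q \<in> S" "code p = code q" "p \<noteq> q"
  have "(\<lambda>n. p \<in> cell n) = (\<lambda>n. q \<in> cell n)"
    by (rule ternary_expansion_inj) (use pq in \<open>simp add: code_def\<close>)
  then show False using cell_separates[OF pq(1,2,4)] by metis
qed

lemma code_measurable: "code \<in> borel_measurable \<nu>"
proof -
  have "(\<lambda>p. of_bool (p \<in> cell n) * (1/3)^n :: real) \<in> borel_measurable \<nu>" for n
  proof -
    have "(\<lambda>p. indicator (cell n) p * (1/3)^n :: real) \<in> borel_measurable \<nu>"
      by (intro borel_measurable_times borel_measurable_indicator cell_sets) simp
    then show ?thesis by (simp add: indicator_def)
  qed
  then show ?thesis unfolding code_def[abs_def] by (rule borel_measurable_suminf)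
qed

lemma code_approx: "\<bar>code p - (\<Sum>k<n. of_bool (p \<in> cell k) * (1/3)^k)\<bar> \<le> (1/3)^n * (3/2)"
proof -
  have summ: "summable (\<lambda>k. of_bool (p \<in> cell k) * (1/3)^k :: real)"
    by (rule summable_comparison_test'[of "\<lambda>n. (1/3)^n" 0]) (auto simp: summable_geometric)
  have "code p - (\<Sum>k<n. of_bool (p \<in> cell k) * (1/3)^k) = (\<Sum>k. of_bool (p \<in> cell (k + n)) * (1/3)^(k + n))"
    unfolding code_def using suminf_split_initial_segment[OF summ, of n] by simp
  moreover have "0 \<le> (\<Sum>k. of_bool (p \<in> cell (k + n)) * (1/3)^(k + n) :: real)"
    using summable_ignore_initial_segment[OF summ, of n] by (intro suminf_nonneg) auto
  moreover have "(\<Sum>k. of_bool (p \<in> cell (k + n)) * (1/3)^(k + n) :: real) \<le> (\<Sum>k. (1/3)^k * (1/3)^n)"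
    using summable_ignore_initial_segment[OF summ, of n]
    by (intro suminf_le) (auto simp: power_add intro!: summable_mult2 summable_geometric)
  moreover have "(\<Sum>k. (1/3)^k * (1/3)^n :: real) = (1/3)^n * (3/2)"
    by (subst suminf_mult2[symmetric]) (auto simp: summable_geometric suminf_geometric)
  ultimately show ?thesis by simp
qed

text \<open>Under the hypothesis every cell is clopen relative to \<open>K\<close>, so every digit
  is continuous there, and the series converges uniformly.\<close>

lemma code_continuous:
  assumes "\<And>n. \<exists>C. closedin mtopology C \<and> cell n \<inter> K = C \<inter> K"
  shows "continuous_map (subtopology mtopology K) euclideanreal code"
proof -
  have step: "continuous_map (subtopology mtopology K) euclideanreal (\<lambda>p. of_bool (p \<in> cell n) * (1/3)^n)" for n
  proof -
    have "openin (subtopology mtopology K) (cell n \<inter> K)"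
      by (auto simp: openin_subtopology cell_def)
    moreover have "closedin (subtopology mtopology K) (cell n \<inter> K)"
      using assms[of n] by (auto simp: closedin_subtopology)
    ultimately have op: "openin (subtopology mtopology K) (cell n \<inter> K)"
      "openin (subtopology mtopology K) (topspace (subtopology mtopology K) - cell n \<inter> K)"
      by (auto simp: closedin_def)
    show ?thesis unfolding continuous_map_def
    proof (intro conjI allI impI)
      fix U :: "real set"
      have "{p \<in> topspace (subtopology mtopology K). of_bool (p \<in> cell n) * (1/3)^n \<in> U} =
        (if (1/3)^n \<in> U then cell n \<inter> K else {}) \<union>
        (if 0 \<in> U then topspace (subtopology mtopology K) - cell n \<inter> K else {})"
        using openin_subset[OF op(1)] by auto
      then show "openin (subtopology mtopology K)
          {p \<in> topspace (subtopology mtopology K). of_bool (p \<in> cell n) * (1/3)^n \<in> U}"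
        using op openin_topspace[of "subtopology mtopology K"] by (auto intro!: openin_Un)
    qed simp
  qed
  have "continuous_map (subtopology mtopology K) (Met_TC.mtopology) code"
  proof (rule Met_TC.continuous_map_uniform_limit)
    show "\<forall>\<^sub>F n in sequentially. continuous_map (subtopology mtopology K) Met_TC.mtopology
        (\<lambda>p. \<Sum>k<n. of_bool (p \<in> cell k) * (1/3)^k :: real)"
      unfolding mtopology_is_euclidean by (intro always_eventually allI continuous_map_sum step) auto
    fix e :: real assume e: "0 < e"
    have "(\<lambda>n. (1/3::real)^n * (3/2)) \<longlonglongrightarrow> 0 * (3/2)" by (intro tendsto_mult LIMSEQ_realpow_zero) auto
    then have "\<forall>\<^sub>F n in sequentially. (1/3::real)^n * (3/2) < e"
      by (rule order_tendstoD(2)) (use e in simp)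
    then show "\<forall>\<^sub>F n in sequentially. \<forall>p\<in>topspace (subtopology mtopology K). code p \<in> UNIV \<and>
        dist (\<Sum>k<n. of_bool (p \<in> cell k) * (1/3)^k :: real) (code p) < e"
      by eventually_elim (auto simp only: dist_real_def abs_minus_commute[of _ "code _"] intro: le_less_trans[OF code_approx])
  qed simp
  then show ?thesis by simp
qed

text \<open>The given centres may lie outside \<open>K\<close>. A point of \<open>K\<close> picked
  in each ball that meets \<open>K\<close> serves as a new centre, at the price of doubling the
  radius.\<close>

lemma mtotally_bounded_outer:
  assumes "K \<subseteq> S" and "\<And>e. 0 < e \<Longrightarrow> \<exists>F. finite F \<and> F \<subseteq> S \<and> K \<subseteq> (\<Union>c\<in>F. mball c e)"
  shows "mtotally_bounded K"
  unfolding mtotally_bounded_def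
proof (intro allI impI)
  fix e :: real assume "0 < e"
  then obtain F where F: "finite F" "F \<subseteq> S" "K \<subseteq> (\<Union>c\<in>F. mball c (e / 2))" using assms(2)[of "e/2"] by auto
  define h where "h c = (SOME p. p \<in> K \<inter> mball c (e/2))" for c
  define F' where "F' = {c\<in>F. K \<inter> mball c (e/2) \<noteq> {}}"
  have h: "h c \<in> K \<inter> mball c (e/2)" if "c \<in> F'" for c
    unfolding h_def by (rule someI_ex) (use that in \<open>auto simp: F'_def\<close>)
  have "K \<subseteq> (\<Union>c\<in>h ` F'. mball c e)"
  proof
    fix p assume p: "p \<in> K"
    then obtain c where c: "c \<in> F" "p \<in> mball c (e/2)" using F by blast
    then have "c \<in> F'" using p by (auto simp: F'_def)
    with h[OF this] c have "d (h c) p < e"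
      using triangle[of "h c" c p] by (auto simp: in_mball commute)
    then show "p \<in> (\<Union>c\<in>h ` F'. mball c e)"
      using h[OF \<open>c \<in> F'\<close>] p assms(1) \<open>c \<in> F'\<close> by (auto simp: in_mball intro!: bexI[of _ c])
  qed
  then show "\<exists>F. finite F \<and> F \<subseteq> K \<and> K \<subseteq> (\<Union>c\<in>F. mball c e)"
    using F(1) h by (intro exI[of _ "h ` F'"]) (auto simp: F'_def)
qed

text \<open>On an intersection of sets \<open>layer n (\<kappa> n)\<close> over all \<open>n\<close>, every \<open>cell n\<close> is relatively clopen, so that
  \<open>code\<close> is continuous, and finitely many balls of any given radius suffice.\<close>

definition layer :: "nat \<Rightarrow> nat \<Rightarrow> 'a set" where
  "layer n k = (mcball (x (fst (prod_decode n))) (1 / Suc (snd (prod_decode n)) - 1 / Suc k) \<union> (S - cell n))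
     \<inter> (\<Union>i\<le>k. mcball (x i) (1 / Suc n))"

lemma layer_closed: "closedin mtopology (layer n k)"
  unfolding layer_def cell_def
  by (intro closedin_Int closedin_Un closedin_Union)
    (auto intro!: closedin_diff simp: closedin_mspace[unfolded topspace_mtopology])

lemma layer_incseq: "incseq (layer n)"
proof (rule incseq_SucI)
  fix k
  have "1 / Suc (Suc k) \<le> (1 / Suc k :: real)" by (intro divide_left_mono) auto
  then show "layer n k \<subseteq> layer n (Suc k)"
    unfolding layer_def by (intro Int_mono Un_mono UN_mono mcball_subset_concentric) auto
qed

lemma layer_Union: "(\<Union>k. layer n k) = S"
proof (intro equalityI subsetI)
  fix p assume p: "p \<in> S"
  obtain k1 where k1: "d (x k1) p < 1 / Suc n" using x_dense[OF p, of "1 / Suc n"] by auto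
  obtain k2 where k2: "p \<in> mcball (x (fst (prod_decode n))) (1 / Suc (snd (prod_decode n)) - 1 / Suc k2) \<union> (S - cell n)"
  proof (cases "p \<in> cell n")
    case True
    then have "0 < 1 / Suc (snd (prod_decode n)) - d (x (fst (prod_decode n))) p"
      by (simp add: cell_def in_mball)
    then obtain k where "1 / Suc k < 1 / Suc (snd (prod_decode n)) - d (x (fst (prod_decode n))) p"
      by (rule nat_approx_posE)
    then show ?thesis using that[of k] p x_mem by (auto simp: in_mcball)
  qed (use p that in auto)
  have "1 / Suc (max k1 k2) \<le> (1 / Suc k2 :: real)" by (intro divide_left_mono) auto
  then have "p \<in> layer n (max k1 k2)"
    unfolding layer_def using k1 k2 p x_mem[of k1]
    by (auto simp: in_mcball intro!: bexI[of _ k1])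
  then show "p \<in> (\<Union>k. layer n k)" by blast
qed (auto simp: layer_def)

text \<open>Tightness and Lusin's theorem in one construction. The layers increase to the whole
  space, so from the n-th a member can be chosen that omits mass at most e / 2^(n+1); the
  intersection of the chosen layers is closed and totally bounded, hence compact by
  completeness.\<close>

lemma inner_compact:
  assumes "0 < e"
  obtains K where "compactin mtopology K" "measure \<nu> (S - K) \<le> e"
    "continuous_map (subtopology mtopology K) euclideanreal code"
proof -
  have "\<exists>k. measure \<nu> (S - layer n k) \<le> e * (1/2)^Suc n" for n
  proof -
    have "(\<lambda>k. measure \<nu> (S - layer n k)) \<longlonglongrightarrow> measure \<nu> (\<Inter>k. S - layer n k)"
      using layer_incseq[of n] layer_closed closed_sets space_eq
      by (intro finite_Lim_measure_decseq) (auto simp: decseq_def incseq_def)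
    moreover have "(\<Inter>k. S - layer n k) = {}" using layer_Union[of n] by auto
    ultimately have "(\<lambda>k. measure \<nu> (S - layer n k)) \<longlonglongrightarrow> 0" by (simp only: measure_empty)
    then have "\<forall>\<^sub>F k in sequentially. measure \<nu> (S - layer n k) < e * (1/2)^Suc n"
      by (rule order_tendstoD(2)) (use assms in simp)
    then show ?thesis by (meson eventually_happens' less_imp_le sequentially_bot)
  qed
  then obtain \<kappa> where \<kappa>: "\<And>n. measure \<nu> (S - layer n (\<kappa> n)) \<le> e * (1/2)^Suc n" by metis
  define K where "K = (\<Inter>n. layer n (\<kappa> n))"
  have K_closed: "closedin mtopology K" unfolding K_def using layer_closed by auto
  have K_sub: "K \<subseteq> S" using closedin_subset[OF K_closed] by simp
  have K_layer: "K \<subseteq> layer n (\<kappa> n)" for n by (auto simp: K_def)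
  have "mtotally_bounded K"
  proof (rule mtotally_bounded_outer[OF K_sub])
    fix r :: real assume "0 < r"
    then obtain n where n: "1 / Suc n < r" by (rule nat_approx_posE)
    have "K \<subseteq> (\<Union>c\<in>x ` {..\<kappa> n}. mball c r)"
    proof
      fix p assume "p \<in> K"
      then obtain i where i: "i \<le> \<kappa> n" "p \<in> mcball (x i) (1 / Suc n)" using K_layer[of n] by (auto simp: layer_def)
      then have "p \<in> mball (x i) r" using n by (auto simp: in_mcball in_mball)
      then show "p \<in> (\<Union>c\<in>x ` {..\<kappa> n}. mball c r)" using i by auto
    qed
    then show "\<exists>F. finite F \<and> F \<subseteq> S \<and> K \<subseteq> (\<Union>c\<in>F. mball c r)"
      using x_mem by (intro exI[of _ "x ` {..\<kappa> n}"]) auto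
  qed
  moreover have "mtopology closure_of K = K" using K_closed by (simp add: closure_of_closedin)
  ultimately have comp: "compactin mtopology K"
    using mtotally_bounded_eq_compact_closure_of[OF complete] K_sub by metis
  have "measure \<nu> (S - K) \<le> e"
  proof -
    have "S - K = (\<Union>n. S - layer n (\<kappa> n))" by (auto simp: K_def)
    moreover have "S - layer n (\<kappa> n) \<in> sets \<nu>" for n
      by (metis sets.compl_sets space_eq layer_closed closed_sets)
    moreover have summ: "summable (\<lambda>n. e * (1/2::real)^Suc n)"
      by (intro summable_mult) (auto simp: summable_geometric)
    moreover have summ': "summable (\<lambda>n. measure \<nu> (S - layer n (\<kappa> n)))"
      by (rule summable_comparison_test'[OF summ]) (use \<kappa> in auto)
    ultimately have "measure \<nu> (S - K) \<le> (\<Sum>n. measure \<nu> (S - layer n (\<kappa> n)))"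
      by (simp only:) (rule finite_measure_subadditive_countably, auto)
    also have "\<dots> \<le> (\<Sum>n. e * (1/2)^Suc n)" by (rule suminf_le[OF \<kappa> summ' summ])
    also have "\<dots> = e" using power_half_series[THEN sums_mult, of e] by (simp add: sums_iff)
    finally show ?thesis .
  qed
  moreover have "continuous_map (subtopology mtopology K) euclideanreal code"
  proof (rule code_continuous)
    fix n
    let ?C = "mcball (x (fst (prod_decode n))) (1 / Suc (snd (prod_decode n)) - 1 / Suc (\<kappa> n))"
    \<comment> \<open>The smaller radius puts the closed ball inside the open cell, while the layer
      excludes the points of the cell beyond it. On \<open>K\<close> the two coincide, so the cell
      is relatively closed.\<close>
    have "1 / Suc (snd (prod_decode n)) - 1 / Suc (\<kappa> n) < (1 / Suc (snd (prod_decode n)) :: real)" by simp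
    then have "?C \<subseteq> cell n" unfolding cell_def by (auto simp only: in_mcball in_mball intro: le_less_trans)
    then have "cell n \<inter> K = ?C \<inter> K" using K_layer[of n] by (auto simp: layer_def)
    then show "\<exists>C. closedin mtopology C \<and> cell n \<inter> K = C \<inter> K" by (intro exI[of _ ?C]) auto
  qed
  ultimately show ?thesis using comp that by blast
qed

abbreviation code_cdf :: "real \<Rightarrow> real" where
  "code_cdf \<equiv> cdf (distr \<nu> borel code)"

text \<open>The probability integral transform of \<open>code\<close>: when the distribution
  function is continuous, it carries \<nu> to Lebesgue measure on the interval from 0 to the total
  mass.\<close>

definition quantile :: "'a \<Rightarrow> real" where
  "quantile p = code_cdf (code p)"

end

section \<open>Diffuse measures and the uniform distribution\<close>

locale diffuse_polish_measure = polish_finite_measure +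
  assumes no_atoms: "\<And>p. p \<in> S \<Longrightarrow> measure \<nu> {p} = 0"
begin

sublocale D: finite_borel_measure "distr \<nu> borel code"
  using finite_measure_distr[OF code_measurable] by (simp add: finite_borel_measure_def finite_borel_measure_axioms_def)

text \<open>A jump would be the mass of a fibre of \<open>code\<close>, and by injectivity a fibre
  has at most one point.\<close>

lemma cdf_isCont: "isCont (code_cdf) t"
proof -
  have "measure (distr \<nu> borel code) {t} = measure \<nu> (code -` {t} \<inter> S)"
    using code_measurable by (simp add: measure_distr space_eq)
  also have "\<dots> = 0"
  proof (cases "\<exists>p\<in>S. code p = t")
    case True
    then obtain p where p: "p \<in> S" "code p = t" by blast
    then have "code -` {t} \<inter> S = {p}" using code_inj by (auto simp: inj_on_def)
    then show ?thesis using no_atoms p by simp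
  next
    case False
    then have "code -` {t} \<inter> S = {}" by auto
    then show ?thesis by simp
  qed
  finally show ?thesis by (simp add: D.isCont_cdf)
qed

lemma quantile_measurable: "quantile \<in> borel_measurable \<nu>"
proof -
  have "code_cdf \<in> borel_measurable borel"
    using cdf_isCont by (intro borel_measurable_continuous_onI) (simp add: continuous_on_eq_continuous_at)
  from measurable_compose[OF code_measurable this] show ?thesis by (simp add: quantile_def[abs_def])
qed

text \<open>For t in the range of interest, the sublevel set of the distribution function F is a
  half line with right end s, and continuity gives F s = t. The points with \<open>quantile\<close>
  at most t are then those with code at most s, which have mass F s.\<close>

lemma quantile_distribution:
  "measure \<nu> {p\<in>S. quantile p \<le> t} = max 0 (min t (measure \<nu> S))"
proof -
  let ?F = "code_cdf" and ?c = "measure \<nu> S"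
  have F_code: "?F s = measure \<nu> {p\<in>S. code p \<le> s}" for s
    using code_measurable by (simp add: cdf_def measure_distr space_eq) (simp add: vimage_def Int_def conj_commute)
  have F_range: "0 \<le> ?F s" "?F s \<le> ?c" for s
    using bounded_measure[of "{p\<in>S. code p \<le> s}"] by (auto simp: F_code space_eq)
  have F_top: "(?F \<longlongrightarrow> ?c) at_top"
    using D.cdf_lim_at_top code_measurable by (simp add: measure_distr space_eq)
  consider "t < 0" | "t \<ge> ?c" | "0 \<le> t" "t < ?c" by linarith
  then show ?thesis
  proof cases
    case 1
    have "0 \<le> quantile p" for p by (simp add: quantile_def F_range(1))
    then have "{p\<in>S. quantile p \<le> t} = {}" using 1 by (auto simp: not_le intro: less_le_trans)
    then show ?thesis using 1 by (simp only: measure_empty)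
  next
    case 2
    have "quantile p \<le> ?c" for p by (simp add: quantile_def F_range(2))
    then have "{p\<in>S. quantile p \<le> t} = S" using 2 by (auto intro: order_trans)
    then show ?thesis using 2 by simp
  next
    case 3
    have up: "\<exists>u. \<forall>s. ?F s \<le> t \<longrightarrow> s \<le> u"
    proof -
      have "\<forall>\<^sub>F s in at_top. t < ?F s" using F_top 3 by (intro order_tendstoD)
      then obtain u where "\<And>s. s \<ge> u \<Longrightarrow> t < ?F s" by (auto simp: eventually_at_top_linorder)
      then show ?thesis by (meson linorder_le_cases not_less)
    qed
    show ?thesis
    proof (cases "\<exists>s. ?F s \<le> t")
      case False
      have "?F s \<ge> t" for s using False by (simp add: not_le less_imp_le)
      \<comment> \<open>If F exceeds t everywhere, its limit 0 at minus infinity leaves only t =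
        0.\<close>
      then have "t \<le> 0" using D.cdf_lim_at_bot by (intro tendsto_lowerbound[of ?F 0 at_bot]) auto
      then have "t = 0" using 3 by simp
      have "{p\<in>S. quantile p \<le> t} = {}" using False by (auto simp: quantile_def)
      then have "measure \<nu> {p\<in>S. quantile p \<le> t} = 0" by (simp only: measure_empty)
      then show ?thesis using \<open>t = 0\<close> 3 by simp
    next
      case True
      define s where "s = Sup {s. ?F s \<le> t}"
      have bdd: "bdd_above {s. ?F s \<le> t}" using up by (auto simp: bdd_above_def)
      have "closed {s. ?F s \<le> t}"
        using cdf_isCont by (intro closed_Collect_le continuous_intros) (simp_all add: continuous_on_eq_continuous_at)
      then have s1: "?F s \<le> t" using closed_contains_Sup[OF _ bdd] True unfolding s_def by auto
      have below: "?F r \<le> t \<longleftrightarrow> r \<le> s" for r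
        using cSup_upper[OF _ bdd, of r] D.cdf_nondecreasing[of r s] s1 by (auto simp: s_def)
      \<comment> \<open>To the right of s the values exceed t, so continuity supplies the inequality
        opposite to \<open>s1\<close>.\<close>
      have "?F s \<ge> t"
      proof (rule tendsto_lowerbound)
        show "(?F \<longlongrightarrow> ?F s) (at_right s)" using cdf_isCont[of s] by (simp add: isCont_def filterlim_at_split)
        show "\<forall>\<^sub>F r in at_right s. t \<le> ?F r"
          using below by (auto simp: eventually_at_right_field intro!: exI[of _ "s + 1"]) (meson less_imp_le not_le)
      qed simp
      then have "?F s = t" using s1 by simp
      moreover have "{p\<in>S. quantile p \<le> t} = {p\<in>S. code p \<le> s}" by (auto simp: quantile_def below)
      ultimately show ?thesis using 3 F_code[of s] by simp
    qed
  qed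
qed

definition collisions :: "real set" where
  "collisions = {t. \<exists>p\<in>S. \<exists>q\<in>S. p \<noteq> q \<and> quantile p = t \<and> quantile q = t}"

text \<open>If two codes have the same value t under the monotone distribution function, it is
  constant between them, so t is also its value at a rational number in between.\<close>

lemma countable_collisions: "countable collisions"
proof (rule countable_subset)
  show "collisions \<subseteq> code_cdf ` \<rat>"
  proof
    fix t assume "t \<in> collisions"
    then obtain p q where pq: "p \<in> S" "q \<in> S" "p \<noteq> q" "quantile p = t" "quantile q = t"
      by (auto simp: collisions_def)
    then have "code p \<noteq> code q" using code_inj by (auto simp: inj_on_def)
    then have "min (code p) (code q) < max (code p) (code q)" by (simp add: min_def max_def)
    then obtain r where r: "r \<in> \<rat>" "min (code p) (code q) < r" "r < max (code p) (code q)"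
      using Rats_dense_in_real by blast
    have "code_cdf (min (code p) (code q)) = t" "code_cdf (max (code p) (code q)) = t"
      using pq by (auto simp: quantile_def min_def max_def)
    then have "code_cdf r = t"
      using r D.cdf_nondecreasing[of "min (code p) (code q)" r] D.cdf_nondecreasing[of r "max (code p) (code q)"] by simp
    then show "t \<in> code_cdf ` \<rat>" using r by blast
  qed
qed (simp add: countable_rat)

lemma quantile_level_null: "measure \<nu> {p\<in>S. quantile p = t} = 0"
proof (rule antisym)
  have sets: "{p\<in>S. quantile p \<le> s} \<in> sets \<nu>" for s
    using measurable_sets[OF quantile_measurable, of "{..s}"] by (simp add: space_eq vimage_def Int_def conj_commute)
  have "measure \<nu> {p\<in>S. quantile p = t} \<le> e" if "0 < e" for e
  proof -
    have "measure \<nu> {p\<in>S. quantile p = t} \<le> measure \<nu> ({p\<in>S. quantile p \<le> t} - {p\<in>S. quantile p \<le> t - e})"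
      using sets that by (intro finite_measure_mono) auto
    also have "\<dots> = measure \<nu> {p\<in>S. quantile p \<le> t} - measure \<nu> {p\<in>S. quantile p \<le> t - e}"
      using sets that by (intro finite_measure_Diff) auto
    also have "\<dots> \<le> e" using that by (simp add: quantile_distribution max_def min_def)
    finally show ?thesis .
  qed
  then show "measure \<nu> {p\<in>S. quantile p = t} \<le> 0" by (rule field_le_epsilon[where y=0, simplified])
qed simp

text \<open>A Borel image of a Borel set need not be Borel. On \<open>K\<close>, however, the map is
  continuous, so relatively closed sets have compact images; the property passes to countable unions
  at once and to complements because the map is injective up to countably many values.\<close>

lemma quantile_image_compact:
  assumes K: "compactin mtopology K" "continuous_map (subtopology mtopology K) euclideanreal code"
    and A: "A \<in> sets \<nu>"
  shows "quantile ` (A \<inter> K) \<in> sets borel"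
proof -
  have K_sub: "K \<subseteq> S" using compactin_subset_topspace[OF K(1)] by simp
  have "continuous_map euclideanreal euclideanreal (code_cdf)"
    using cdf_isCont by (simp add: continuous_on_eq_continuous_at)
  from continuous_map_compose[OF K(2) this]
  have cont: "continuous_map (subtopology mtopology K) euclideanreal quantile"
    by (simp add: quantile_def[abs_def] comp_def)
  have closed_image: "quantile ` (A \<inter> K) \<in> sets borel" if "closedin mtopology A" for A
  proof -
    have "compactin (subtopology mtopology K) (A \<inter> K)"
      using closed_Int_compactin[OF that K(1)] by (simp add: compactin_subtopology)
    then have "compact (quantile ` (A \<inter> K))" using image_compactin[OF _ cont] by simp
    then show ?thesis by (intro borel_closed compact_imp_closed)
  qed
  \<comment> \<open>As \<open>quantile\<close> takes only countably many values more than once, it maps complements to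
    complements up to a countable set.\<close>
  have compl: "quantile ` ((S - A) \<inter> K) \<in> sets borel" if "quantile ` (A \<inter> K) \<in> sets borel" for A
  proof -
    have split: "quantile ` ((S - A) \<inter> K) = (quantile ` (S \<inter> K) - quantile ` (A \<inter> K)) \<union>
        (quantile ` ((S - A) \<inter> K) \<inter> quantile ` (A \<inter> K))" using K_sub by blast
    have "quantile ` ((S - A) \<inter> K) \<inter> quantile ` (A \<inter> K) \<subseteq> collisions"
    proof
      fix t assume "t \<in> quantile ` ((S - A) \<inter> K) \<inter> quantile ` (A \<inter> K)"
      then obtain p q where pq: "p \<in> (S - A) \<inter> K" "q \<in> A \<inter> K" "quantile p = t" "quantile q = t" by auto
      then have "p \<in> S" "q \<in> S" "p \<noteq> q" using K_sub by auto
      then show "t \<in> collisions"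
        unfolding collisions_def by (intro CollectI bexI[of _ p] bexI[of _ q] conjI pq(3,4))
    qed
    then have "countable (quantile ` ((S - A) \<inter> K) \<inter> quantile ` (A \<inter> K))"
      using countable_collisions countable_subset by blast
    then have small: "quantile ` ((S - A) \<inter> K) \<inter> quantile ` (A \<inter> K) \<in> sets borel"
      by (rule sets.countable[rotated]) simp
    have "quantile ` (S \<inter> K) \<in> sets borel" using closed_image[of S] by simp
    then show ?thesis by (subst split) (intro sets.Un sets.Diff that small)
  qed
  from A[unfolded sets_eq] show ?thesis
  proof induction
    case (Basic U)
    then have "closedin mtopology (S - U)" by auto
    from compl[OF closed_image[OF this]] Basic show ?case
      by (simp add: double_diff openin_subset[of mtopology, simplified])
  next
    case (Union A)
    have "quantile ` ((\<Union>i. A i) \<inter> K) = (\<Union>i. quantile ` (A i \<inter> K))" by auto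
    then show ?case using Union by auto
  qed (use compl in auto)
qed

text \<open>Compact sets from the Lusin argument exhaust the space up to a null set. Removing the
  preimage of the collisions, a countable union of null level sets, makes the map injective while
  images remain Borel.\<close>

lemma quantile_isomorphism:
  obtains S' where "S' \<in> sets \<nu>" "measure \<nu> (S - S') = 0" "inj_on quantile S'"
    "\<And>A. A \<in> sets \<nu> \<Longrightarrow> A \<subseteq> S' \<Longrightarrow> quantile ` A \<in> sets borel"
proof -
  have "\<exists>K. compactin mtopology K \<and> measure \<nu> (S - K) \<le> 1 / Suc n \<and>
      continuous_map (subtopology mtopology K) euclideanreal code" for n
    using inner_compact[of "1 / Suc n"] by (metis of_nat_0_less_iff zero_less_Suc zero_less_divide_1_iff)
  then obtain K where K: "\<And>n. compactin mtopology (K n)" "\<And>n. measure \<nu> (S - K n) \<le> 1 / Suc n"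
    "\<And>n. continuous_map (subtopology mtopology (K n)) euclideanreal code" by metis
  have K_sets: "K n \<in> sets \<nu>" for n
    using K(1) by (intro closed_sets compactin_imp_closedin) (auto simp: Hausdorff_space_mtopology)
  have S_sets: "S \<in> sets \<nu>" using sets.top[of \<nu>] by (simp add: space_eq)
  define Q where "Q = {p\<in>S. quantile p \<in> collisions}"
  have Q: "Q \<in> sets \<nu>"
    using measurable_sets[OF quantile_measurable sets.countable[OF _ countable_collisions]]
    by (simp add: Q_def space_eq vimage_def Int_def conj_commute)
  have "measure \<nu> Q = 0"
  proof -
    have "(\<Union>t\<in>collisions. {p\<in>S. quantile p = t}) \<in> null_sets \<nu>"
    proof (intro null_sets_UN' countable_collisions)
      fix t show "{p\<in>S. quantile p = t} \<in> null_sets \<nu>"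
        using measurable_sets[OF quantile_measurable, of "{t}"] quantile_level_null[of t]
        by (simp add: null_sets_def emeasure_eq_measure space_eq vimage_def Int_def conj_commute)
    qed
    moreover have "(\<Union>t\<in>collisions. {p\<in>S. quantile p = t}) = Q" by (auto simp: Q_def)
    ultimately show ?thesis by (simp add: null_sets_def measure_def)
  qed
  define S' where "S' = (\<Union>n. K n) - Q"
  show ?thesis
  proof
    show S'_sets: "S' \<in> sets \<nu>" using K_sets Q by (auto simp: S'_def)
    have "measure \<nu> (S - S') \<le> e" if "0 < e" for e
    proof -
      obtain n where n: "1 / Suc n < e" using \<open>0 < e\<close> by (rule nat_approx_posE)
      have "measure \<nu> (S - S') \<le> measure \<nu> ((S - K n) \<union> Q)"
        using K_sets Q S_sets by (intro finite_measure_mono) (auto simp: S'_def)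
      also have "\<dots> \<le> measure \<nu> (S - K n) + measure \<nu> Q"
        using K_sets Q S_sets by (intro measure_Un_le) auto
      also have "\<dots> \<le> e" using K(2)[of n] n \<open>measure \<nu> Q = 0\<close> by simp
      finally show ?thesis .
    qed
    then have "measure \<nu> (S - S') \<le> 0" by (rule field_le_epsilon[where y=0, simplified])
    then show "measure \<nu> (S - S') = 0" by (simp add: antisym)
    have "S' \<subseteq> S" using sets.sets_into_space[OF S'_sets] by (simp add: space_eq)
    then show "inj_on quantile S'" by (auto simp: inj_on_def S'_def Q_def collisions_def)
    fix A assume A: "A \<in> sets \<nu>" "A \<subseteq> S'"
    then have "A = (\<Union>n. A \<inter> K n)" by (auto simp: S'_def)
    then have "quantile ` A = (\<Union>n. quantile ` (A \<inter> K n))" by (metis image_UN)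
    then show "quantile ` A \<in> sets borel" using quantile_image_compact[OF K(1,3) A(1)] by auto
  qed
qed

end

section \<open>Partitions into pieces of equal measure\<close>

text \<open>Coordinates on \<open>C\<close> modulo null sets: the transform above, applied to the
  measure restricted to \<open>C\<close>, is uniformly distributed and has a Borel inverse on a
  conull subset.\<close>

lemma uniformizing_map:
  assumes "standard_borel M" "nonatomic M" and C: "C \<in> sets M" "emeasure M C < \<infinity>"
  obtains g C' where "g \<in> borel_measurable M"
    "\<And>t. measure M {p\<in>C. g p \<le> t} = max 0 (min t (measure M C))"
    "C' \<in> sets M" "C' \<subseteq> C" "emeasure M (C - C') = 0" "inj_on g C'"
    "\<And>A. A \<in> sets M \<Longrightarrow> A \<subseteq> C' \<Longrightarrow> g ` A \<in> sets borel"
proof -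
  obtain X where X: "topspace X = space M" "completely_metrizable_space X" "separable_space X"
    "sets M = sigma_sets (topspace X) {U. openin X U}"
    using assms(1) unfolding standard_borel_def by blast
  obtain S d where "Metric_space S d" and compl: "Metric_space.mcomplete S d" and X_eq: "X = Metric_space.mtopology S d"
    using X(2) unfolding completely_metrizable_space_def by blast
  interpret Metric_space S d by fact
  have S: "S = space M" using X(1) X_eq by simp
  obtain D where D: "countable D" "D \<subseteq> S" "mtopology closure_of D = S"
    using X(3) X_eq unfolding separable_space_def by auto
  show ?thesis
  proof (cases "S = {}")
    case True
    then have "C = {}" using sets.sets_into_space[OF C(1)] S by auto
    then show ?thesis by (intro that[of "\<lambda>_. 0" "{}"]) auto
  next
    case False
    then have D_ne: "D \<noteq> {}" using D(3) by auto
    define x where "x = from_nat_into D"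
    \<comment> \<open>A density restricts the measure to \<open>C\<close> but keeps the underlying
      space, so the complete metric of the whole space can be used and \<open>C\<close> needs no
      topology of its own.\<close>
    define \<nu> where "\<nu> = density M (indicator C)"
    have em: "emeasure \<nu> A = emeasure M (C \<inter> A)" if "A \<in> sets M" for A
      unfolding \<nu>_def using C(1) that by (rule emeasure_restricted)
    have ms: "measure \<nu> A = measure M (C \<inter> A)" if "A \<in> sets M" for A
      using em[OF that] by (simp add: measure_def)
    interpret finite_measure \<nu>
      using em[of "space M"] C sets.sets_into_space[OF C(1)]
      by (intro finite_measureI) (simp add: \<nu>_def Int_absorb2)
    interpret polish_finite_measure S d \<nu> x
    proof
      show "x n \<in> S" for n using D D_ne from_nat_into[of D] by (auto simp: x_def)
      show "\<exists>n. d (x n) p < e" if pe: "p \<in> S" "0 < e" for p e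
      proof -
        have "p \<in> mtopology closure_of D" using pe D(3) by simp
        then obtain y where y: "y \<in> D" "y \<in> mball p e" using pe(2) unfolding metric_closure_of by blast
        then obtain n where "x n = y" using D(1) by (metis from_nat_into_surj x_def)
        then show ?thesis using y by (auto simp: in_mball commute)
      qed
      show "sets \<nu> = sigma_sets S {U. openin mtopology U}" using X(4) X_eq by (simp add: \<nu>_def)
    qed (rule compl)
    have sets_M: "sets M = sets \<nu>" by (simp add: \<nu>_def)
    interpret diffuse_polish_measure S d \<nu> x
    proof
      fix p assume p: "p \<in> S"
      have p_sets: "{p} \<in> sets M" unfolding sets_M
        by (rule closed_sets) (use p in \<open>simp add: closedin_Hausdorff_sing_eq Hausdorff_space_mtopology\<close>)
      have "emeasure M {p} = 0"
      proof (rule ccontr)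
        assume "emeasure M {p} \<noteq> 0"
        \<comment> \<open>A point has only two subsets, itself and the empty set, and neither has
          intermediate mass.\<close>
        then obtain B where "B \<subseteq> {p}" "0 < emeasure M B" "emeasure M B < emeasure M {p}"
          using assms(2) p_sets unfolding nonatomic_def by (metis zero_less_iff_neq_zero)
        then show False by (metis emeasure_empty less_irrefl subset_singletonD)
      qed
      then have "emeasure M (C \<inter> {p}) = 0" using p_sets by (metis Int_lower2 emeasure_mono le_zero_eq)
      then show "measure \<nu> {p} = 0" using ms[OF p_sets] by (simp add: measure_def)
    qed
    obtain S' where S': "S' \<in> sets \<nu>" "measure \<nu> (S - S') = 0" "inj_on quantile S'"
      "\<And>A. A \<in> sets \<nu> \<Longrightarrow> A \<subseteq> S' \<Longrightarrow> quantile ` A \<in> sets borel"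
      by (rule quantile_isomorphism) blast
    have sub: "C \<subseteq> S" using sets.sets_into_space[OF C(1)] S by simp
    show ?thesis
    proof (rule that[of quantile "S' \<inter> C"])
      show meas: "quantile \<in> borel_measurable M"
        using quantile_measurable by (simp add: \<nu>_def)
      fix t
      have "{p\<in>S. quantile p \<le> t} \<in> sets M"
        using measurable_sets[OF meas, of "{..t}"] S by (simp add: vimage_def Int_def conj_commute)
      from ms[OF this] have "measure \<nu> {p\<in>S. quantile p \<le> t} = measure M {p\<in>C. quantile p \<le> t}"
        using sub by (simp add: Int_def) (metis (mono_tags, lifting) subsetD)
      moreover have "measure \<nu> S = measure M C"
        using ms[of S] sub S by (simp add: Int_absorb2)
      ultimately show "measure M {p\<in>C. quantile p \<le> t} = max 0 (min t (measure M C))"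
        using quantile_distribution[of t] by simp
    next
      have "measure M (C \<inter> (S - S')) = 0"
        using S'(1,2) ms[of "S - S'"] S sets_M by (metis sets.compl_sets)
      moreover have "C \<inter> (S - S') = C - S' \<inter> C" using sub by auto
      moreover have "emeasure M (C - S' \<inter> C) < \<infinity>"
        using C by (meson Diff_subset emeasure_mono le_less_trans)
      ultimately show "emeasure M (C - S' \<inter> C) = 0"
        by (auto simp: measure_def enn2real_eq_0_iff)
    qed (use S' C sets_M in \<open>auto intro: inj_on_subset\<close>)
  qed
qed

text \<open>Cut \<open>C\<close> at the levels k / N of a uniformly distributed coordinate. Only
  full slices count; the remainder consists of the null set where the coordinate is at most 0 and of
  a top part of mass at most 1 / N.\<close>

lemma slices:
  assumes M: "standard_borel M" "nonatomic M" and C: "C \<in> sets M" "emeasure M C < \<infinity>" and N: "0 < (N::nat)"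
  obtains P where "\<And>k. P k \<in> sets M" "\<And>k. P k \<subseteq> C" "disjoint_family P"
    "\<And>k. k < nat \<lfloor>N * measure M C\<rfloor> \<Longrightarrow> measure M (P k) = 1 / N"
    "measure M (C - (\<Union>k<nat \<lfloor>N * measure M C\<rfloor>. P k)) \<le> 1 / N"
proof -
  obtain g where g: "g \<in> borel_measurable M"
    "\<And>t. measure M {p\<in>C. g p \<le> t} = max 0 (min t (measure M C))"
    using uniformizing_map[OF M C] by metis
  have C_fm: "C \<in> fmeasurable M" using C by (simp add: fmeasurable_def)
  have sets: "{p\<in>C. g p \<le> t} \<in> fmeasurable M" for t
  proof -
    have "{p\<in>C. g p \<le> t} = C \<inter> (g -` {..t} \<inter> space M)"
      using sets.sets_into_space[OF C(1)] by (auto simp only: vimage_def)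
    also have "\<dots> \<in> sets M" using C(1) measurable_sets[OF g(1), of "{..t}"] by auto
    finally have "{p\<in>C. g p \<le> t} \<in> sets M" .
    then show ?thesis by (rule fmeasurableI2[OF C_fm, rotated]) auto
  qed
  have diff: "measure M ({p\<in>C. g p \<le> t} - {p\<in>C. g p \<le> s}) = measure M {p\<in>C. g p \<le> t} - measure M {p\<in>C. g p \<le> s}"
    if "s \<le> t" for s t
    using that by (intro measurable_measure_Diff sets fmeasurableD[OF sets]) auto
  define P where "P k = {p\<in>C. g p \<le> real (Suc k) / N} - {p\<in>C. g p \<le> real k / N}" for k
  have mono: "real k / N \<le> real (Suc k) / N" for k using N by (simp add: divide_right_mono)
  let ?m = "nat \<lfloor>N * measure M C\<rfloor>"
  have m: "real ?m \<le> N * measure M C" "N * measure M C < real ?m + 1"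
    using N by (auto simp: of_nat_nat)
  show ?thesis
  proof
    show "P k \<in> sets M" for k using sets by (auto simp: P_def fmeasurable_def)
    show "P k \<subseteq> C" for k by (auto simp: P_def)
    have "P j \<inter> P k = {}" if "j < k" for j k
    proof -
      have "real (Suc j) / N \<le> real k / N" using that N by (intro divide_right_mono) auto
      then show ?thesis by (auto simp: P_def)
    qed
    then show "disjoint_family P" unfolding disjoint_family_on_def by (metis Int_commute linorder_neqE_nat)
    show "measure M (P k) = 1 / N" if "k < ?m" for k
    proof -
      have "real (Suc k) \<le> N * measure M C" using that m(1) by (intro order_trans[OF _ m(1)]) simp
      then have "real (Suc k) / N \<le> measure M C" using N by (simp add: field_simps)
      moreover from this have "real k / N \<le> measure M C" using mono[of k] by linarith
      ultimately show ?thesis unfolding P_def diff[OF mono] g(2)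
        using N by (simp add: min_absorb1 diff_divide_distrib[symmetric])
    qed
    have "C - (\<Union>k<?m. P k) \<subseteq> {p\<in>C. g p \<le> 0} \<union> (C - {p\<in>C. g p \<le> real ?m / N})"
    proof
      fix p assume p: "p \<in> C - (\<Union>k<?m. P k)"
      show "p \<in> {p\<in>C. g p \<le> 0} \<union> (C - {p\<in>C. g p \<le> real ?m / N})"
      proof (rule ccontr)
        assume "\<not> ?thesis"
        then have gp: "0 < g p" "g p \<le> real ?m / N" using p by auto
        \<comment> \<open>The slices are open at the bottom and closed at the top, so the slice
          number is the ceiling minus 1, not the floor.\<close>
        define k where "k = nat (\<lceil>N * g p\<rceil> - 1)"
        have "0 < N * g p" using gp N by simp
        then have "real k < N * g p" "N * g p \<le> real (Suc k)" unfolding k_def by linarith+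
        moreover have "N * g p \<le> real ?m" using gp N by (simp add: field_simps)
        ultimately have "p \<in> P k" "k < ?m" using p N by (auto simp: P_def field_simps)
        then show False using p by auto
      qed
    qed
    then have "measure M (C - (\<Union>k<?m. P k)) \<le> measure M ({p\<in>C. g p \<le> 0} \<union> (C - {p\<in>C. g p \<le> real ?m / N}))"
      by (intro measure_mono_fmeasurable sets.Diff sets.finite_UN fmeasurable.Un fmeasurable.Diff C_fm C(1) sets)
        (auto simp: P_def intro!: fmeasurableD[OF sets])
    also have "\<dots> \<le> measure M {p\<in>C. g p \<le> 0} + measure M (C - {p\<in>C. g p \<le> real ?m / N})"
      using sets C by (intro measure_Un_le) (auto simp: fmeasurable_def)
    also have "measure M (C - {p\<in>C. g p \<le> real ?m / N}) = measure M C - measure M {p\<in>C. g p \<le> real ?m / N}"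
      using sets C by (intro measurable_measure_Diff) (auto simp: fmeasurable_def)
    also have "measure M {p\<in>C. g p \<le> 0} + \<dots> \<le> 1 / N"
    proof -
      have "real ?m / N \<le> measure M C" "measure M C \<le> real ?m / N + 1 / N"
        using m N by (simp_all add: field_simps)
      then show ?thesis by (simp add: g(2) min_absorb1)
    qed
    finally show "measure M (C - (\<Union>k<?m. P k)) \<le> 1 / N" .
  qed
qed

text \<open>The sets \<D> cut their union into atoms \<open>E v\<close>, one for each subset v of
  \<D>. Slicing each atom separately keeps every piece inside or outside each D, and every atom
  wastes at most 1 / N. An index consists of an atom and a slice number.\<close>

lemma fine_partition:
  assumes M: "standard_borel M" "nonatomic M"
    and \<D>: "finite \<D>" "\<And>D. D \<in> \<D> \<Longrightarrow> D \<in> sets M" "\<And>D. D \<in> \<D> \<Longrightarrow> emeasure M D < \<infinity>" and N: "0 < (N::nat)"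
  obtains I and C :: "'a set set \<times> nat \<Rightarrow> 'a set" where "finite I" "disjoint_family_on C I"
    "\<And>i. i \<in> I \<Longrightarrow> C i \<in> sets M" "\<And>i. i \<in> I \<Longrightarrow> measure M (C i) = 1 / N" "\<And>i. i \<in> I \<Longrightarrow> C i \<subseteq> \<Union>\<D>"
    "\<And>i D. i \<in> I \<Longrightarrow> D \<in> \<D> \<Longrightarrow> C i \<subseteq> D \<or> C i \<inter> D = {}"
    "measure M (\<Union>\<D> - (\<Union>i\<in>I. C i)) \<le> 2 ^ card \<D> / N"
proof -
  define E where "E v = {p\<in>\<Union>\<D>. {D\<in>\<D>. p \<in> D} = v}" for v
  have E_sets: "E v \<in> sets M" for v
  proof (cases "v \<subseteq> \<D>")
    case True
    have "E v = \<Union>\<D> - (\<Union>D\<in>v. \<Union>\<D> - D) - \<Union>(\<D> - v)" unfolding E_def using True by auto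
    also have "\<dots> \<in> sets M"
      using \<D> True by (intro sets.Diff sets.finite_UN sets.finite_Union) (auto intro: finite_subset)
    finally show ?thesis .
  next
    case False
    then have "E v = {}" by (auto simp: E_def)
    then show ?thesis by simp
  qed
  have U_fm: "\<Union>\<D> \<in> fmeasurable M" using \<D> by (intro fmeasurable.finite_Union) (auto simp: fmeasurable_def)
  have E_sub: "E v \<subseteq> \<Union>\<D>" for v by (auto simp: E_def)
  have E_fin: "emeasure M (E v) < \<infinity>" for v
    using fmeasurableI2[OF U_fm E_sub E_sets] by (simp add: fmeasurable_def)
  define m where "m v = nat \<lfloor>N * measure M (E v)\<rfloor>" for v
  have "\<exists>P. (\<forall>k. P k \<in> sets M) \<and> (\<forall>k. P k \<subseteq> E v) \<and> disjoint_family P \<and>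
    (\<forall>k < m v. measure M (P k) = 1 / N) \<and>
    measure M (E v - (\<Union>k<m v. P k)) \<le> 1 / N" for v
    unfolding m_def by (rule slices[OF M E_sets E_fin N, of v]) blast
  then obtain P where P: "\<And>v k. P v k \<in> sets M" "\<And>v k. P v k \<subseteq> E v" "\<And>v. disjoint_family (P v)"
    "\<And>v k. k < m v \<Longrightarrow> measure M (P v k) = 1 / N"
    "\<And>v. measure M (E v - (\<Union>k<m v. P v k)) \<le> 1 / N" by metis
  define I where "I = (SIGMA v:Pow \<D>. {..<m v})"
  define C where "C = (\<lambda>(v, k). P v k)"
  show ?thesis
  proof
    show "finite I" unfolding I_def using \<D>(1) by auto
    show "disjoint_family_on C I"
      unfolding disjoint_family_on_def
    proof (intro ballI impI)
      fix i j assume "i \<in> I" "j \<in> I" and ij: "i \<noteq> j"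
      obtain v k w l where vk: "i = (v, k)" "j = (w, l)" by (cases i, cases j) auto
      show "C i \<inter> C j = {}"
      proof (cases "v = w")
        case True
        then show ?thesis using ij vk P(3)[of v] by (auto simp: C_def disjoint_family_on_def)
      next
        case False
        then have "E v \<inter> E w = {}" by (auto simp: E_def)
        then show ?thesis using P(2)[of v k] P(2)[of w l] vk by (auto simp: C_def)
      qed
    qed
    show "C i \<in> sets M" for i using P(1) by (auto simp: C_def split: prod.split)
    show "measure M (C i) = 1 / N" if "i \<in> I" for i using P(4) that by (auto simp: C_def I_def)
    show "C i \<subseteq> \<Union>\<D>" for i using P(2) E_sub by (auto simp: C_def split: prod.splits) blast
    show "C i \<subseteq> D \<or> C i \<inter> D = {}" if "D \<in> \<D>" for i D
    proof -
      obtain v k where i: "i = (v, k)" by (cases i)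
      have "C i \<subseteq> E v" using P(2) by (auto simp: C_def i)
      moreover have "E v \<subseteq> D \<or> E v \<inter> D = {}" using that by (auto simp: E_def)
      ultimately show ?thesis by blast
    qed
    have "\<Union>\<D> - (\<Union>i\<in>I. C i) \<subseteq> (\<Union>v\<in>Pow \<D>. E v - (\<Union>k<m v. P v k))"
    proof
      fix p assume p: "p \<in> \<Union>\<D> - (\<Union>i\<in>I. C i)"
      let ?v = "{D\<in>\<D>. p \<in> D}"
      have "p \<in> E ?v" "?v \<in> Pow \<D>" using p by (auto simp: E_def)
      moreover have "p \<notin> P ?v k" if "k < m ?v" for k
      proof -
        have "(?v, k) \<in> I" using that by (auto simp: I_def)
        then have "p \<notin> C (?v, k)" using p by blast
        then show ?thesis by (simp add: C_def)
      qed
      ultimately show "p \<in> (\<Union>v\<in>Pow \<D>. E v - (\<Union>k<m v. P v k))" by blast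
    qed
    moreover have R_sets: "E v - (\<Union>k<m v. P v k) \<in> sets M" for v
      using E_sets P(1) by auto
    moreover have "E v - (\<Union>k<m v. P v k) \<in> fmeasurable M" for v
      using E_sub R_sets by (intro fmeasurableI2[OF U_fm]) auto
    ultimately have "measure M (\<Union>\<D> - (\<Union>i\<in>I. C i)) \<le> measure M (\<Union>v\<in>Pow \<D>. E v - (\<Union>k<m v. P v k))"
      using \<D>(1) \<D>(2) P(1) U_fm \<open>finite I\<close>
      by (intro measure_mono_fmeasurable fmeasurable.finite_UN sets.Diff sets.finite_UN fmeasurableD[OF U_fm])
        (auto simp: C_def split: prod.splits)
    also have "\<dots> \<le> (\<Sum>v\<in>Pow \<D>. measure M (E v - (\<Union>k<m v. P v k)))"
      using \<D>(1) R_sets by (intro measure_UNION_le) auto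
    also have "\<dots> \<le> (\<Sum>v\<in>Pow \<D>. 1 / N)" by (intro sum_mono P(5))
    also have "\<dots> = 2 ^ card \<D> / N" using \<D>(1) by (simp add: card_Pow)
    finally show "measure M (\<Union>\<D> - (\<Union>i\<in>I. C i)) \<le> 2 ^ card \<D> / N" .
  qed
qed

section \<open>Automorphisms permuting pieces of equal measure\<close>

text \<open>The pieces have equal mass, so their coordinates have the same distribution function and
  hence the same law \<open>L\<close> on the line. Each coordinate is onto its image only up to an
  \<open>L\<close>-null set; intersecting the finitely many images gives one \<open>W\<close> on
  which all pieces are modelled exactly.\<close>

lemma common_model:
  assumes M: "standard_borel M" "nonatomic M" and I: "finite I" "disjoint_family_on C I"
    and C: "\<And>i. i \<in> I \<Longrightarrow> C i \<in> sets M" "\<And>i. i \<in> I \<Longrightarrow> emeasure M (C i) = ennreal c"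
  obtains g C' and W :: "real set" and L :: "real measure" where
    "\<And>i. i \<in> I \<Longrightarrow> g i \<in> borel_measurable M" "\<And>i. i \<in> I \<Longrightarrow> C' i \<in> sets M" "\<And>i. i \<in> I \<Longrightarrow> C' i \<subseteq> C i"
    "\<And>i. i \<in> I \<Longrightarrow> emeasure M (C i - C' i) = 0" "\<And>i. i \<in> I \<Longrightarrow> bij_betw (g i) (C' i) W"
    "\<And>i A. i \<in> I \<Longrightarrow> A \<in> sets M \<Longrightarrow> A \<subseteq> C' i \<Longrightarrow> g i ` A \<in> sets borel"
    "\<And>i E. i \<in> I \<Longrightarrow> E \<in> sets borel \<Longrightarrow> emeasure M (C' i \<inter> g i -` E) = emeasure L E"
proof (cases "I = {}")
  case True
  then show ?thesis using that by blast
next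
  case False
  define Q where "Q i g C' \<longleftrightarrow> g \<in> borel_measurable M \<and> (\<forall>t. measure M {p\<in>C i. g p \<le> t} = max 0 (min t (measure M (C i)))) \<and>
      C' \<in> sets M \<and> C' \<subseteq> C i \<and> emeasure M (C i - C') = 0 \<and> inj_on g C' \<and>
      (\<forall>A. A \<in> sets M \<longrightarrow> A \<subseteq> C' \<longrightarrow> g ` A \<in> sets borel)" for i g C'
  have "\<exists>g C'. Q i g C'" if i: "i \<in> I" for i
  proof -
    have "emeasure M (C i) < \<infinity>" using C(2)[OF i] by simp
    then show ?thesis unfolding Q_def by (rule uniformizing_map[OF M C(1)[OF i]]) blast
  qed
  then obtain g C1 where "\<And>i. i \<in> I \<Longrightarrow> Q i (g i) (C1 i)" by metis
  then have g: "\<And>i. i \<in> I \<Longrightarrow> g i \<in> borel_measurable M"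
    "\<And>i t. i \<in> I \<Longrightarrow> measure M {p\<in>C i. g i p \<le> t} = max 0 (min t (measure M (C i)))"
    "\<And>i. i \<in> I \<Longrightarrow> C1 i \<in> sets M" "\<And>i. i \<in> I \<Longrightarrow> C1 i \<subseteq> C i" "\<And>i. i \<in> I \<Longrightarrow> emeasure M (C i - C1 i) = 0"
    "\<And>i. i \<in> I \<Longrightarrow> inj_on (g i) (C1 i)"
    "\<And>i A. i \<in> I \<Longrightarrow> A \<in> sets M \<Longrightarrow> A \<subseteq> C1 i \<Longrightarrow> g i ` A \<in> sets borel"
    unfolding Q_def by blast+
  define L where "L i = distr (density M (indicator (C i))) borel (g i)" for i
  have em_L: "emeasure (L i) E = emeasure M (C i \<inter> g i -` E)" if i: "i \<in> I" and E: "E \<in> sets borel" for i E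
  proof -
    have "emeasure (L i) E = emeasure (density M (indicator (C i))) (g i -` E \<inter> space M)"
      unfolding L_def using g(1)[OF i] E by (simp add: emeasure_distr)
    also have "\<dots> = emeasure M (C i \<inter> (g i -` E \<inter> space M))"
      using g(1)[OF i] E C(1)[OF i] by (intro emeasure_restricted measurable_sets[OF g(1)[OF i]]) auto
    also have "C i \<inter> (g i -` E \<inter> space M) = C i \<inter> g i -` E"
      using sets.sets_into_space[OF C(1)[OF i]] by auto
    finally show ?thesis .
  qed
  have L_eq: "L i = L j" if ij: "i \<in> I" "j \<in> I" for i j
  proof (rule cdf_unique')
    have "finite_borel_measure (L i)" if i: "i \<in> I" for i
    proof -
      have "emeasure (L i) (space (L i)) = emeasure M (C i)"
        using em_L[OF i, of UNIV] by (simp add: L_def)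
      then have "finite_measure (L i)" using C(2)[OF i] by (intro finite_measureI) simp
      then show ?thesis by (simp add: finite_borel_measure_def finite_borel_measure_axioms_def L_def)
    qed
    then show "finite_borel_measure (L i)" "finite_borel_measure (L j)" using ij by auto
    have "cdf (L i) t = max 0 (min t (enn2real (ennreal c)))" if i: "i \<in> I" for i t
    proof -
      have "C i \<inter> g i -` {..t} = {p\<in>C i. g i p \<le> t}" by auto
      then show ?thesis using em_L[OF i, of "{..t}"] g(2)[OF i, of t] C(2)[OF i]
        by (simp add: cdf_def measure_def)
    qed
    then show "cdf (L i) = cdf (L j)" using ij by auto
  qed
  define W where "W = (\<Inter>i\<in>I. g i ` C1 i)"
  have W: "W \<in> sets borel" unfolding W_def using False I(1) g(3,7) by (intro sets.finite_INT) auto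
  define C' where "C' i = C1 i \<inter> g i -` W" for i
  obtain i0 where i0: "i0 \<in> I" using False by blast
  have C'_sets: "C' i \<in> sets M" if i: "i \<in> I" for i
  proof -
    have "C' i = C1 i \<inter> (g i -` W \<inter> space M)"
      using sets.sets_into_space[OF g(3)[OF i]] by (auto simp: C'_def)
    then show ?thesis using g(3)[OF i] measurable_sets[OF g(1)[OF i] W] by auto
  qed
  have null: "emeasure M (C i - C' i) = 0" if i: "i \<in> I" for i
  proof -
    \<comment> \<open>Points of piece j whose coordinate lies outside the image of
      \<open>C1 j\<close> must lie outside \<open>C1 j\<close>, and these form a null set; since all
      laws agree, this bounds the loss for every other piece too.\<close>
    have miss: "emeasure (L i0) (- (g j ` C1 j)) = 0" if j: "j \<in> I" for j
    proof -
      have B: "- (g j ` C1 j) \<in> sets borel" using g(3,7)[OF j] by (simp add: borel_comp)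
      have "C j \<inter> g j -` (- (g j ` C1 j)) \<subseteq> C j - C1 j" by auto
      then have "emeasure M (C j \<inter> g j -` (- (g j ` C1 j))) \<le> emeasure M (C j - C1 j)"
        using C(1)[OF j] g(3)[OF j] by (intro emeasure_mono) auto
      then show ?thesis using em_L[OF j B] g(5)[OF j] L_eq[OF i0 j] by simp
    qed
    have "- W = (\<Union>j\<in>I. - (g j ` C1 j))" by (auto simp: W_def)
    moreover have "emeasure (L i0) (\<Union>j\<in>I. - (g j ` C1 j)) \<le> (\<Sum>j\<in>I. emeasure (L i0) (- (g j ` C1 j)))"
      using I(1) g(3,7) by (intro emeasure_subadditive_finite) (auto simp: L_def borel_comp)
    ultimately have "emeasure (L i0) (- W) = 0" using miss by simp
    then have "emeasure M (C i \<inter> g i -` (- W)) = 0"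
      using em_L[OF i borel_comp[OF W]] L_eq[OF i0 i] by simp
    moreover have "C i \<inter> g i -` (- W) \<in> sets M"
    proof -
      have "C i \<inter> g i -` (- W) = C i \<inter> (g i -` (- W) \<inter> space M)"
        using sets.sets_into_space[OF C(1)[OF i]] by auto
      then show ?thesis using C(1)[OF i] measurable_sets[OF g(1)[OF i] borel_comp[OF W]] by auto
    qed
    ultimately have "(C i - C1 i) \<union> (C i \<inter> g i -` (- W)) \<in> null_sets M"
      using g(3,5)[OF i] C(1)[OF i] by (intro null_sets.Un) auto
    then show ?thesis
      by (rule null_setsD1[OF null_sets_subset]) (use C(1) C'_sets i in \<open>auto simp: C'_def\<close>)
  qed
  show ?thesis
  proof (rule that[of g C' W "L i0"])
    fix i assume i: "i \<in> I"
    show "g i \<in> borel_measurable M" "C' i \<in> sets M" "C' i \<subseteq> C i" "emeasure M (C i - C' i) = 0"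
      using g(1,4)[OF i] C'_sets[OF i] null[OF i] by (auto simp: C'_def)
    have "W \<subseteq> g i ` C1 i" using i by (auto simp: W_def)
    then have "g i ` C' i = W" unfolding C'_def by fast
    then show "bij_betw (g i) (C' i) W"
      using g(6)[OF i] by (auto simp: bij_betw_def C'_def intro: inj_on_subset)
    show "g i ` A \<in> sets borel" if "A \<in> sets M" "A \<subseteq> C' i" for A
      using g(7)[OF i that(1)] that(2) by (auto simp: C'_def)
    show "emeasure M (C' i \<inter> g i -` E) = emeasure (L i0) E" if E: "E \<in> sets borel" for E
    proof -
      have sets: "C i \<inter> g i -` E \<in> sets M"
      proof -
        have "C i \<inter> g i -` E = C i \<inter> (g i -` E \<inter> space M)"
          using sets.sets_into_space[OF C(1)[OF i]] by auto
        then show ?thesis using C(1)[OF i] measurable_sets[OF g(1)[OF i] E] by auto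
      qed
      have "C' i \<inter> g i -` E = (C i \<inter> g i -` E) - (C i - C' i)"
        using g(4)[OF i] by (auto simp: C'_def)
      moreover have "C i - C' i \<in> null_sets M"
        using null[OF i] C(1)[OF i] C'_sets[OF i] by auto
      ultimately have "emeasure M (C' i \<inter> g i -` E) = emeasure M (C i \<inter> g i -` E)"
        using sets by (simp add: emeasure_Diff_null_set)
      then show ?thesis using em_L[OF i E] L_eq[OF i0 i] by simp
    qed
  qed
qed

text \<open>A point of piece i goes to the point of piece \<sigma> i with the same coordinate in
  \<open>W\<close>. Because all pieces use the one set \<open>W\<close>, products of permutations
  become compositions at every point, not just almost everywhere. All other points are fixed,
  including those trimmed off the pieces.\<close>

lemma permutation_automorphisms:
  assumes M: "standard_borel M" "nonatomic M" and I: "finite I" "disjoint_family_on C I"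
    and C: "\<And>i. i \<in> I \<Longrightarrow> C i \<in> sets M" "\<And>i. i \<in> I \<Longrightarrow> emeasure M (C i) = ennreal c"
  obtains C' T where
    "\<And>i. i \<in> I \<Longrightarrow> C' i \<in> sets M" "\<And>i. i \<in> I \<Longrightarrow> C' i \<subseteq> C i" "\<And>i. i \<in> I \<Longrightarrow> emeasure M (C i - C' i) = 0"
    "\<And>\<sigma>. \<sigma> permutes I \<Longrightarrow> T \<sigma> \<in> mp_automorphisms M"
    "\<And>\<sigma> \<tau>. \<sigma> permutes I \<Longrightarrow> \<tau> permutes I \<Longrightarrow> T (\<sigma> \<circ> \<tau>) = compose (space M) (T \<sigma>) (T \<tau>)"
    "\<And>\<sigma> i p. \<sigma> permutes I \<Longrightarrow> i \<in> I \<Longrightarrow> p \<in> C' i \<Longrightarrow> T \<sigma> p \<in> C' (\<sigma> i)"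
    "\<And>\<sigma> i p. \<sigma> permutes I \<Longrightarrow> i \<in> I \<Longrightarrow> p \<in> C' i \<Longrightarrow> \<sigma> i = i \<Longrightarrow> T \<sigma> p = p"
    "\<And>\<sigma> p. \<sigma> permutes I \<Longrightarrow> p \<in> space M \<Longrightarrow> p \<notin> (\<Union>i\<in>I. C' i) \<Longrightarrow> T \<sigma> p = p"
proof -
  obtain g C' and W :: "real set" and L :: "real measure" where
    g: "\<And>i. i \<in> I \<Longrightarrow> g i \<in> borel_measurable M" and C': "\<And>i. i \<in> I \<Longrightarrow> C' i \<in> sets M" "\<And>i. i \<in> I \<Longrightarrow> C' i \<subseteq> C i"
    "\<And>i. i \<in> I \<Longrightarrow> emeasure M (C i - C' i) = 0" and bij: "\<And>i. i \<in> I \<Longrightarrow> bij_betw (g i) (C' i) W"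
    and im: "\<And>i A. i \<in> I \<Longrightarrow> A \<in> sets M \<Longrightarrow> A \<subseteq> C' i \<Longrightarrow> g i ` A \<in> sets borel"
    and L: "\<And>i E. i \<in> I \<Longrightarrow> E \<in> sets borel \<Longrightarrow> emeasure M (C' i \<inter> g i -` E) = emeasure L E"
    by (rule common_model[OF M I C]) (assumption | blast)+
  define h where "h i = inv_into (C' i) (g i)" for i
  have h: "h i w \<in> C' i" "g i (h i w) = w" if "i \<in> I" "w \<in> W" for i w
    using bij[OF that(1)] that(2) unfolding h_def
    by (metis bij_betw_imp_surj_on inv_into_into, metis bij_betw_inv_into_right)
  have hg: "h i (g i p) = p" "g i p \<in> W" if "i \<in> I" "p \<in> C' i" for i p
    using bij[OF that(1)] that(2) unfolding h_def
    by (metis bij_betw_inv_into_left, metis bij_betw_apply)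
  have uniq: "i = j" if "i \<in> I" "j \<in> I" "p \<in> C' i" "p \<in> C' j" for i j p
    using I(2) C'(2) that by (meson disjoint_family_onD disjoint_iff subsetD)
  define idx where "idx p = (THE i. i \<in> I \<and> p \<in> C' i)" for p
  have idx: "idx p = i" if "i \<in> I" "p \<in> C' i" for i p
    unfolding idx_def using that uniq by (intro the_equality) auto
  define V where "V = (\<Union>i\<in>I. C' i)"
  have V: "V \<in> sets M" unfolding V_def using I(1) C'(1) by auto
  have C'_space: "C' i \<subseteq> space M" if "i \<in> I" for i using sets.sets_into_space[OF C'(1)[OF that]] .
  define T where "T \<sigma> p = (if p \<in> V then h (\<sigma> (idx p)) (g (idx p) p) else if p \<in> space M then p else undefined)" for \<sigma> p
  have T_in: "T \<sigma> p = h (\<sigma> i) (g i p)" if "i \<in> I" "p \<in> C' i" for \<sigma> i p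
    using that idx[OF that] by (auto simp: T_def V_def)
  have T_out: "T \<sigma> p = p" if "p \<in> space M" "p \<notin> V" for \<sigma> p using that by (auto simp: T_def)
  have T_C': "T \<sigma> p \<in> C' (\<sigma> i)" if "\<sigma> permutes I" "i \<in> I" "p \<in> C' i" for \<sigma> i p
    using T_in[OF that(2,3)] h(1) hg(2) that by (simp add: permutes_in_image)
  have T_comp: "T (\<sigma> \<circ> \<tau>) p = T \<sigma> (T \<tau> p)" if st: "\<sigma> permutes I" "\<tau> permutes I" and p: "p \<in> space M" for \<sigma> \<tau> p
  proof (cases "p \<in> V")
    case True
    then obtain i where i: "i \<in> I" "p \<in> C' i" by (auto simp: V_def)
    have ti: "\<tau> i \<in> I" using st i by (simp add: permutes_in_image)
    have "g (\<tau> i) (T \<tau> p) = g i p" using T_in[OF i] h(2)[OF ti hg(2)[OF i]] by simp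
    then show ?thesis using T_in[OF i] T_in[OF ti T_C'[OF st(2) i]] by simp
  qed (simp add: T_out p)
  have T_space: "T \<sigma> p \<in> space M" if "\<sigma> permutes I" "p \<in> space M" for \<sigma> p
  proof (cases "p \<in> V")
    case True
    then obtain i where i: "i \<in> I" "p \<in> C' i" by (auto simp: V_def)
    then show ?thesis using T_C'[OF that(1) i] C'_space[of "\<sigma> i"] that(1) by (auto simp: permutes_in_image)
  qed (use T_out that in auto)
  \<comment> \<open>The part of the preimage of B lying in piece i, written through coordinates: its
    measurability rests on the images under \<open>g\<close> being Borel, and its measure is that of
    B in piece \<sigma> i because both equal the mass \<open>L\<close> gives to the same set of
    coordinates.\<close>
  define Z where "Z \<sigma> B i = C' i \<inter> g i -` (g (\<sigma> i) ` (B \<inter> C' (\<sigma> i)))" for \<sigma> B i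
  have pre: "T \<sigma> -` B \<inter> space M = (B - V) \<union> (\<Union>i\<in>I. Z \<sigma> B i)"
    if s: "\<sigma> permutes I" and B: "B \<in> sets M" for \<sigma> B
  proof (intro equalityI subsetI)
    fix p assume p: "p \<in> T \<sigma> -` B \<inter> space M"
    show "p \<in> (B - V) \<union> (\<Union>i\<in>I. Z \<sigma> B i)"
    proof (cases "p \<in> V")
      case True
      then obtain i where i: "i \<in> I" "p \<in> C' i" by (auto simp: V_def)
      have si: "\<sigma> i \<in> I" using s i by (simp add: permutes_in_image)
      have "g (\<sigma> i) (T \<sigma> p) = g i p" using T_in[OF i] h(2)[OF si hg(2)[OF i]] by simp
      then have "p \<in> Z \<sigma> B i" using p i T_C'[OF s i] by (auto simp: Z_def intro!: image_eqI[of _ _ "T \<sigma> p"])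
      then show ?thesis using i by blast
    qed (use p T_out in auto)
  next
    fix p assume "p \<in> (B - V) \<union> (\<Union>i\<in>I. Z \<sigma> B i)"
    then show "p \<in> T \<sigma> -` B \<inter> space M"
    proof
      assume "p \<in> B - V"
      then show ?thesis using T_out[of p \<sigma>] sets.sets_into_space[OF B] by auto
    next
      assume "p \<in> (\<Union>i\<in>I. Z \<sigma> B i)"
      then obtain i q where i: "i \<in> I" "p \<in> C' i" and q: "q \<in> B" "q \<in> C' (\<sigma> i)" "g i p = g (\<sigma> i) q"
        by (auto simp: Z_def)
      have si: "\<sigma> i \<in> I" using s i by (simp add: permutes_in_image)
      have "T \<sigma> p = q" using T_in[OF i] q(3) hg(1)[OF si q(2)] by simp
      then show ?thesis using q i C'_space by auto
    qed
  qed
  have gB: "g j ` (B \<inter> C' j) \<in> sets borel" if "j \<in> I" "B \<in> sets M" for j B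
    using im[OF that(1), of "B \<inter> C' j"] that C'(1) by auto
  have Z_sets: "Z \<sigma> B i \<in> sets M" if s: "\<sigma> permutes I" and B: "B \<in> sets M" and i: "i \<in> I" for \<sigma> B i
  proof -
    have si: "\<sigma> i \<in> I" using s i by (simp add: permutes_in_image)
    have "Z \<sigma> B i = C' i \<inter> (g i -` (g (\<sigma> i) ` (B \<inter> C' (\<sigma> i))) \<inter> space M)"
      using C'_space[OF i] by (auto simp: Z_def)
    then show ?thesis using C'(1)[OF i] measurable_sets[OF g[OF i] gB[OF si B]] by auto
  qed
  have T_meas: "T \<sigma> \<in> measurable M M" if s: "\<sigma> permutes I" for \<sigma>
  proof (rule measurableI)
    show "T \<sigma> -` B \<inter> space M \<in> sets M" if B: "B \<in> sets M" for B
      unfolding pre[OF s B] using B V I(1) Z_sets[OF s B] by (intro sets.Un sets.Diff sets.finite_UN) auto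
  qed (use T_space s in auto)
  have em_Z: "emeasure M (Z \<sigma> B i) = emeasure M (B \<inter> C' (\<sigma> i))"
    if s: "\<sigma> permutes I" and B: "B \<in> sets M" and i: "i \<in> I" for \<sigma> B i
  proof -
    have si: "\<sigma> i \<in> I" using s i by (simp add: permutes_in_image)
    have "C' (\<sigma> i) \<inter> g (\<sigma> i) -` (g (\<sigma> i) ` (B \<inter> C' (\<sigma> i))) = B \<inter> C' (\<sigma> i)"
      using bij_betw_imp_inj_on[OF bij[OF si]] by (auto simp: inj_on_def)
    then show ?thesis unfolding Z_def using L[OF i gB[OF si B]] L[OF si gB[OF si B]] by simp
  qed
  have T_em: "emeasure M (T \<sigma> -` B \<inter> space M) = emeasure M B" if s: "\<sigma> permutes I" and B: "B \<in> sets M" for \<sigma> B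
  proof -
    have dis: "disjoint_family_on F I" if "\<And>i. i \<in> I \<Longrightarrow> F i \<subseteq> C' i" for F :: "_ \<Rightarrow> 'a set"
      unfolding disjoint_family_on_def using that uniq by blast
    have "emeasure M ((B - V) \<union> (\<Union>i\<in>I. F i)) = emeasure M (B - V) + (\<Sum>i\<in>I. emeasure M (F i))"
      if F: "\<And>i. i \<in> I \<Longrightarrow> F i \<subseteq> C' i" "\<And>i. i \<in> I \<Longrightarrow> F i \<in> sets M" for F
    proof -
      have "(B - V) \<inter> (\<Union>i\<in>I. F i) = {}" using F(1) by (auto simp: V_def)
      then have "emeasure M ((B - V) \<union> (\<Union>i\<in>I. F i)) = emeasure M (B - V) + emeasure M (\<Union>i\<in>I. F i)"
        using B V I(1) F(2) by (intro plus_emeasure[symmetric]) auto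
      also have "emeasure M (\<Union>i\<in>I. F i) = (\<Sum>i\<in>I. emeasure M (F i))"
        using I(1) F(2) dis[OF F(1)] by (intro sum_emeasure[symmetric]) auto
      finally show ?thesis .
    qed note decomp = this
    have "emeasure M (T \<sigma> -` B \<inter> space M) = emeasure M (B - V) + (\<Sum>i\<in>I. emeasure M (Z \<sigma> B i))"
      unfolding pre[OF s B] by (rule decomp) (auto simp only: Z_def Int_lower1 intro!: Z_sets[OF s B, unfolded Z_def])
    also have "(\<Sum>i\<in>I. emeasure M (Z \<sigma> B i)) = (\<Sum>i\<in>I. emeasure M (B \<inter> C' (\<sigma> i)))"
      by (intro sum.cong refl em_Z[OF s B])
    also have "\<dots> = (\<Sum>i\<in>I. emeasure M (B \<inter> C' i))"
      by (rule sum.reindex_bij_betw[OF permutes_imp_bij[OF s]])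
    also have "emeasure M (B - V) + \<dots> = emeasure M ((B - V) \<union> (\<Union>i\<in>I. B \<inter> C' i))"
      by (rule decomp[symmetric]) (use B C'(1) in auto)
    also have "(B - V) \<union> (\<Union>i\<in>I. B \<inter> C' i) = B" by (auto simp: V_def)
    finally show ?thesis .
  qed
  have T_fix: "T \<sigma> p = p" if "\<sigma> permutes I" "i \<in> I" "p \<in> C' i" "\<sigma> i = i" for \<sigma> i p
    using T_in[OF that(2,3)] hg(1)[OF that(2,3)] that(4) by simp
  have T_id: "T id p = p" if "p \<in> space M" for p
    using T_fix[OF permutes_id] T_out[OF that] by (cases "p \<in> V") (auto simp: V_def)
  have T_ext: "T \<sigma> \<in> extensional (space M)" for \<sigma>
    using sets.sets_into_space[OF V] by (auto simp: extensional_def T_def)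
  show ?thesis
  proof (rule that[of C' T])
    fix \<sigma> assume s: "\<sigma> permutes I"
    have s': "inv_into UNIV \<sigma> permutes I" using s by (rule permutes_inv)
    show "T \<sigma> \<in> mp_automorphisms M"
    proof (rule mp_automorphismI[OF T_meas[OF s] T_ext T_meas[OF s']])
      fix p assume p: "p \<in> space M"
      show "T (inv_into UNIV \<sigma>) (T \<sigma> p) = p" "T \<sigma> (T (inv_into UNIV \<sigma>) p) = p"
        using T_comp[OF s' s p] T_comp[OF s s' p] T_id[OF p] permutes_inv_o[OF s] by simp_all
    qed (rule T_em[OF s])
    show "T (\<sigma> \<circ> \<tau>) = compose (space M) (T \<sigma>) (T \<tau>)" if "\<tau> permutes I" for \<tau>
    proof
      fix p show "T (\<sigma> \<circ> \<tau>) p = compose (space M) (T \<sigma>) (T \<tau>) p"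
        using T_comp[OF s that, of p] T_ext[of "\<sigma> \<circ> \<tau>"] by (cases "p \<in> space M") (auto simp: compose_def extensional_def)
    qed
  qed (use C' T_C' T_fix T_out in \<open>auto simp: V_def\<close>)
qed

section \<open>The Koopman representation\<close>

definition L2_norm :: "'a measure \<Rightarrow> ('a \<Rightarrow> complex) \<Rightarrow> real" where
  "L2_norm M f = sqrt (LINT x|M. (cmod (f x))\<^sup>2)"

lemma L2_functionsD:
  assumes "f \<in> L2_functions M"
  shows "f \<in> borel_measurable M" "integrable M (\<lambda>x. (cmod (f x))\<^sup>2)"
  using assms by (auto simp: L2_functions_def)

lemma L2_norm_nonneg: "0 \<le> L2_norm M f"
  by (simp add: L2_norm_def)

lemma L2_norm_power2: "(L2_norm M f)\<^sup>2 = (LINT x|M. (cmod (f x))\<^sup>2)"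
  by (simp add: L2_norm_def)

lemma L2_functions_scale: "f \<in> L2_functions M \<Longrightarrow> (\<lambda>x. c * f x) \<in> L2_functions M"
  by (auto simp: L2_functions_def norm_mult power_mult_distrib)

lemma L2_functions_add:
  assumes f: "f \<in> L2_functions M" and g: "g \<in> L2_functions M"
  shows "(\<lambda>x. f x + g x) \<in> L2_functions M"
proof -
  have "(cmod (f x + g x))\<^sup>2 \<le> 2 * (cmod (f x))\<^sup>2 + 2 * (cmod (g x))\<^sup>2" for x
  proof -
    have "(cmod (f x + g x))\<^sup>2 \<le> (cmod (f x) + cmod (g x))\<^sup>2" by (intro power_mono norm_triangle_ineq) simp
    also have "\<dots> \<le> 2 * (cmod (f x))\<^sup>2 + 2 * (cmod (g x))\<^sup>2" 
      using zero_le_power2[of "cmod (f x) - cmod (g x)"] by (simp add: power2_sum power2_diff)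
    finally show ?thesis .
  qed
  note bound = this
  have "integrable M (\<lambda>x. 2 * (cmod (f x))\<^sup>2 + 2 * (cmod (g x))\<^sup>2)"
    using L2_functionsD(2)[OF f] L2_functionsD(2)[OF g] by simp
  moreover have "(\<lambda>x. (cmod (f x + g x))\<^sup>2) \<in> borel_measurable M"
    using L2_functionsD(1)[OF f] L2_functionsD(1)[OF g] by measurable
  moreover have "AE x in M. norm ((cmod (f x + g x))\<^sup>2) \<le> norm (2 * (cmod (f x))\<^sup>2 + 2 * (cmod (g x))\<^sup>2)"
    by (rule AE_I2) (simp only: real_norm_def abs_of_nonneg zero_le_power2 add_nonneg_nonneg mult_nonneg_nonneg zero_le_numeral bound)
  ultimately have "integrable M (\<lambda>x. (cmod (f x + g x))\<^sup>2)"
    by (rule Bochner_Integration.integrable_bound)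
  then show ?thesis
    using L2_functionsD(1)[OF f] L2_functionsD(1)[OF g] by (simp add: L2_functions_def)
qed

lemma L2_functions_diff: "f \<in> L2_functions M \<Longrightarrow> g \<in> L2_functions M \<Longrightarrow> (\<lambda>x. f x - g x) \<in> L2_functions M"
  using L2_functions_add[of f M "\<lambda>x. (-1) * g x"] L2_functions_scale[of g M "-1"] by simp

lemma L2_norm_cong:
  assumes "f \<in> borel_measurable M" "g \<in> borel_measurable M" "AE x in M. f x = g x"
  shows "L2_norm M f = L2_norm M g"
proof -
  have "(LINT x|M. (cmod (f x))\<^sup>2) = (LINT x|M. (cmod (g x))\<^sup>2)"
    using assms by (intro integral_cong_AE) auto
  then show ?thesis by (simp add: L2_norm_def)
qed

text \<open>Integrate the pointwise convexity bound (s + t)^2 \<le> (a + b) (s^2 / a + t^2 / b) with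
  a and b close to the two norms. The added e / 2 keeps both positive when a norm vanishes.\<close>

lemma L2_norm_triangle:
  assumes f: "f \<in> L2_functions M" and g: "g \<in> L2_functions M"
  shows "L2_norm M (\<lambda>x. f x + g x) \<le> L2_norm M f + L2_norm M g"
proof (rule field_le_epsilon)
  fix e :: real assume "0 < e"
  define a where "a = L2_norm M f + e / 2"
  define b where "b = L2_norm M g + e / 2"
  have ab: "a > 0" "b > 0" "L2_norm M f \<le> a" "L2_norm M g \<le> b"
    using \<open>0 < e\<close> L2_norm_nonneg[of M f] L2_norm_nonneg[of M g] by (auto simp: a_def b_def)
  have convex: "(s + t)\<^sup>2 \<le> (a + b) * (s\<^sup>2 / a + t\<^sup>2 / b)" for s t :: real
  proof -
    have "(a + b) * (s\<^sup>2 / a + t\<^sup>2 / b) - (s + t)\<^sup>2 = (b * s - a * t)\<^sup>2 / (a * b)"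
      using ab by (simp add: field_simps power2_eq_square)
    also have "\<dots> \<ge> 0" using ab by simp
    finally show ?thesis by simp
  qed
  have "(L2_norm M (\<lambda>x. f x + g x))\<^sup>2 \<le> (LINT x|M. (a + b) * ((cmod (f x))\<^sup>2 / a + (cmod (g x))\<^sup>2 / b))"
    unfolding L2_norm_power2
  proof (rule integral_mono)
    show "integrable M (\<lambda>x. (cmod (f x + g x))\<^sup>2)" using L2_functionsD[OF L2_functions_add[OF f g]] by simp
    show "integrable M (\<lambda>x. (a + b) * ((cmod (f x))\<^sup>2 / a + (cmod (g x))\<^sup>2 / b))"
      using L2_functionsD(2)[OF f] L2_functionsD(2)[OF g] by auto
    fix x
    have "(cmod (f x + g x))\<^sup>2 \<le> (cmod (f x) + cmod (g x))\<^sup>2" by (intro power_mono norm_triangle_ineq) simp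
    also note convex
    finally show "(cmod (f x + g x))\<^sup>2 \<le> (a + b) * ((cmod (f x))\<^sup>2 / a + (cmod (g x))\<^sup>2 / b)" .
  qed
  also have "\<dots> = (a + b) * ((L2_norm M f)\<^sup>2 / a + (L2_norm M g)\<^sup>2 / b)"
    using L2_functionsD(2)[OF f] L2_functionsD(2)[OF g] by (simp add: L2_norm_power2)
  also have "\<dots> \<le> (a + b) * (a\<^sup>2 / a + b\<^sup>2 / b)"
    using ab by (intro mult_left_mono add_mono divide_right_mono power_mono L2_norm_nonneg) auto
  also have "\<dots> = (a + b)\<^sup>2" using ab by (simp add: power2_eq_square)
  finally have "L2_norm M (\<lambda>x. f x + g x) \<le> a + b" by (rule power2_le_imp_le) (use ab in simp)
  then show "L2_norm M (\<lambda>x. f x + g x) \<le> L2_norm M f + L2_norm M g + e" by (simp add: a_def b_def)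
qed

lemma L2_norm_diff_triangle:
  assumes "f \<in> L2_functions M" "g \<in> L2_functions M" "h \<in> L2_functions M"
  shows "L2_norm M (\<lambda>x. f x - h x) \<le> L2_norm M (\<lambda>x. f x - g x) + L2_norm M (\<lambda>x. g x - h x)"
  using L2_norm_triangle[of "\<lambda>x. f x - g x" M "\<lambda>x. g x - h x"] assms by (simp add: L2_functions_diff)

lemma L2_norm_commute: "L2_norm M (\<lambda>x. f x - g x) = L2_norm M (\<lambda>x. g x - f x)"
  by (simp add: L2_norm_def norm_minus_commute)

lemma L2_norm_eq_0:
  assumes "f \<in> L2_functions M"
  shows "L2_norm M f = 0 \<longleftrightarrow> (AE x in M. f x = 0)"
  using integral_nonneg_eq_0_iff_AE[OF L2_functionsD(2)[OF assms]] by (simp add: L2_norm_def)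

lemma L2_class_cong: "AE x in M. f x = g x \<Longrightarrow> L2_class M f = L2_class M g"
  unfolding L2_class_def by (intro Collect_cong conj_cong refl iffI; erule eventually_elim2; simp)

lemma L2_class_eqD:
  assumes "f \<in> L2_functions M" "L2_class M f = L2_class M g"
  shows "AE x in M. f x = g x"
proof -
  have "f \<in> L2_class M f" using assms(1) by (simp add: L2_class_def)
  then have "f \<in> L2_class M g" using assms(2) by simp
  then show ?thesis by (simp add: L2_class_def)
qed

lemma L2_class_in_L2: "f \<in> L2_functions M \<Longrightarrow> L2_class M f \<in> L2 M"
  by (simp add: L2_def)

lemma rep_L2_class:
  assumes "f \<in> L2_functions M"
  shows "rep (L2_class M f) \<in> L2_functions M" "AE x in M. rep (L2_class M f) x = f x"
proof -
  have "f \<in> L2_class M f" using assms by (simp add: L2_class_def)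
  then have "rep (L2_class M f) \<in> L2_class M f"
    unfolding rep_def by (rule someI[where P="\<lambda>h. h \<in> L2_class M f"])
  then show "rep (L2_class M f) \<in> L2_functions M" "AE x in M. rep (L2_class M f) x = f x"
    by (auto simp: L2_class_def)
qed

lemma L2_cases:
  assumes "F \<in> L2 M"
  obtains f where "f \<in> L2_functions M" "F = L2_class M f"
  using assms by (auto simp: L2_def)

lemma L2_dist_class:
  assumes f: "f \<in> L2_functions M" and g: "g \<in> L2_functions M"
  shows "L2_dist M (L2_class M f) (L2_class M g) = L2_norm M (\<lambda>x. f x - g x)"
proof -
  note rf = rep_L2_class[OF f] and rg = rep_L2_class[OF g]
  have "AE x in M. rep (L2_class M f) x - rep (L2_class M g) x = f x - g x"
    using rf(2) rg(2) by eventually_elim simp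
  then have "L2_norm M (\<lambda>x. rep (L2_class M f) x - rep (L2_class M g) x) = L2_norm M (\<lambda>x. f x - g x)"
    using L2_functionsD(1)[OF L2_functions_diff[OF rf(1) rg(1)]] L2_functionsD(1)[OF L2_functions_diff[OF f g]]
    by (intro L2_norm_cong)
  then show ?thesis by (simp add: L2_dist_def L2_norm_def)
qed

lemma Metric_space_L2: "Metric_space (L2 M) (L2_dist M)"
proof
  show "0 \<le> L2_dist M F G" for F G by (simp add: L2_dist_def)
  show "L2_dist M F G = L2_dist M G F" for F G by (simp add: L2_dist_def norm_minus_commute)
  fix F G assume FG: "F \<in> L2 M" "G \<in> L2 M"
  obtain f where f: "f \<in> L2_functions M" "F = L2_class M f" using FG(1) by (rule L2_cases)
  obtain g where g: "g \<in> L2_functions M" "G = L2_class M g" using FG(2) by (rule L2_cases)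
  have "L2_dist M F G = 0 \<longleftrightarrow> (AE x in M. f x = g x)"
    unfolding f(2) g(2) L2_dist_class[OF f(1) g(1)] L2_norm_eq_0[OF L2_functions_diff[OF f(1) g(1)]] by simp
  also have "\<dots> \<longleftrightarrow> F = G"
    using L2_class_eqD[OF f(1)] L2_class_cong f(2) g(2) by metis
  finally show "L2_dist M F G = 0 \<longleftrightarrow> F = G" .
  fix H assume "H \<in> L2 M"
  then obtain h where h: "h \<in> L2_functions M" "H = L2_class M h" by (rule L2_cases)
  show "L2_dist M F H \<le> L2_dist M F G + L2_dist M G H"
    unfolding f(2) g(2) h(2) using f(1) g(1) h(1) by (simp add: L2_dist_class L2_norm_diff_triangle)
qed

section \<open>Composition of square-integrable functions with automorphisms\<close>

lemma L2_functions_automorphism: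
  assumes T: "T \<in> mp_automorphisms M" and f: "f \<in> L2_functions M"
  shows "(\<lambda>x. f (T x)) \<in> L2_functions M"
proof -
  note Tm = mp_automorphismD(2)[OF T] and fm = L2_functionsD[OF f]
  have "integrable (distr M M T) (\<lambda>x. (cmod (f x))\<^sup>2)" using fm(2) mp_automorphismD(4)[OF T] by simp
  then have "integrable M (\<lambda>x. (cmod (f (T x)))\<^sup>2)" by (rule integrable_distr[OF Tm])
  then show ?thesis using measurable_compose[OF Tm fm(1)] by (simp add: L2_functions_def)
qed

lemma integral_automorphism:
  fixes h :: "'a \<Rightarrow> 'b::{banach, second_countable_topology}"
  assumes T: "T \<in> mp_automorphisms M" and h: "h \<in> borel_measurable M"
  shows "(LINT x|M. h (T x)) = (LINT x|M. h x)"
  using integral_distr[OF mp_automorphismD(2)[OF T] h] mp_automorphismD(4)[OF T] by simp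

lemma L2_norm_automorphism:
  assumes "T \<in> mp_automorphisms M" "f \<in> borel_measurable M"
  shows "L2_norm M (\<lambda>x. f (T x)) = L2_norm M f"
  unfolding L2_norm_def using assms by (subst integral_automorphism[of T M "\<lambda>x. (cmod (f x))\<^sup>2"]) auto

lemma rep_aut_class:
  assumes "T \<in> mp_automorphisms M"
  shows "rep (aut_class M T) \<in> mp_automorphisms M" "AE x in M. T x = rep (aut_class M T) x"
proof -
  have "T \<in> aut_class M T" using assms by (simp add: ae_eq_def)
  then have "rep (aut_class M T) \<in> aut_class M T"
    unfolding rep_def by (rule someI[where P="\<lambda>S. S \<in> aut_class M T"])
  then show "rep (aut_class M T) \<in> mp_automorphisms M" "AE x in M. T x = rep (aut_class M T) x"
    by (auto simp: ae_eq_def)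
qed

text \<open>The operator may be computed with any representatives. Two automorphisms equal almost
  everywhere have inverses equal almost everywhere: substitute T^-1 x into the equation T = T',
  which is legitimate since T^-1 preserves null sets.\<close>

lemma Koopman_class:
  assumes T: "T \<in> mp_automorphisms M" and f: "f \<in> L2_functions M"
  shows "Koopman M (aut_class M T) (L2_class M f) = L2_class M (\<lambda>x. f (mp_inv M T x))"
proof -
  define T' where "T' = rep (aut_class M T)"
  have T': "T' \<in> mp_automorphisms M" "AE x in M. T x = T' x"
    unfolding T'_def by (rule rep_aut_class[OF T])+
  have "AE x in M. T (mp_inv M T x) = T' (mp_inv M T x)"
    by (rule AE_automorphism[OF mp_inv_automorphism[OF T] T'(2)])
  moreover have "AE x in M. rep (L2_class M f) (mp_inv M T x) = f (mp_inv M T x)"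
    by (rule AE_automorphism[OF mp_inv_automorphism[OF T] rep_L2_class(2)[OF f]])
  ultimately have "AE x in M. rep (L2_class M f) (inv_into (space M) T' x) = f (mp_inv M T x)"
    using AE_space
  proof eventually_elim
    case (elim x)
    have "mp_inv M T x \<in> space M" using elim mp_automorphism_space[OF mp_inv_automorphism[OF T]] by simp
    then have "inv_into (space M) T' x = mp_inv M T x"
      using elim mp_inv_cancel[OF T] mp_automorphismD(5)[OF T'(1)] by (metis bij_betw_inv_into_left)
    then show ?case using elim by simp
  qed
  then show ?thesis
    using L2_class_in_L2[OF f] by (simp add: Koopman_def T'_def[symmetric] L2_class_cong)
qed

lemma Koopman_L2: "g \<in> carrier (Aut M) \<Longrightarrow> F \<in> L2 M \<Longrightarrow> Koopman M g F \<in> L2 M"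
  by (auto simp: carrier_Aut Koopman_class L2_functions_automorphism mp_inv_automorphism
      intro!: L2_class_in_L2 elim!: L2_cases)

lemma Koopman_extensional: "Koopman M g \<in> extensional (L2 M)"
  by (simp add: Koopman_def)

lemma Koopman_mult:
  assumes "g \<in> carrier (Aut M)" "h \<in> carrier (Aut M)" "F \<in> L2 M"
  shows "Koopman M (g \<otimes>\<^bsub>Aut M\<^esub> h) F = Koopman M g (Koopman M h F)"
proof -
  obtain S where S: "S \<in> mp_automorphisms M" "g = aut_class M S" using assms(1) by (auto simp: carrier_Aut)
  obtain T where T: "T \<in> mp_automorphisms M" "h = aut_class M T" using assms(2) by (auto simp: carrier_Aut)
  obtain f where f: "f \<in> L2_functions M" "F = L2_class M f" using assms(3) by (rule L2_cases)
  have "AE x in M. f (mp_inv M (compose (space M) S T) x) = f (mp_inv M T (mp_inv M S x))"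
  proof (rule AE_I2)
    fix x assume x: "x \<in> space M"
    let ?y = "mp_inv M T (mp_inv M S x)"
    have y: "?y \<in> space M"
      using x S T by (simp add: mp_automorphism_space mp_inv_automorphism)
    have "compose (space M) S T ?y = x"
      using x y S T by (simp add: compose_def mp_inv_cancel mp_automorphism_space mp_inv_automorphism)
    then have "mp_inv M (compose (space M) S T) x = ?y"
      using mp_inv_cancel(2)[OF compose_automorphism[OF S(1) T(1)] y] by simp
    then show "f (mp_inv M (compose (space M) S T) x) = f ?y" by simp
  qed
  then show ?thesis
    using S T f by (simp add: mult_Aut Koopman_class compose_automorphism mp_inv_automorphism L2_functions_automorphism L2_class_cong)
qed

lemma Koopman_one:
  assumes "F \<in> L2 M"
  shows "Koopman M \<one>\<^bsub>Aut M\<^esub> F = F"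
proof -
  obtain f where f: "f \<in> L2_functions M" "F = L2_class M f" using assms by (rule L2_cases)
  have "AE x in M. f (mp_inv M (\<lambda>x\<in>space M. x) x) = f x"
  proof (rule AE_I2)
    fix x assume "x \<in> space M"
    then show "f (mp_inv M (\<lambda>x\<in>space M. x) x) = f x"
      using mp_inv_cancel(2)[OF id_automorphism, of x M] by simp
  qed
  then show ?thesis using f by (simp add: one_Aut Koopman_class id_automorphism L2_class_cong)
qed

lemma Koopman_isometry:
  assumes "g \<in> carrier (Aut M)" "F \<in> L2 M" "G \<in> L2 M"
  shows "L2_dist M (Koopman M g F) (Koopman M g G) = L2_dist M F G"
proof -
  obtain T where T: "T \<in> mp_automorphisms M" "g = aut_class M T" using assms(1) by (auto simp: carrier_Aut)
  obtain f1 where f1: "f1 \<in> L2_functions M" "F = L2_class M f1" using assms(2) by (rule L2_cases)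
  obtain f2 where f2: "f2 \<in> L2_functions M" "G = L2_class M f2" using assms(3) by (rule L2_cases)
  show ?thesis
    using T f1 f2 L2_norm_automorphism[OF mp_inv_automorphism[OF T(1)] L2_functionsD(1)[OF L2_functions_diff[OF f1(1) f2(1)]]]
    by (simp add: Koopman_class L2_dist_class L2_functions_automorphism mp_inv_automorphism)
qed

lemma borel_measurable_cnj:
  assumes "f \<in> borel_measurable M"
  shows "(\<lambda>x. cnj (f x)) \<in> borel_measurable M"
proof -
  have "cnj \<in> borel_measurable borel" by (intro borel_measurable_continuous_onI continuous_intros)
  from measurable_compose[OF assms this] show ?thesis .
qed

lemma L2_inner_class:
  assumes f: "f \<in> L2_functions M" and g: "g \<in> L2_functions M"
  shows "L2_inner M (L2_class M f) (L2_class M g) = (LINT x|M. f x * cnj (g x))"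
proof -
  note rf = rep_L2_class[OF f] and rg = rep_L2_class[OF g]
  have "AE x in M. rep (L2_class M f) x * cnj (rep (L2_class M g) x) = f x * cnj (g x)"
    using rf(2) rg(2) by eventually_elim simp
  then show ?thesis unfolding L2_inner_def
    using L2_functionsD(1)[OF f] L2_functionsD(1)[OF g] L2_functionsD(1)[OF rf(1)] L2_functionsD(1)[OF rg(1)]
    by (intro integral_cong_AE borel_measurable_times borel_measurable_cnj)
qed

text \<open>The strong operator topology lives on the unitary group only, so this is what makes the
  pulled back topology have all of \<open>carrier (Aut M)\<close> as its space.\<close>

lemma Koopman_unitary:
  assumes g: "g \<in> carrier (Aut M)"
  shows "Koopman M g \<in> L2_unitary M"
proof -
  obtain T where T: "T \<in> mp_automorphisms M" "g = aut_class M T" using g by (auto simp: carrier_Aut)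
  let ?R = "mp_inv M T"
  have R: "?R \<in> mp_automorphisms M" by (rule mp_inv_automorphism[OF T(1)])
  have ig: "inv\<^bsub>Aut M\<^esub> g \<in> carrier (Aut M)" using group.inv_closed[OF group_Aut g] .
  have "Koopman M (inv\<^bsub>Aut M\<^esub> g) (Koopman M g F) = F" "Koopman M g (Koopman M (inv\<^bsub>Aut M\<^esub> g) F) = F"
    if "F \<in> L2 M" for F
    using Koopman_mult[OF ig g that] Koopman_mult[OF g ig that] Koopman_one[OF that]
      group.l_inv[OF group_Aut g] group.r_inv[OF group_Aut g] by simp_all
  then have "bij_betw (Koopman M g) (L2 M) (L2 M)"
    by (intro bij_betw_byWitness[of _ "Koopman M (inv\<^bsub>Aut M\<^esub> g)"]) (use Koopman_L2 g ig in auto)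
  then have "Koopman M g \<in> Bij (L2 M)" by (simp add: Bij_def Koopman_def)
  moreover have "Koopman M g (L2_add M F G) = L2_add M (Koopman M g F) (Koopman M g G) \<and>
      Koopman M g (L2_scale M c F) = L2_scale M c (Koopman M g F) \<and>
      L2_inner M (Koopman M g F) (Koopman M g G) = L2_inner M F G" if FG: "F \<in> L2 M" "G \<in> L2 M" for F G c
  proof (intro conjI)
    obtain f1 where f1: "f1 \<in> L2_functions M" "F = L2_class M f1" using FG(1) by (rule L2_cases)
    obtain f2 where f2: "f2 \<in> L2_functions M" "G = L2_class M f2" using FG(2) by (rule L2_cases)
    have add: "L2_add M (L2_class M a) (L2_class M b) = L2_class M (\<lambda>x. a x + b x)"
      if "a \<in> L2_functions M" "b \<in> L2_functions M" for a b
    proof -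
      have "AE x in M. rep (L2_class M a) x + rep (L2_class M b) x = a x + b x"
        using rep_L2_class(2)[OF that(1)] rep_L2_class(2)[OF that(2)] by eventually_elim simp
      then show ?thesis unfolding L2_add_def by (rule L2_class_cong)
    qed
    have scale: "L2_scale M c (L2_class M a) = L2_class M (\<lambda>x. c * a x)" if "a \<in> L2_functions M" for a
    proof -
      have "AE x in M. c * rep (L2_class M a) x = c * a x"
        using rep_L2_class(2)[OF that] by eventually_elim simp
      then show ?thesis unfolding L2_scale_def by (rule L2_class_cong)
    qed
    note K = Koopman_class[OF T(1)]
    note f1R = L2_functions_automorphism[OF R f1(1)] and f2R = L2_functions_automorphism[OF R f2(1)]
    show "Koopman M g (L2_add M F G) = L2_add M (Koopman M g F) (Koopman M g G)"
      unfolding T(2) f1(2) f2(2) add[OF f1(1) f2(1)] K[OF f1(1)] K[OF f2(1)]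
        K[OF L2_functions_add[OF f1(1) f2(1)]] add[OF f1R f2R] ..
    show "Koopman M g (L2_scale M c F) = L2_scale M c (Koopman M g F)"
      unfolding T(2) f1(2) scale[OF f1(1)] K[OF f1(1)] K[OF L2_functions_scale[OF f1(1)]] scale[OF f1R] ..
    have "(\<lambda>x. f1 x * cnj (f2 x)) \<in> borel_measurable M"
      using L2_functionsD(1)[OF f1(1)] L2_functionsD(1)[OF f2(1)]
      by (intro borel_measurable_times borel_measurable_cnj)
    from integral_automorphism[OF R this]
    show "L2_inner M (Koopman M g F) (Koopman M g G) = L2_inner M F G"
      unfolding T(2) f1(2) f2(2) K[OF f1(1)] K[OF f2(1)] L2_inner_class[OF f1R f2R] L2_inner_class[OF f1(1) f2(1)] .
  qed
  ultimately show ?thesis by (simp add: L2_unitary_def)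
qed

section \<open>The strong topology\<close>

lemma topspace_L2_topology [simp]: "topspace (L2_topology M) = L2 M"
  unfolding L2_topology_def by (rule Metric_space.topspace_mtopology[OF Metric_space_L2])

lemma Koopman_PiE: "g \<in> carrier (Aut M) \<Longrightarrow> Koopman M g \<in> L2 M \<rightarrow>\<^sub>E L2 M"
  using Koopman_L2 Koopman_extensional by (auto simp: PiE_def)

lemma topspace_Aut_strong_topology: "topspace (Aut_strong_topology M) = carrier (Aut M)"
  unfolding Aut_strong_topology_def topspace_pullback_topology strong_operator_topology_def
  using Koopman_PiE Koopman_unitary by (auto simp: PiE_def Pi_def)

lemma continuous_map_Koopman_apply:
  assumes F: "F \<in> L2 M"
  shows "continuous_map (Aut_strong_topology M) (L2_topology M) (\<lambda>g. Koopman M g F)"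
proof -
  have "continuous_map (product_topology (\<lambda>_. L2_topology M) (L2 M)) (L2_topology M) (\<lambda>U. U F)"
    by (rule continuous_map_product_projection[OF F])
  then have "continuous_map (strong_operator_topology M) (L2_topology M) (\<lambda>U. U F)"
    unfolding strong_operator_topology_def by (rule continuous_map_from_subtopology)
  from continuous_map_pullback[OF this, of "carrier (Aut M)" "Koopman M"] show ?thesis
    by (simp add: Aut_strong_topology_def comp_def)
qed

text \<open>Universal property of the pullback of a product topology: continuity may be tested on
  one vector at a time.\<close>

lemma continuous_map_into_Aut:
  assumes f: "\<And>y. y \<in> topspace Y \<Longrightarrow> f y \<in> carrier (Aut M)"
    and cont: "\<And>F. F \<in> L2 M \<Longrightarrow> continuous_map Y (L2_topology M) (\<lambda>y. Koopman M (f y) F)"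
  shows "continuous_map Y (Aut_strong_topology M) f"
  unfolding Aut_strong_topology_def
proof (rule continuous_map_pullback')
  show "topspace Y \<subseteq> f -` carrier (Aut M)" using f by auto
  show "continuous_map Y (strong_operator_topology M) (Koopman M \<circ> f)"
    unfolding strong_operator_topology_def continuous_map_in_subtopology continuous_map_componentwise
    using cont f Koopman_unitary Koopman_extensional by (auto simp: image_subset_iff Pi_iff)
qed

lemma Koopman_neighbourhood:
  assumes F: "F \<in> L2 M" and g: "g \<in> carrier (Aut M)" and e: "0 < e"
  obtains U where "openin (Aut_strong_topology M) U" "g \<in> U"
    "\<And>h. h \<in> U \<Longrightarrow> h \<in> carrier (Aut M) \<and> L2_dist M (Koopman M g F) (Koopman M h F) < e"
proof -
  interpret Metric_space "L2 M" "L2_dist M" by (rule Metric_space_L2)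
  have "\<exists>U. openin (Aut_strong_topology M) U \<and> g \<in> U \<and> (\<forall>h\<in>U. Koopman M h F \<in> mball (Koopman M g F) e)"
    using continuous_map_Koopman_apply[OF F] g e
    unfolding L2_topology_def continuous_map_to_metric topspace_Aut_strong_topology by blast
  then obtain U where U: "openin (Aut_strong_topology M) U" "g \<in> U"
    "\<And>h. h \<in> U \<Longrightarrow> Koopman M h F \<in> mball (Koopman M g F) e" by blast
  have "h \<in> carrier (Aut M)" if "h \<in> U" for h
    using openin_subset[OF U(1)] that by (auto simp: topspace_Aut_strong_topology)
  then show ?thesis using U that by (auto simp: in_mball)
qed

lemma continuous_map_into_L2:
  assumes "\<And>y. y \<in> topspace Y \<Longrightarrow> f y \<in> L2 M"
    and "\<And>y e. y \<in> topspace Y \<Longrightarrow> 0 < e \<Longrightarrow>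
      \<exists>U. openin Y U \<and> y \<in> U \<and> (\<forall>z\<in>U. L2_dist M (f y) (f z) < e)"
  shows "continuous_map Y (L2_topology M) f"
proof -
  interpret Metric_space "L2 M" "L2_dist M" by (rule Metric_space_L2)
  show ?thesis unfolding L2_topology_def continuous_map_to_metric
  proof (intro ballI allI impI)
    fix y and e :: real assume "y \<in> topspace Y" "0 < e"
    then obtain U where U: "openin Y U" "y \<in> U" "\<forall>z\<in>U. L2_dist M (f y) (f z) < e" using assms(2) by blast
    then show "\<exists>U. openin Y U \<and> y \<in> U \<and> (\<forall>z\<in>U. f z \<in> mball (f y) e)"
      using assms(1) openin_subset[OF U(1)] by (intro exI[of _ U]) (auto simp: in_mball)
  qed
qed

text \<open>Both operations are continuous because Koopman operators are isometries: in a product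
  the factor on the left does not magnify the error of the factor on the right, and an inverse can
  be moved to the other argument of the distance.\<close>

lemma topological_group_Aut: "topological_group (Aut M) (Aut_strong_topology M)"
proof -
  interpret group "Aut M" by (rule group_Aut)
  interpret L: Metric_space "L2 M" "L2_dist M" by (rule Metric_space_L2)
  let ?\<tau> = "Aut_strong_topology M"
  have mult: "continuous_map (prod_topology ?\<tau> ?\<tau>) ?\<tau> (\<lambda>(g, h). g \<otimes>\<^bsub>Aut M\<^esub> h)"
  proof (rule continuous_map_into_Aut)
    fix F assume F: "F \<in> L2 M"
    show "continuous_map (prod_topology ?\<tau> ?\<tau>) (L2_topology M) (\<lambda>y. Koopman M (case y of (g, h) \<Rightarrow> g \<otimes>\<^bsub>Aut M\<^esub> h) F)"
    proof (rule continuous_map_into_L2)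
      fix y and e :: real assume "y \<in> topspace (prod_topology ?\<tau> ?\<tau>)" "0 < e"
      then obtain g h where y: "y = (g, h)" and g: "g \<in> carrier (Aut M)" and h: "h \<in> carrier (Aut M)"
        by (auto simp: topspace_Aut_strong_topology)
      obtain U where U: "openin ?\<tau> U" "g \<in> U" "\<And>g'. g' \<in> U \<Longrightarrow> g' \<in> carrier (Aut M) \<and>
          L2_dist M (Koopman M g (Koopman M h F)) (Koopman M g' (Koopman M h F)) < e / 2"
        by (rule Koopman_neighbourhood[OF Koopman_L2[OF h F] g, of "e/2"]) (use \<open>0 < e\<close> in auto)
      obtain V where V: "openin ?\<tau> V" "h \<in> V" "\<And>h'. h' \<in> V \<Longrightarrow> h' \<in> carrier (Aut M) \<and>
          L2_dist M (Koopman M h F) (Koopman M h' F) < e / 2"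
        by (rule Koopman_neighbourhood[OF F h, of "e/2"]) (use \<open>0 < e\<close> in auto)
      have "L2_dist M (Koopman M (g \<otimes>\<^bsub>Aut M\<^esub> h) F) (Koopman M (g' \<otimes>\<^bsub>Aut M\<^esub> h') F) < e"
        if g': "g' \<in> U" and h': "h' \<in> V" for g' h'
      proof -
        have c: "g' \<in> carrier (Aut M)" "h' \<in> carrier (Aut M)" using U(3)[OF g'] V(3)[OF h'] by auto
        note KL = Koopman_L2[OF h F] Koopman_L2[OF c(2) F]
        have "L2_dist M (Koopman M g (Koopman M h F)) (Koopman M g' (Koopman M h' F)) \<le>
            L2_dist M (Koopman M g (Koopman M h F)) (Koopman M g' (Koopman M h F)) +
            L2_dist M (Koopman M g' (Koopman M h F)) (Koopman M g' (Koopman M h' F))"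
          using g c KL h F by (intro L.triangle Koopman_L2)
        also have "\<dots> < e / 2 + e / 2"
          using U(3)[OF g'] V(3)[OF h'] by (intro add_strict_mono) (simp_all add: Koopman_isometry[OF c(1) KL])
        finally show ?thesis using g h c F by (simp add: Koopman_mult)
      qed
      then show "\<exists>U. openin (prod_topology ?\<tau> ?\<tau>) U \<and> y \<in> U \<and> (\<forall>z\<in>U.
          L2_dist M (Koopman M (case y of (g, h) \<Rightarrow> g \<otimes>\<^bsub>Aut M\<^esub> h) F)
            (Koopman M (case z of (g, h) \<Rightarrow> g \<otimes>\<^bsub>Aut M\<^esub> h) F) < e)"
        using U(1,2) V(1,2) by (intro exI[of _ "U \<times> V"]) (auto simp: y openin_prod_Times_iff)
    qed (use F in \<open>auto simp: topspace_Aut_strong_topology intro!: Koopman_L2\<close>)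
  qed (auto simp: topspace_Aut_strong_topology)
  have "continuous_map ?\<tau> ?\<tau> (\<lambda>g. inv\<^bsub>Aut M\<^esub> g)"
  proof (rule continuous_map_into_Aut)
    fix F assume F: "F \<in> L2 M"
    show "continuous_map ?\<tau> (L2_topology M) (\<lambda>g. Koopman M (inv\<^bsub>Aut M\<^esub> g) F)"
    proof (rule continuous_map_into_L2)
      fix g and e :: real assume "g \<in> topspace ?\<tau>" and e: "0 < e"
      then have g: "g \<in> carrier (Aut M)" by (simp add: topspace_Aut_strong_topology)
      \<comment> \<open>Test on the vector H = g^-1 F instead of F: the distance from H to h^-1 F
        equals that from h H to F = g H, which is small when h is near g.\<close>
      define H where "H = Koopman M (inv\<^bsub>Aut M\<^esub> g) F"
      have H: "H \<in> L2 M" unfolding H_def using g F by (intro Koopman_L2) auto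
      have gH: "Koopman M g H = F"
        unfolding H_def using g F by (simp add: Koopman_mult[symmetric] Koopman_one)
      obtain U where U: "openin ?\<tau> U" "g \<in> U" "\<And>h. h \<in> U \<Longrightarrow> h \<in> carrier (Aut M) \<and>
          L2_dist M (Koopman M g H) (Koopman M h H) < e"
        by (rule Koopman_neighbourhood[OF H g e]) auto
      have "L2_dist M H (Koopman M (inv\<^bsub>Aut M\<^esub> h) F) < e" if h: "h \<in> U" for h
      proof -
        have c: "h \<in> carrier (Aut M)" using U(3)[OF h] by simp
        then have ic: "inv\<^bsub>Aut M\<^esub> h \<in> carrier (Aut M)" by simp
        have "L2_dist M (Koopman M (inv\<^bsub>Aut M\<^esub> h) F) (Koopman M (inv\<^bsub>Aut M\<^esub> h) (Koopman M h H)) = L2_dist M F (Koopman M h H)"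
          by (rule Koopman_isometry[OF ic F Koopman_L2[OF c H]])
        moreover have "Koopman M (inv\<^bsub>Aut M\<^esub> h) (Koopman M h H) = H"
          using c H by (simp add: Koopman_mult[symmetric] Koopman_one)
        ultimately show ?thesis using U(3)[OF h] gH L.commute by simp
      qed
      then show "\<exists>U. openin ?\<tau> U \<and> g \<in> U \<and> (\<forall>h\<in>U.
          L2_dist M (Koopman M (inv\<^bsub>Aut M\<^esub> g) F) (Koopman M (inv\<^bsub>Aut M\<^esub> h) F) < e)"
        using U(1,2) unfolding H_def by blast
    qed (use F in \<open>auto simp: topspace_Aut_strong_topology intro!: Koopman_L2\<close>)
  qed (auto simp: topspace_Aut_strong_topology)
  with mult show ?thesis
    by (simp add: topological_group_def topspace_Aut_strong_topology is_group)
qed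

text \<open>A basic open set of the product constrains finitely many coordinates, and the identity
  operator sits in each of them with some radius to spare.\<close>

lemma identity_neighbourhood_L2:
  assumes U: "openin (Aut_strong_topology M) U" "\<one>\<^bsub>Aut M\<^esub> \<in> U"
  obtains \<Phi> e where "finite \<Phi>" "\<Phi> \<subseteq> L2 M" "0 < e"
    "\<And>g. g \<in> carrier (Aut M) \<Longrightarrow> (\<And>F. F \<in> \<Phi> \<Longrightarrow> L2_dist M F (Koopman M g F) < e) \<Longrightarrow> g \<in> U"
proof -
  interpret L: Metric_space "L2 M" "L2_dist M" by (rule Metric_space_L2)
  obtain V where V: "openin (product_topology (\<lambda>_. L2_topology M) (L2 M)) V"
    and U_eq: "U = Koopman M -` (V \<inter> L2_unitary M) \<inter> carrier (Aut M)"
    using U(1) unfolding Aut_strong_topology_def openin_pullback_topology strong_operator_topology_def openin_subtopology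
    by blast
  have "Koopman M \<one>\<^bsub>Aut M\<^esub> \<in> V" using U(2) U_eq by auto
  then have "\<exists>W. finite {F \<in> L2 M. W F \<noteq> topspace (L2_topology M)} \<and>
      (\<forall>F\<in>L2 M. openin (L2_topology M) (W F)) \<and> Koopman M \<one>\<^bsub>Aut M\<^esub> \<in> Pi\<^sub>E (L2 M) W \<and> Pi\<^sub>E (L2 M) W \<subseteq> V"
    by (rule openin_product_topology_alt[THEN iffD1, rule_format, OF V])
  then obtain W where "finite {F \<in> L2 M. W F \<noteq> topspace (L2_topology M)} \<and>
      (\<forall>F\<in>L2 M. openin (L2_topology M) (W F)) \<and> Koopman M \<one>\<^bsub>Aut M\<^esub> \<in> Pi\<^sub>E (L2 M) W \<and> Pi\<^sub>E (L2 M) W \<subseteq> V" ..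
  then have W: "finite {F \<in> L2 M. W F \<noteq> topspace (L2_topology M)}"
    "\<And>F. F \<in> L2 M \<Longrightarrow> openin (L2_topology M) (W F)" "Koopman M \<one>\<^bsub>Aut M\<^esub> \<in> Pi\<^sub>E (L2 M) W" "Pi\<^sub>E (L2 M) W \<subseteq> V"
    by simp_all
  define \<Phi> where "\<Phi> = {F \<in> L2 M. W F \<noteq> L2 M}"
  have fin: "finite \<Phi>" using W(1) by (simp add: \<Phi>_def)
  have "\<exists>r>0. \<forall>G\<in>L2 M. L2_dist M F G < r \<longrightarrow> G \<in> W F" if F: "F \<in> L2 M" for F
  proof -
    have "F \<in> W F" using W(3) F Koopman_one[OF F] by (metis PiE_mem)
    then obtain r where "r > 0" "L.mball F r \<subseteq> W F"
      using W(2)[OF F] unfolding L2_topology_def L.openin_mtopology by blast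
    then show ?thesis using F by (intro exI[of _ r]) (auto simp: L.in_mball subset_iff)
  qed
  then obtain r where r: "\<And>F. F \<in> L2 M \<Longrightarrow> r F > 0" "\<And>F G. F \<in> L2 M \<Longrightarrow> G \<in> L2 M \<Longrightarrow> L2_dist M F G < r F \<Longrightarrow> G \<in> W F"
    by metis
  \<comment> \<open>The extra 1 keeps the minimum meaningful when no coordinate is
    constrained.\<close>
  define e where "e = Min (insert 1 (r ` \<Phi>))"
  have e: "0 < e" "\<And>F. F \<in> \<Phi> \<Longrightarrow> e \<le> r F"
    unfolding e_def using fin r(1) by (auto simp: \<Phi>_def)
  show ?thesis
  proof (rule that[OF fin _ e(1)])
    show "\<Phi> \<subseteq> L2 M" by (auto simp: \<Phi>_def)
    fix g assume g: "g \<in> carrier (Aut M)" and close: "\<And>F. F \<in> \<Phi> \<Longrightarrow> L2_dist M F (Koopman M g F) < e"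
    have "Koopman M g F \<in> W F" if F: "F \<in> L2 M" for F
    proof (cases "F \<in> \<Phi>")
      case True
      then have "L2_dist M F (Koopman M g F) < r F" using close e(2) by (meson less_le_trans)
      then show ?thesis by (rule r(2)[OF F Koopman_L2[OF g F]])
    next
      case False
      then show ?thesis using Koopman_L2[OF g F] F by (auto simp: \<Phi>_def)
    qed
    then have "Koopman M g \<in> Pi\<^sub>E (L2 M) W" using Koopman_extensional by (auto simp: PiE_def)
    then show "g \<in> U" using W(4) g Koopman_unitary[OF g] by (auto simp: U_eq)
  qed
qed

text \<open>The measure of the symmetric difference of \<open>A\<close> and its preimage under
  \<open>T\<close>. It is informative for \<open>A\<close> of finite measure, as
  \<open>measure\<close> takes the value 0 on sets of infinite measure.\<close>

definition displacement :: "'a measure \<Rightarrow> 'a set \<Rightarrow> ('a \<Rightarrow> 'a) \<Rightarrow> real" where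
  "displacement M A T = measure M {x\<in>space M. (x \<in> A) \<noteq> (T x \<in> A)}"

lemma displaced_fmeasurable:
  assumes T: "T \<in> mp_automorphisms M" and A: "A \<in> fmeasurable M"
  shows "{x\<in>space M. (x \<in> A) \<noteq> (T x \<in> A)} \<in> fmeasurable M"
proof -
  have "T -` A \<inter> space M \<in> fmeasurable M"
    using A mp_automorphism_emeasure[OF T] measurable_sets[OF mp_automorphismD(2)[OF T]]
    by (auto simp: fmeasurable_def)
  then have "(A - (T -` A \<inter> space M)) \<union> ((T -` A \<inter> space M) - A) \<in> fmeasurable M"
    using A by (intro fmeasurable.Un fmeasurable.Diff)
  moreover have "{x\<in>space M. (x \<in> A) \<noteq> (T x \<in> A)} = (A - (T -` A \<inter> space M)) \<union> ((T -` A \<inter> space M) - A)"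
    using sets.sets_into_space[OF fmeasurableD[OF A]] by auto
  ultimately show ?thesis by simp
qed

lemma L2_simple_approximation:
  assumes f: "f \<in> L2_functions M" and e: "0 < e"
  obtains s where "simple_function M s" "s \<in> L2_functions M" "L2_norm M (\<lambda>x. f x - s x) < e"
proof -
  note fm = L2_functionsD[OF f]
  obtain F where F: "\<And>i. simple_function M (F i)" "\<And>x. x \<in> space M \<Longrightarrow> (\<lambda>i. F i x) \<longlonglongrightarrow> f x"
    "\<And>i x. x \<in> space M \<Longrightarrow> dist (F i x) 0 \<le> 2 * dist (f x) 0"
    using borel_measurable_implies_sequence_metric[OF fm(1), of 0] by blast
  have Fm: "F i \<in> borel_measurable M" for i using F(1) by (rule borel_measurable_simple_function)
  have F_le: "cmod (F i x) \<le> 2 * cmod (f x)" if "x \<in> space M" for i x using F(3)[OF that, of i] by simp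
  \<comment> \<open>The approximants satisfy |F i| \<le> 2 |f|, so |f - F i| \<le> 3 |f|, and
    squaring gives the 9.\<close>
  have dom: "integrable M (\<lambda>x. 9 * (cmod (f x))\<^sup>2)" using fm(2) by simp
  have bound: "(cmod (f x - F i x))\<^sup>2 \<le> 9 * (cmod (f x))\<^sup>2" if "x \<in> space M" for i x
  proof -
    have "cmod (f x - F i x) \<le> 3 * cmod (f x)"
      using norm_triangle_ineq4[of "f x" "F i x"] F_le[OF that, of i] by linarith
    then have "(cmod (f x - F i x))\<^sup>2 \<le> (3 * cmod (f x))\<^sup>2" by (intro power_mono) auto
    then show ?thesis by (simp add: power_mult_distrib)
  qed
  have "(\<lambda>i. LINT x|M. (cmod (f x - F i x))\<^sup>2) \<longlonglongrightarrow> (LINT x|M. 0)"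
  proof (rule integral_dominated_convergence[OF _ _ dom])
    show "AE x in M. (\<lambda>i. (cmod (f x - F i x))\<^sup>2) \<longlonglongrightarrow> 0"
    proof (rule AE_I2)
      fix x assume "x \<in> space M"
      then have "(\<lambda>i. (cmod (f x - F i x))\<^sup>2) \<longlonglongrightarrow> (cmod (f x - f x))\<^sup>2"
        by (intro tendsto_intros F(2))
      then show "(\<lambda>i. (cmod (f x - F i x))\<^sup>2) \<longlonglongrightarrow> 0" by simp
    qed
    show "(\<lambda>x. (cmod (f x - F i x))\<^sup>2) \<in> borel_measurable M" for i using fm(1) Fm by measurable
    show "AE x in M. norm ((cmod (f x - F i x))\<^sup>2) \<le> 9 * (cmod (f x))\<^sup>2" for i
      using bound by (intro AE_I2) simp
  qed simp
  then have "(\<lambda>i. L2_norm M (\<lambda>x. f x - F i x)) \<longlonglongrightarrow> sqrt (LINT x|M. 0)"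
    unfolding L2_norm_def by (rule tendsto_real_sqrt)
  then have "\<forall>\<^sub>F i in sequentially. L2_norm M (\<lambda>x. f x - F i x) < e"
    by (rule order_tendstoD(2)) (use e in simp)
  then obtain i where i: "L2_norm M (\<lambda>x. f x - F i x) < e"
    by (meson eventually_happens' sequentially_bot)
  have "integrable M (\<lambda>x. (cmod (F i x))\<^sup>2)"
  proof (rule Bochner_Integration.integrable_bound)
    show "integrable M (\<lambda>x. 4 * (cmod (f x))\<^sup>2)" using fm(2) by simp
    show "(\<lambda>x. (cmod (F i x))\<^sup>2) \<in> borel_measurable M" using Fm by measurable
    show "AE x in M. norm ((cmod (F i x))\<^sup>2) \<le> norm (4 * (cmod (f x))\<^sup>2)"
    proof (rule AE_I2)
      fix x assume "x \<in> space M"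
      then have "(cmod (F i x))\<^sup>2 \<le> (2 * cmod (f x))\<^sup>2" by (intro power_mono F_le) auto
      then show "norm ((cmod (F i x))\<^sup>2) \<le> norm (4 * (cmod (f x))\<^sup>2)" by (simp add: power_mult_distrib)
    qed
  qed
  then have "F i \<in> L2_functions M" using Fm by (simp add: L2_functions_def)
  then show ?thesis using that F(1) i by blast
qed

text \<open>Where s and s \<circ> T differ, at least one of the two values is a nonzero y, and the
  point is displaced relative to the level set of y. The level 0 is left out because its measure may
  be infinite; the other level sets have finite measure as s is square-integrable.\<close>

lemma simple_displacement:
  assumes s: "simple_function M s" "s \<in> L2_functions M" and e: "0 < e"
  obtains \<A> d where "finite \<A>" "\<A> \<subseteq> fmeasurable M" "0 < d"
    "\<And>T. T \<in> mp_automorphisms M \<Longrightarrow> (\<And>A. A \<in> \<A> \<Longrightarrow> displacement M A T < d) \<Longrightarrow>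
      L2_norm M (\<lambda>x. s x - s (T x)) < e"
proof -
  define Y where "Y = s ` space M - {0}"
  define A where "A y = s -` {y} \<inter> space M" for y
  have Y: "finite Y" using simple_functionD(1)[OF s(1)] by (simp add: Y_def)
  have A: "A y \<in> fmeasurable M" if y: "y \<in> Y" for y
  proof -
    have sets: "A y \<in> sets M" unfolding A_def by (rule simple_functionD(2)[OF s(1)])
    have "integrable M (\<lambda>x. indicator (A y) x *\<^sub>R (cmod (s x))\<^sup>2)"
      using L2_functionsD(2)[OF s(2)] sets by (rule integrable_mult_indicator[rotated])
    also have "(\<lambda>x. indicator (A y) x *\<^sub>R (cmod (s x))\<^sup>2) = (\<lambda>x. indicator (A y) x * (cmod y)\<^sup>2)"
      by (auto simp: A_def indicator_def)
    finally have "integrable M (\<lambda>x. indicator (A y) x * (cmod y)\<^sup>2)" .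
    moreover have "y \<noteq> 0" using y by (simp add: Y_def)
    ultimately have "integrable M (indicator (A y) :: _ \<Rightarrow> real)" by simp
    then show ?thesis using sets sets.sets_into_space[OF sets]
      by (simp add: fmeasurable_def integrable_indicator_iff Int_absorb2)
  qed
  define B where "B = Max (insert 0 (cmod ` s ` space M))"
  have fin: "finite (insert 0 (cmod ` s ` space M))" using simple_functionD(1)[OF s(1)] by simp
  have B: "0 \<le> B" "\<And>x. x \<in> space M \<Longrightarrow> cmod (s x) \<le> B" unfolding B_def using fin by auto
  define c where "c = (2 * B)\<^sup>2 * card Y"
  have c: "0 \<le> c" by (simp add: c_def)
  \<comment> \<open>The squared norm will be at most c d, with c collecting the bound (2 B)^2 for
    each nonzero level; the added 1 covers c = 0 and makes the final inequality strict.\<close>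
  define d where "d = e\<^sup>2 / (c + 1)"
  have d: "0 < d" using e c by (simp add: d_def)
  show ?thesis
  proof (rule that[of "A ` Y" d])
    show "finite (A ` Y)" "A ` Y \<subseteq> fmeasurable M" "0 < d" using Y A d by auto
    fix T assume T: "T \<in> mp_automorphisms M" and close: "\<And>E. E \<in> A ` Y \<Longrightarrow> displacement M E T < d"
    define E where "E y = {x\<in>space M. (x \<in> A y) \<noteq> (T x \<in> A y)}" for y
    have E: "E y \<in> fmeasurable M" if "y \<in> Y" for y unfolding E_def by (rule displaced_fmeasurable[OF T A[OF that]])
    have intE: "integrable M (indicator (E y) :: _ \<Rightarrow> real)" if "y \<in> Y" for y
      using E[OF that] by (intro integrable_real_indicator) (auto simp: fmeasurable_def)
    have bound: "(cmod (s x - s (T x)))\<^sup>2 \<le> (\<Sum>y\<in>Y. (2 * B)\<^sup>2 * indicator (E y) x)" if x: "x \<in> space M" for x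
    proof (cases "s x = s (T x)")
      case False
      have Tx: "T x \<in> space M" by (rule mp_automorphism_space[OF T x])
      obtain y where y: "y \<in> Y" "x \<in> E y"
      proof (cases "s x = 0")
        case True
        then show ?thesis using False x Tx that[of "s (T x)"] by (auto simp: Y_def E_def A_def)
      next
        case nz: False
        then show ?thesis using False x Tx that[of "s x"] by (auto simp: Y_def E_def A_def)
      qed
      have "cmod (s x - s (T x)) \<le> 2 * B"
        using norm_triangle_ineq4[of "s x" "s (T x)"] B(2)[OF x] B(2)[OF Tx] by linarith
      then have "(cmod (s x - s (T x)))\<^sup>2 \<le> (2 * B)\<^sup>2" by (rule power_mono) simp
      then have "(cmod (s x - s (T x)))\<^sup>2 \<le> (2 * B)\<^sup>2 * indicator (E y) x" using y by simp
      also have "\<dots> \<le> (\<Sum>y\<in>Y. (2 * B)\<^sup>2 * indicator (E y) x)"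
        by (rule member_le_sum[OF y(1) _ Y]) (auto simp: indicator_def)
      finally show ?thesis .
    qed (auto intro!: sum_nonneg)
    have sT: "(\<lambda>x. s x - s (T x)) \<in> L2_functions M"
      by (rule L2_functions_diff[OF s(2) L2_functions_automorphism[OF T s(2)]])
    have "(L2_norm M (\<lambda>x. s x - s (T x)))\<^sup>2 \<le> (LINT x|M. (\<Sum>y\<in>Y. (2 * B)\<^sup>2 * indicator (E y) x))"
      unfolding L2_norm_power2 using L2_functionsD(2)[OF sT] intE bound
      by (intro integral_mono Bochner_Integration.integrable_sum integrable_mult_right) auto
    also have "\<dots> = (\<Sum>y\<in>Y. (2 * B)\<^sup>2 * measure M (E y))"
      using intE E sets.sets_into_space[OF fmeasurableD[OF E]]
      by (subst Bochner_Integration.integral_sum) (auto simp: Int_absorb2 intro!: sum.cong)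
    also have "\<dots> \<le> (\<Sum>y\<in>Y. (2 * B)\<^sup>2 * d)"
      using close by (intro sum_mono mult_left_mono) (auto simp: E_def displacement_def intro: less_imp_le)
    also have "\<dots> = c * d" by (simp add: c_def)
    also have "\<dots> < (c + 1) * d" using d by simp
    also have "\<dots> = e\<^sup>2" using c by (simp add: d_def)
    finally show "L2_norm M (\<lambda>x. s x - s (T x)) < e"
      by (rule power2_less_imp_less) (use e in simp)
  qed
qed

text \<open>Density of simple functions, uniformly in T: the error of replacing f \<circ> T by s
  \<circ> T has the same norm as f - s, so a single s works for every T.\<close>

lemma L2_displacement:
  assumes f: "f \<in> L2_functions M" and e: "0 < e"
  obtains \<A> d where "finite \<A>" "\<A> \<subseteq> fmeasurable M" "0 < d"
    "\<And>T. T \<in> mp_automorphisms M \<Longrightarrow> (\<And>A. A \<in> \<A> \<Longrightarrow> displacement M A T < d) \<Longrightarrow>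
      L2_norm M (\<lambda>x. f x - f (T x)) < e"
proof -
  have e3: "0 < e / 3" using e by simp
  obtain s where s: "simple_function M s" "s \<in> L2_functions M" "L2_norm M (\<lambda>x. f x - s x) < e / 3"
    by (rule L2_simple_approximation[OF f e3])
  obtain \<A> d where Ad: "finite \<A>" "\<A> \<subseteq> fmeasurable M" "0 < d"
    "\<And>T. T \<in> mp_automorphisms M \<Longrightarrow> (\<And>A. A \<in> \<A> \<Longrightarrow> displacement M A T < d) \<Longrightarrow>
      L2_norm M (\<lambda>x. s x - s (T x)) < e / 3"
    by (rule simple_displacement[OF s(1,2) e3]) blast
  show ?thesis
  proof (rule that[OF Ad(1-3)])
    fix T assume T: "T \<in> mp_automorphisms M" and close: "\<And>A. A \<in> \<A> \<Longrightarrow> displacement M A T < d"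
    note fT = L2_functions_automorphism[OF T f] and sT = L2_functions_automorphism[OF T s(2)]
    have "L2_norm M (\<lambda>x. f x - f (T x)) \<le> L2_norm M (\<lambda>x. f x - s x) + L2_norm M (\<lambda>x. s x - f (T x))"
      by (rule L2_norm_diff_triangle[OF f s(2) fT])
    also have "L2_norm M (\<lambda>x. s x - f (T x)) \<le> L2_norm M (\<lambda>x. s x - s (T x)) + L2_norm M (\<lambda>x. s (T x) - f (T x))"
      by (rule L2_norm_diff_triangle[OF s(2) sT fT])
    also have "L2_norm M (\<lambda>x. s (T x) - f (T x)) = L2_norm M (\<lambda>x. s x - f x)"
      by (rule L2_norm_automorphism[OF T L2_functionsD(1)[OF L2_functions_diff[OF s(2) f]]])
    also have "\<dots> = L2_norm M (\<lambda>x. f x - s x)" by (rule L2_norm_commute)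
    finally show "L2_norm M (\<lambda>x. f x - f (T x)) < e"
      using s(3) Ad(4)[OF T close] by simp
  qed
qed

lemma identity_neighbourhood:
  assumes U: "openin (Aut_strong_topology M) U" "\<one>\<^bsub>Aut M\<^esub> \<in> U"
  obtains \<A> d where "finite \<A>" "\<A> \<subseteq> fmeasurable M" "0 < d"
    "\<And>T. T \<in> mp_automorphisms M \<Longrightarrow> (\<And>A. A \<in> \<A> \<Longrightarrow> displacement M A T < d) \<Longrightarrow> aut_class M T \<in> U"
proof -
  obtain \<Phi> e where \<Phi>: "finite \<Phi>" "\<Phi> \<subseteq> L2 M" "0 < e"
    "\<And>g. g \<in> carrier (Aut M) \<Longrightarrow> (\<And>F. F \<in> \<Phi> \<Longrightarrow> L2_dist M F (Koopman M g F) < e) \<Longrightarrow> g \<in> U"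
    by (rule identity_neighbourhood_L2[OF U]) blast
  have "\<exists>\<A> d. finite \<A> \<and> \<A> \<subseteq> fmeasurable M \<and> 0 < d \<and>
      (\<forall>T\<in>mp_automorphisms M. (\<forall>A\<in>\<A>. displacement M A T < d) \<longrightarrow>
        L2_dist M F (Koopman M (aut_class M T) F) < e)" if F: "F \<in> \<Phi>" for F
  proof -
    have "F \<in> L2 M" using F \<Phi>(2) by blast
    then obtain f where f: "f \<in> L2_functions M" "F = L2_class M f" by (rule L2_cases)
    obtain \<A> d where Ad: "finite \<A>" "\<A> \<subseteq> fmeasurable M" "0 < d"
      "\<And>T. T \<in> mp_automorphisms M \<Longrightarrow> (\<And>A. A \<in> \<A> \<Longrightarrow> displacement M A T < d) \<Longrightarrow>
        L2_norm M (\<lambda>x. f x - f (T x)) < e"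
      by (rule L2_displacement[OF f(1) \<Phi>(3)]) blast
    have "L2_dist M F (Koopman M (aut_class M T) F) = L2_norm M (\<lambda>x. f x - f (T x))"
      if T: "T \<in> mp_automorphisms M" for T
    proof -
      note R = mp_inv_automorphism[OF T]
      have "L2_dist M F (Koopman M (aut_class M T) F) = L2_norm M (\<lambda>x. f x - f (mp_inv M T x))"
        using f T R by (simp add: Koopman_class L2_dist_class L2_functions_automorphism)
      \<comment> \<open>The operator involves the inverse of T, but \<open>displacement\<close> is
        stated for T; the norm-preserving substitution of T x for x exchanges them.\<close>
      also have "\<dots> = L2_norm M (\<lambda>x. f (T x) - f (mp_inv M T (T x)))"
        by (rule L2_norm_automorphism[OF T L2_functionsD(1)[OF L2_functions_diff[OF f(1) L2_functions_automorphism[OF R f(1)]]], symmetric])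
      also have "\<dots> = L2_norm M (\<lambda>x. f (T x) - f x)"
        unfolding L2_norm_def by (intro arg_cong[where f=sqrt] Bochner_Integration.integral_cong) (simp_all add: mp_inv_cancel[OF T])
      also have "\<dots> = L2_norm M (\<lambda>x. f x - f (T x))" by (rule L2_norm_commute)
      finally show ?thesis .
    qed
    then show ?thesis using Ad by (intro exI[of _ \<A>] exI[of _ d]) auto
  qed
  then obtain \<A> d where Ad: "\<And>F. F \<in> \<Phi> \<Longrightarrow> finite (\<A> F) \<and> \<A> F \<subseteq> fmeasurable M \<and> 0 < d F \<and>
      (\<forall>T\<in>mp_automorphisms M. (\<forall>A\<in>\<A> F. displacement M A T < d F) \<longrightarrow>
        L2_dist M F (Koopman M (aut_class M T) F) < e)" by metis
  define d0 where "d0 = Min (insert 1 (d ` \<Phi>))"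
  have d0: "0 < d0" "\<And>F. F \<in> \<Phi> \<Longrightarrow> d0 \<le> d F" unfolding d0_def using \<Phi>(1) Ad by auto
  show ?thesis
  proof (rule that[of "\<Union>F\<in>\<Phi>. \<A> F" d0])
    show "finite (\<Union>F\<in>\<Phi>. \<A> F)" "(\<Union>F\<in>\<Phi>. \<A> F) \<subseteq> fmeasurable M" "0 < d0"
      using \<Phi>(1) Ad d0 by auto
    fix T assume T: "T \<in> mp_automorphisms M" and close: "\<And>A. A \<in> (\<Union>F\<in>\<Phi>. \<A> F) \<Longrightarrow> displacement M A T < d0"
    show "aut_class M T \<in> U"
    proof (rule \<Phi>(4))
      show "aut_class M T \<in> carrier (Aut M)" using T by (auto simp: carrier_Aut)
      fix F assume F: "F \<in> \<Phi>"
      have "displacement M A T < d F" if "A \<in> \<A> F" for A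
        using close[of A] d0(2)[OF F] that F by fastforce
      then show "L2_dist M F (Koopman M (aut_class M T) F) < e" using Ad[OF F] T by blast
    qed
  qed
qed

section \<open>Approximation by permutations\<close>

text \<open>Up to a part of the uncovered rest, E is the disjoint union of the pieces inside it.
  Counting pieces therefore measures E with an error of at most \<open>R\<close> pieces, whatever
  \<open>N\<close> is.\<close>

lemma piece_count:
  assumes I: "finite I" "disjoint_family_on C I" and N: "0 < (N::nat)"
    and C: "\<And>i. i \<in> I \<Longrightarrow> C i \<in> sets M" "\<And>i. i \<in> I \<Longrightarrow> measure M (C i) = 1 / N" "\<And>i. i \<in> I \<Longrightarrow> C i \<subseteq> \<Omega>"
    and \<Omega>: "\<Omega> \<in> fmeasurable M" "measure M (\<Omega> - (\<Union>i\<in>I. C i)) \<le> R / N"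
    and E: "E \<in> sets M" "E \<subseteq> \<Omega>" "\<And>i. i \<in> I \<Longrightarrow> C i \<subseteq> E \<or> C i \<inter> E = {}"
  shows "card {i\<in>I. C i \<subseteq> E} \<le> N * measure M E" "N * measure M E \<le> card {i\<in>I. C i \<subseteq> E} + R"
proof -
  define J where "J = {i\<in>I. C i \<subseteq> E}"
  have J: "finite J" "J \<subseteq> I" using I by (auto simp: J_def)
  have Cf: "C i \<in> fmeasurable M" if "i \<in> I" for i
    using fmeasurableI2[OF \<Omega>(1) C(3)[OF that] C(1)[OF that]] .
  have Ef: "E \<in> fmeasurable M" using fmeasurableI2[OF \<Omega>(1) E(2,1)] .
  have "measure M (\<Union>i\<in>J. C i) = (\<Sum>i\<in>J. measure M (C i))"
  proof (rule measure_UNION')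
    show "pairwise (\<lambda>i j. disjnt (C i) (C j)) J"
      using I(2) J(2) unfolding pairwise_def disjnt_def disjoint_family_on_def by blast
  qed (use J Cf in auto)
  also have "\<dots> = (\<Sum>i\<in>J. 1 / N)" using J C(2) by (intro sum.cong) auto
  finally have J_meas: "measure M (\<Union>i\<in>J. C i) = card J / N" by simp
  have "measure M (\<Union>i\<in>J. C i) \<le> measure M E"
    using J C(1) Ef by (intro measure_mono_fmeasurable) (auto simp: J_def)
  then show "card {i\<in>I. C i \<subseteq> E} \<le> N * measure M E"
    using N by (simp add: J_meas J_def[symmetric] field_simps)
  have "E \<subseteq> (\<Union>i\<in>J. C i) \<union> (\<Omega> - (\<Union>i\<in>I. C i))" using E(2,3) by (fastforce simp: J_def)
  moreover have UJ: "(\<Union>i\<in>J. C i) \<in> fmeasurable M" using J Cf by (intro fmeasurable.finite_UN) auto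
  moreover have rest: "\<Omega> - (\<Union>i\<in>I. C i) \<in> fmeasurable M"
    using I(1) Cf \<Omega>(1) by (intro fmeasurable.Diff fmeasurable.finite_UN) auto
  ultimately have "measure M E \<le> measure M ((\<Union>i\<in>J. C i) \<union> (\<Omega> - (\<Union>i\<in>I. C i)))"
    using E(1) by (intro measure_mono_fmeasurable fmeasurable.Un)
  also have "\<dots> \<le> measure M (\<Union>i\<in>J. C i) + measure M (\<Omega> - (\<Union>i\<in>I. C i))"
    using UJ rest by (intro measure_Un_le) (auto simp: fmeasurable_def)
  also have "\<dots> \<le> card J / N + R / N" using J_meas \<Omega>(2) by simp
  finally show "N * measure M E \<le> card {i\<in>I. C i \<subseteq> E} + R"
    using N by (simp add: J_def[symmetric] field_simps)
qed

lemma measure_preimage_automorphism: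
  assumes "S \<in> mp_automorphisms M" "A \<in> sets M"
  shows "measure M (S -` A \<inter> space M) = measure M A"
  using mp_automorphism_emeasure[OF assms] by (simp add: measure_def)

lemma label_cell_sets:
  assumes "finite \<A>" "\<A> \<subseteq> sets M" "S \<in> measurable M M" "\<Omega> \<in> sets M"
  shows "{x\<in>\<Omega>. {A\<in>\<A>. S x \<in> A} = v} \<in> sets M"
proof -
  have pre: "S -` A \<inter> space M \<in> sets M" if "A \<in> \<A>" for A using assms that by (auto intro: measurable_sets)
  have sub: "\<Omega> \<subseteq> space M" using sets.sets_into_space assms(4) by blast
  show ?thesis
  proof (cases "v \<subseteq> \<A>")
    case True
    then have "{x\<in>\<Omega>. {A\<in>\<A>. S x \<in> A} = v} =
      (\<Omega> - (\<Union>A\<in>v. \<Omega> - (S -` A \<inter> space M))) - (\<Union>A\<in>\<A> - v. S -` A \<inter> space M)"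
      using sub by auto
    also have "\<dots> \<in> sets M"
      using assms(1,4) pre True by (intro sets.Diff sets.finite_UN) (auto intro: finite_subset)
    finally show ?thesis .
  next
    case False
    then have "{x\<in>\<Omega>. {A\<in>\<A>. S x \<in> A} = v} = {}" by auto
    then show ?thesis by (simp only: sets.empty_sets)
  qed
qed

text \<open>For nonempty v the left cell is the S-preimage of the right one. For empty v the
  preimage can leave \<Omega>; there both cells are complements in \<Omega> of sets of equal
  measure, and finiteness of \<Omega> allows the subtraction.\<close>

lemma label_cell_measure:
  assumes \<A>: "finite \<A>" "\<A> \<subseteq> sets M" and S: "S \<in> mp_automorphisms M" and \<Omega>: "\<Omega> \<in> fmeasurable M"
    and sub: "\<And>A. A \<in> \<A> \<Longrightarrow> A \<subseteq> \<Omega>" "\<And>A. A \<in> \<A> \<Longrightarrow> S -` A \<inter> space M \<subseteq> \<Omega>"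
  shows "measure M {x\<in>\<Omega>. {A\<in>\<A>. S x \<in> A} = v} = measure M {x\<in>\<Omega>. {A\<in>\<A>. x \<in> A} = v}"
proof -
  have \<Omega>_sub: "\<Omega> \<subseteq> space M" using sets.sets_into_space[OF fmeasurableD[OF \<Omega>]] .
  have sets: "{x\<in>\<Omega>. {A\<in>\<A>. x \<in> A} = v} \<in> sets M" for v
    using label_cell_sets[of \<A> M "\<lambda>x. x" \<Omega> v] \<A> fmeasurableD[OF \<Omega>] by simp
  show ?thesis
  proof (cases "v = {}")
    case False
    have "S -` {x\<in>\<Omega>. {A\<in>\<A>. x \<in> A} = v} \<inter> space M = {x\<in>\<Omega>. {A\<in>\<A>. S x \<in> A} = v}"
    proof (intro equalityI subsetI)
      fix x assume "x \<in> S -` {x\<in>\<Omega>. {A\<in>\<A>. x \<in> A} = v} \<inter> space M"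
      then have x: "x \<in> space M" "{A\<in>\<A>. S x \<in> A} = v" by auto
      then obtain A where "A \<in> \<A>" "S x \<in> A" using False by blast
      then have "x \<in> \<Omega>" using sub(2) x by blast
      then show "x \<in> {x\<in>\<Omega>. {A\<in>\<A>. S x \<in> A} = v}" using x by simp
    next
      fix x assume "x \<in> {x\<in>\<Omega>. {A\<in>\<A>. S x \<in> A} = v}"
      then have x: "x \<in> \<Omega>" "{A\<in>\<A>. S x \<in> A} = v" by auto
      then obtain A where "A \<in> \<A>" "S x \<in> A" using False by blast
      then have "S x \<in> \<Omega>" using sub(1) by blast
      then show "x \<in> S -` {x\<in>\<Omega>. {A\<in>\<A>. x \<in> A} = v} \<inter> space M" using x \<Omega>_sub by auto
    qed
    then show ?thesis using measure_preimage_automorphism[OF S sets, of v] by simp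
  next
    case True
    have U: "\<Union>\<A> \<in> sets M" using \<A> by (intro sets.finite_Union) auto
    have S_U: "S -` \<Union>\<A> \<inter> space M \<in> sets M" using U mp_automorphismD(2)[OF S] by (rule measurable_sets[rotated])
    have "{x\<in>\<Omega>. {A\<in>\<A>. S x \<in> A} = v} = \<Omega> - (S -` \<Union>\<A> \<inter> space M)" using True \<Omega>_sub by auto
    moreover have "{x\<in>\<Omega>. {A\<in>\<A>. x \<in> A} = v} = \<Omega> - \<Union>\<A>" using True by auto
    moreover have "measure M (\<Omega> - (S -` \<Union>\<A> \<inter> space M)) = measure M \<Omega> - measure M (S -` \<Union>\<A> \<inter> space M)"
      using \<Omega> S_U sub(2) by (intro measurable_measure_Diff) auto
    moreover have "measure M (\<Omega> - \<Union>\<A>) = measure M \<Omega> - measure M (\<Union>\<A>)"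
      using \<Omega> U sub(1) by (intro measurable_measure_Diff) auto
    ultimately show ?thesis using measure_preimage_automorphism[OF S U] by simp
  qed
qed

text \<open>Substitute x = S y, which preserves the measure. Closeness of T S^-1 to the identity
  thus means that S and T mostly agree on whether a point lands in \<open>A\<close>.\<close>

lemma displacement_compose_inv:
  assumes S: "S \<in> mp_automorphisms M" and T: "T \<in> mp_automorphisms M" and A: "A \<in> sets M"
  shows "displacement M A (compose (space M) T (mp_inv M S)) = measure M {y\<in>space M. (S y \<in> A) \<noteq> (T y \<in> A)}"
proof -
  let ?R = "compose (space M) T (mp_inv M S)"
  let ?E = "{x\<in>space M. (x \<in> A) \<noteq> (?R x \<in> A)}"
  have R: "?R \<in> mp_automorphisms M" by (rule compose_automorphism[OF T mp_inv_automorphism[OF S]])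
  have "?E = (A - (?R -` A \<inter> space M)) \<union> ((?R -` A \<inter> space M) - A)"
    using sets.sets_into_space[OF A] by auto
  also have "\<dots> \<in> sets M" using A measurable_sets[OF mp_automorphismD(2)[OF R] A] by auto
  finally have "measure M (S -` ?E \<inter> space M) = measure M ?E" by (rule measure_preimage_automorphism[OF S])
  moreover have "S -` ?E \<inter> space M = {y\<in>space M. (S y \<in> A) \<noteq> (T y \<in> A)}"
    using mp_automorphism_space[OF S] mp_inv_cancel[OF S] by (auto simp: compose_def)
  ultimately show ?thesis by (simp add: displacement_def)
qed

text \<open>What the concentration argument needs from level \<open>N\<close>. The bound on
  \<open>card I\<close> is linear in \<open>N\<close>, so that it loses against the square in the
  variance estimate; the displacement bound translates Hamming distance into closeness in the strong
  topology.\<close>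

definition permutation_model where
  "permutation_model M \<A> \<S> d c N I T \<longleftrightarrow> finite I \<and> card I \<le> c * real N \<and>
      (\<forall>\<sigma>. \<sigma> permutes I \<longrightarrow> T \<sigma> \<in> mp_automorphisms M) \<and>
      (\<forall>\<sigma> \<tau>. \<sigma> permutes I \<longrightarrow> \<tau> permutes I \<longrightarrow> T (\<sigma> \<circ> \<tau>) = compose (space M) (T \<sigma>) (T \<tau>)) \<and>
      (\<forall>\<sigma> A. \<sigma> permutes I \<longrightarrow> A \<in> \<A> \<longrightarrow> displacement M A (T \<sigma>) \<le> card {i. \<sigma> i \<noteq> i} / real N) \<and>
      (\<forall>S\<in>\<S>. \<exists>\<sigma>. \<sigma> permutes I \<and> (\<forall>A\<in>\<A>. displacement M A (compose (space M) (T \<sigma>) (mp_inv M S)) < d))"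

text \<open>Label a piece by the sets \<open>A \<in> \<A>\<close> containing it, and alternatively by the \<open>A\<close> whose preimage under
  \<open>S\<close> contains it. As \<open>S\<close> preserves the measure, a label occurs about equally often in both labellings, so
  some permutation of the pieces matches nearly all labels.\<close>

lemma permutation_approximation:
  fixes M :: "'a measure"
  assumes M: "standard_borel M" "nonatomic M"
    and \<A>: "finite \<A>" "\<A> \<subseteq> fmeasurable M" and \<S>: "finite \<S>" "\<S> \<subseteq> mp_automorphisms M" and d: "0 < d"
  obtains c N0 where "0 \<le> c"
    "\<And>N. N0 \<le> N \<Longrightarrow> \<exists>(I :: ('a set set \<times> nat) set) T. permutation_model M \<A> \<S> d c N I T"
proof -
  \<comment> \<open>Preimages under the S are included so that a piece lies wholly inside or outside
    each of them, which makes both labels of a piece well defined.\<close>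
  define \<D> where "\<D> = \<A> \<union> (\<lambda>(S, A). S -` A \<inter> space M) ` (\<S> \<times> \<A>)"
  have \<A>_sets: "\<A> \<subseteq> sets M" using \<A>(2) by (auto simp: fmeasurable_def)
  have \<D>: "finite \<D>" using \<A>(1) \<S>(1) by (simp add: \<D>_def)
  have \<D>_sets: "D \<in> sets M" "emeasure M D < \<infinity>" if "D \<in> \<D>" for D
  proof -
    have "D \<in> sets M \<and> emeasure M D < \<infinity>"
    proof (cases "D \<in> \<A>")
      case True
      then show ?thesis using \<A>(2) by (auto simp: fmeasurable_def)
    next
      case False
      then have "D \<in> (\<lambda>(S, A). S -` A \<inter> space M) ` (\<S> \<times> \<A>)" using that by (simp add: \<D>_def)
      then obtain S A where D: "D = S -` A \<inter> space M" and S: "S \<in> mp_automorphisms M" and A: "A \<in> fmeasurable M"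
        using \<A>(2) \<S>(2) by auto
      then show ?thesis
        using mp_automorphism_emeasure[OF S fmeasurableD[OF A]] measurable_sets[OF mp_automorphismD(2)[OF S] fmeasurableD[OF A]]
        by (auto simp: fmeasurable_def)
    qed
    then show "D \<in> sets M" "emeasure M D < \<infinity>" by auto
  qed
  define \<Omega> where "\<Omega> = \<Union>\<D>"
  have \<Omega>: "\<Omega> \<in> fmeasurable M" unfolding \<Omega>_def using \<D> \<D>_sets by (intro fmeasurable.finite_Union) (auto simp: fmeasurable_def)
  define R where "R = (2::nat) ^ card \<D>"
  define V where "V = card (Pow \<A>)"
  \<comment> \<open>Matching may fail on V R pieces (at most \<open>R\<close> for each of
    \<open>V\<close> labels), and a set of measure at most R / N is covered by no piece. These
    errors together must stay below d.\<close>
  obtain N0 where N0: "(V * R + R) / d < real N0" using reals_Archimedean2 by blast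
  show ?thesis
  proof (rule that[of "measure M \<Omega>" "Suc N0"])
    fix N assume N_ge: "Suc N0 \<le> N"
    then have N: "0 < N" by simp
    have small: "(V * R + R) / real N < d"
    proof -
      have "(V * R + R) / d < real N" using N0 N_ge by linarith
      then show ?thesis using d N by (simp add: field_simps)
    qed
    obtain I and C :: "'a set set \<times> nat \<Rightarrow> 'a set" where I: "finite I" "disjoint_family_on C I"
      and C: "\<And>i. i \<in> I \<Longrightarrow> C i \<in> sets M" "\<And>i. i \<in> I \<Longrightarrow> measure M (C i) = 1 / N" "\<And>i. i \<in> I \<Longrightarrow> C i \<subseteq> \<Omega>"
        "\<And>i D. i \<in> I \<Longrightarrow> D \<in> \<D> \<Longrightarrow> C i \<subseteq> D \<or> C i \<inter> D = {}"
      and rest: "measure M (\<Omega> - (\<Union>i\<in>I. C i)) \<le> R / N"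
      unfolding \<Omega>_def R_def by (rule fine_partition[OF M \<D> \<D>_sets N]) auto
    have C_fm: "C i \<in> fmeasurable M" if "i \<in> I" for i
      using fmeasurableI2[OF \<Omega> C(3)[OF that] C(1)[OF that]] .
    have C_em: "emeasure M (C i) = ennreal (1 / N)" if "i \<in> I" for i
      using emeasure_eq_measure2[OF C_fm[OF that]] C(2)[OF that] by simp
    have C_ne: "C i \<noteq> {}" if "i \<in> I" for i using C(2)[OF that] N by auto
    have count: "card {i\<in>I. C i \<subseteq> E} \<le> N * measure M E" "N * measure M E \<le> card {i\<in>I. C i \<subseteq> E} + R"
      if "E \<in> sets M" "E \<subseteq> \<Omega>" "\<And>i. i \<in> I \<Longrightarrow> C i \<subseteq> E \<or> C i \<inter> E = {}" for E
      by (rule piece_count[OF I N _ _ _ \<Omega> rest that]; use C(1-3) in blast)+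
    obtain C' T where C': "\<And>i. i \<in> I \<Longrightarrow> C' i \<in> sets M" "\<And>i. i \<in> I \<Longrightarrow> C' i \<subseteq> C i" "\<And>i. i \<in> I \<Longrightarrow> emeasure M (C i - C' i) = 0"
      and T: "\<And>\<sigma>. \<sigma> permutes I \<Longrightarrow> T \<sigma> \<in> mp_automorphisms M"
        "\<And>\<sigma> \<tau>. \<sigma> permutes I \<Longrightarrow> \<tau> permutes I \<Longrightarrow> T (\<sigma> \<circ> \<tau>) = compose (space M) (T \<sigma>) (T \<tau>)"
        "\<And>\<sigma> i p. \<sigma> permutes I \<Longrightarrow> i \<in> I \<Longrightarrow> p \<in> C' i \<Longrightarrow> T \<sigma> p \<in> C' (\<sigma> i)"
        "\<And>\<sigma> i p. \<sigma> permutes I \<Longrightarrow> i \<in> I \<Longrightarrow> p \<in> C' i \<Longrightarrow> \<sigma> i = i \<Longrightarrow> T \<sigma> p = p"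
        "\<And>\<sigma> p. \<sigma> permutes I \<Longrightarrow> p \<in> space M \<Longrightarrow> p \<notin> (\<Union>i\<in>I. C' i) \<Longrightarrow> T \<sigma> p = p"
      apply (rule permutation_automorphisms[OF M I C(1) C_em], assumption, assumption)
      subgoal premises prems by (rule that; rule prems; assumption)
      done
    have meas_UN: "measure M (\<Union>i\<in>J. C i) \<le> card J / N" if "J \<subseteq> I" for J
    proof -
      have "measure M (\<Union>i\<in>J. C i) \<le> (\<Sum>i\<in>J. measure M (C i))"
        using that I(1) C(1) by (intro measure_UNION_le) (auto intro: finite_subset)
      also have "\<dots> = (\<Sum>i\<in>J. 1 / N)" using that C(2) by (intro sum.cong) auto
      finally show ?thesis by simp
    qed
    have UN_fm: "(\<Union>i\<in>J. C i) \<in> fmeasurable M" if "J \<subseteq> I" for J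
      using that I(1) C_fm by (intro fmeasurable.finite_UN) (auto intro: finite_subset)
    have card_I: "card I \<le> measure M \<Omega> * real N"
    proof -
      have "{i\<in>I. C i \<subseteq> \<Omega>} = I" using C(3) by auto
      then show ?thesis using count(1)[of \<Omega>] C(3) fmeasurableD[OF \<Omega>] by (simp add: mult.commute)
    qed
    have moved: "displacement M A (T \<sigma>) \<le> card {i. \<sigma> i \<noteq> i} / real N" if \<sigma>: "\<sigma> permutes I" and A: "A \<in> \<A>" for \<sigma> A
    proof -
      have sub: "{i. \<sigma> i \<noteq> i} \<subseteq> I" using \<sigma> by (auto simp: permutes_def)
      have "{x\<in>space M. (x \<in> A) \<noteq> (T \<sigma> x \<in> A)} \<subseteq> (\<Union>i\<in>{i. \<sigma> i \<noteq> i}. C i)"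
      proof
        fix x assume "x \<in> {x\<in>space M. (x \<in> A) \<noteq> (T \<sigma> x \<in> A)}"
        then have x: "x \<in> space M" "T \<sigma> x \<noteq> x" by auto
        then obtain i where i: "i \<in> I" "x \<in> C' i" using T(5)[OF \<sigma>] by blast
        then have "\<sigma> i \<noteq> i" using T(4)[OF \<sigma>] x by blast
        then show "x \<in> (\<Union>i\<in>{i. \<sigma> i \<noteq> i}. C i)" using i C'(2) by blast
      qed
      then have "displacement M A (T \<sigma>) \<le> measure M (\<Union>i\<in>{i. \<sigma> i \<noteq> i}. C i)"
        unfolding displacement_def using UN_fm[OF sub] displaced_fmeasurable[OF T(1)[OF \<sigma>]] A \<A>(2)
        by (intro measure_mono_fmeasurable) (auto simp: fmeasurable_def)
      also have "\<dots> \<le> card {i. \<sigma> i \<noteq> i} / N" by (rule meas_UN[OF sub])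
      finally show ?thesis by simp
    qed
    have approx: "\<exists>\<sigma>. \<sigma> permutes I \<and> (\<forall>A\<in>\<A>. displacement M A (compose (space M) (T \<sigma>) (mp_inv M S)) < d)"
      if S_mem: "S \<in> \<S>" for S
    proof -
      have S: "S \<in> mp_automorphisms M" using S_mem \<S>(2) by blast
      have subA: "A \<subseteq> \<Omega>" "S -` A \<inter> space M \<subseteq> \<Omega>" "A \<in> \<D>" "S -` A \<inter> space M \<in> \<D>" if "A \<in> \<A>" for A
        using that S_mem by (auto simp: \<Omega>_def \<D>_def)
      define \<alpha> where "\<alpha> i = {A\<in>\<A>. C i \<subseteq> A}" for i
      define \<beta> where "\<beta> i = {A\<in>\<A>. C i \<subseteq> S -` A \<inter> space M}" for i
      have \<alpha>: "{A\<in>\<A>. x \<in> A} = \<alpha> i" if "i \<in> I" "x \<in> C i" for i x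
        unfolding \<alpha>_def using C(4)[OF that(1)] subA(3) that(2) by blast
      have \<beta>: "{A\<in>\<A>. S x \<in> A} = \<beta> i" if "i \<in> I" "x \<in> C i" for i x
      proof -
        have "x \<in> space M" using that C(1) sets.sets_into_space by blast
        then have "S x \<in> A \<longleftrightarrow> C i \<subseteq> S -` A \<inter> space M" if "A \<in> \<A>" for A
          using C(4)[OF \<open>i \<in> I\<close> subA(4)[OF that]] \<open>x \<in> C i\<close> by blast
        then show ?thesis by (auto simp: \<beta>_def)
      qed
      define E where "E v = {x\<in>\<Omega>. {A\<in>\<A>. x \<in> A} = v}" for v
      define E' where "E' v = {x\<in>\<Omega>. {A\<in>\<A>. S x \<in> A} = v}" for v
      have E_piece: "(C i \<subseteq> E v \<longleftrightarrow> \<alpha> i = v) \<and> (C i \<subseteq> E v \<or> C i \<inter> E v = {})" if i: "i \<in> I" for i v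
      proof -
        have "x \<in> E v \<longleftrightarrow> \<alpha> i = v" if "x \<in> C i" for x
          using \<alpha>[OF i that] C(3)[OF i] that unfolding E_def by auto
        then show ?thesis using C_ne[OF i] by blast
      qed
      have E'_piece: "(C i \<subseteq> E' v \<longleftrightarrow> \<beta> i = v) \<and> (C i \<subseteq> E' v \<or> C i \<inter> E' v = {})" if i: "i \<in> I" for i v
      proof -
        have "x \<in> E' v \<longleftrightarrow> \<beta> i = v" if "x \<in> C i" for x
          using \<beta>[OF i that] C(3)[OF i] that unfolding E'_def by auto
        then show ?thesis using C_ne[OF i] by blast
      qed
      have E_sets: "E v \<in> sets M" "E v \<subseteq> \<Omega>" for v
        using label_cell_sets[of \<A> M "\<lambda>x. x" \<Omega> v] \<A>(1) \<A>_sets fmeasurableD[OF \<Omega>] by (auto simp: E_def)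
      have E'_sets: "E' v \<in> sets M" "E' v \<subseteq> \<Omega>" for v
        using label_cell_sets[of \<A> M S \<Omega> v] \<A>(1) \<A>_sets fmeasurableD[OF \<Omega>] mp_automorphismD(2)[OF S]
        by (auto simp: E'_def)
      have E_eq: "measure M (E' v) = measure M (E v)" for v
        unfolding E_def E'_def by (rule label_cell_measure[OF \<A>(1) \<A>_sets S \<Omega> subA(1,2)])
      have "card {i\<in>I. \<beta> i = v} \<le> card {i\<in>I. \<alpha> i = v} + R" for v
      proof -
        have "{i\<in>I. C i \<subseteq> E v} = {i\<in>I. \<alpha> i = v}" "{i\<in>I. C i \<subseteq> E' v} = {i\<in>I. \<beta> i = v}"
          by (intro Collect_cong conj_cong refl conjunct1[OF E_piece] conjunct1[OF E'_piece]; assumption)+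
        then have "real (card {i\<in>I. \<beta> i = v}) \<le> N * measure M (E' v)" "N * measure M (E v) \<le> card {i\<in>I. \<alpha> i = v} + R"
          using count(1)[OF E'_sets conjunct2[OF E'_piece], of v] count(2)[OF E_sets conjunct2[OF E_piece], of v]
          by simp_all
        then show ?thesis using E_eq[of v] by (simp flip: of_nat_add)
      qed
      then obtain \<sigma> where \<sigma>: "\<sigma> permutes I" and bad: "card {i\<in>I. \<alpha> (\<sigma> i) \<noteq> \<beta> i} \<le> V * R"
        unfolding V_def using \<A>(1)
        by (rule_tac permutation_matching[OF I(1), of "Pow \<A>" \<alpha> \<beta> R]) (auto simp: \<alpha>_def \<beta>_def)
      define J where "J = {i\<in>I. \<alpha> (\<sigma> i) \<noteq> \<beta> i}"
      have J: "J \<subseteq> I" by (auto simp: J_def)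
      have "displacement M A (compose (space M) (T \<sigma>) (mp_inv M S)) < d" if A: "A \<in> \<A>" for A
      proof -
        let ?X = "{y\<in>space M. (S y \<in> A) \<noteq> (T \<sigma> y \<in> A)}"
        let ?Z = "\<Union>i\<in>I. C i - C' i"
        \<comment> \<open>Disagreement has three sources: mismatched pieces, the part of \<Omega>
          covered by no piece, and the null sets trimmed off the pieces. Points outside \<Omega> are
          fixed by \<open>T \<sigma>\<close>, and neither they nor their S-images lie in A.\<close>
        have "?X \<subseteq> (\<Union>i\<in>J. C i) \<union> ((\<Omega> - (\<Union>i\<in>I. C i)) \<union> ?Z)"
        proof
          fix y assume "y \<in> ?X"
          then have y: "y \<in> space M" "(S y \<in> A) \<noteq> (T \<sigma> y \<in> A)" by auto
          show "y \<in> (\<Union>i\<in>J. C i) \<union> ((\<Omega> - (\<Union>i\<in>I. C i)) \<union> ?Z)"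
          proof (cases "y \<in> (\<Union>i\<in>I. C' i)")
            case True
            then obtain i where i: "i \<in> I" "y \<in> C' i" by blast
            have si: "\<sigma> i \<in> I" using \<sigma> i by (simp add: permutes_in_image)
            have "T \<sigma> y \<in> C (\<sigma> i)" using T(3)[OF \<sigma> i] C'(2)[OF si] by blast
            \<comment> \<open>The label \<beta> of piece i decides whether S y lies in A, and the
              label \<alpha> of piece \<sigma> i decides the same for the image of y under
              \<open>T \<sigma>\<close>; equal labels would force agreement.\<close>
            then have "\<alpha> (\<sigma> i) \<noteq> \<beta> i"
              using \<alpha>[OF si, of "T \<sigma> y"] \<beta>[OF i(1), of y] C'(2)[OF i(1)] i(2) y(2) A by blast
            then have "i \<in> J" using i by (simp add: J_def)
            then show ?thesis using i C'(2) by blast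
          next
            case False
            then have "T \<sigma> y = y" using T(5)[OF \<sigma>] y by simp
            then have "y \<in> \<Omega>" using y subA(1,2)[OF A] by auto
            then show ?thesis using False by blast
          qed
        qed
        moreover have X_sets: "?X \<in> sets M"
        proof -
          have "?X = (S -` A \<inter> space M - (T \<sigma> -` A \<inter> space M)) \<union> (T \<sigma> -` A \<inter> space M - (S -` A \<inter> space M))" by auto
          then show ?thesis
            using A \<A>_sets measurable_sets[OF mp_automorphismD(2)[OF S]] measurable_sets[OF mp_automorphismD(2)[OF T(1)[OF \<sigma>]]]
            by (auto intro!: sets.Un sets.Diff)
        qed
        moreover have Z: "?Z \<in> null_sets M" using I(1) C(1) C'(1,3) by (intro null_sets_UN') (auto intro: countable_finite)
        moreover have rest_fm: "\<Omega> - (\<Union>i\<in>I. C i) \<in> fmeasurable M"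
          using \<Omega> UN_fm[of I] by (intro fmeasurable.Diff) auto
        ultimately have "measure M ?X \<le> measure M ((\<Union>i\<in>J. C i) \<union> ((\<Omega> - (\<Union>i\<in>I. C i)) \<union> ?Z))"
          using UN_fm[OF J] by (intro measure_mono_fmeasurable fmeasurable.Un) (auto simp: null_sets_def fmeasurable_def)
        also have "\<dots> \<le> measure M (\<Union>i\<in>J. C i) + measure M ((\<Omega> - (\<Union>i\<in>I. C i)) \<union> ?Z)"
          using UN_fm[OF J] rest_fm Z by (intro measure_Un_le sets.Un) (auto simp: null_sets_def fmeasurable_def)
        also have "measure M ((\<Omega> - (\<Union>i\<in>I. C i)) \<union> ?Z) \<le> measure M (\<Omega> - (\<Union>i\<in>I. C i)) + measure M ?Z"
          using rest_fm Z by (intro measure_Un_le) (auto simp: null_sets_def fmeasurable_def)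
        also have "measure M ?Z = 0" using Z by (simp add: null_sets_def measure_def)
        finally have "measure M ?X \<le> card J / N + R / N" using meas_UN[OF J] rest by simp
        also have "\<dots> \<le> (V * R) / N + R / N"
          using bad by (intro add_right_mono divide_right_mono) (auto simp: J_def simp flip: of_nat_mult)
        also have "\<dots> < d" using small by (simp add: add_divide_distrib)
        finally show ?thesis using displacement_compose_inv[OF S T(1)[OF \<sigma>]] A \<A>_sets by auto
      qed
      then show ?thesis using \<sigma> by blast
    qed
    show "\<exists>(I :: ('a set set \<times> nat) set) T. permutation_model M \<A> \<S> d (measure M \<Omega>) N I T"
      using I(1) card_I T(1,2) moved approx unfolding permutation_model_def
      by (intro exI[of _ I] exI[of _ T] conjI allI impI ballI) auto
  qed simp
qed

section \<open>Fixed points on compact spaces\<close>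

text \<open>The pairs (u, y) with displacement below e form an open set containing the slice over
  the identity. By compactness of X the tube lemma yields one \<open>U\<close> for all y, so the
  estimate may later be used at points that depend on the permutation.\<close>

lemma uniform_displacement:
  assumes X: "compact_space X" and act: "continuous_action G \<tau> X \<phi>" and G: "topspace \<tau> = carrier G" "group G"
    and f: "continuous_map X euclideanreal f" and e: "0 < e"
  obtains U where "openin \<tau> U" "\<one>\<^bsub>G\<^esub> \<in> U"
    "\<And>u y. u \<in> U \<Longrightarrow> y \<in> topspace X \<Longrightarrow> \<bar>f (\<phi> u y) - f y\<bar> < e"
proof -
  interpret group_action G "topspace X" \<phi> using act by (simp add: continuous_action_def)
  have cont: "continuous_map (prod_topology \<tau> X) X (\<lambda>(g, x). \<phi> g x)"
    using act by (simp add: continuous_action_def)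
  have one: "\<one>\<^bsub>G\<^esub> \<in> topspace \<tau>" using G group.is_monoid monoid.one_closed by metis
  define W where "W = {z \<in> topspace (prod_topology \<tau> X). f ((\<lambda>(g, x). \<phi> g x) z) - f (snd z) \<in> {-e<..<e}}"
  have "continuous_map (prod_topology \<tau> X) euclideanreal (\<lambda>z. f ((\<lambda>(g, x). \<phi> g x) z) - f (snd z))"
    using continuous_map_compose[OF cont f] continuous_map_compose[OF continuous_map_snd f]
    by (intro continuous_map_diff) (simp_all add: comp_def)
  then have W: "openin (prod_topology \<tau> X) W"
    unfolding W_def by (rule openin_continuous_map_preimage) simp
  have "\<phi> \<one>\<^bsub>G\<^esub> x = x" if "x \<in> topspace X" for x using id_eq_one that by (metis restrict_apply)
  then have "{\<one>\<^bsub>G\<^esub>} \<times> topspace X \<subseteq> W" using one e by (auto simp: W_def)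
  then obtain U V where UV: "openin \<tau> U" "\<one>\<^bsub>G\<^esub> \<in> U" "topspace X \<subseteq> V" "U \<times> V \<subseteq> W"
    using tube_lemma_right[OF W _ one, of "topspace X"] X by (auto simp: compact_space_def)
  have "\<bar>f (\<phi> u y) - f y\<bar> < e" if "u \<in> U" "y \<in> topspace X" for u y
  proof -
    have "(u, y) \<in> W" using UV that by blast
    then show ?thesis by (auto simp: W_def abs_less_iff)
  qed
  then show ?thesis using UV that by blast
qed

text \<open>Almost fixed points for finite data give the finite intersection property for the closed
  sets \<open>E (f, g, n)\<close>. A common point has f (g x) = f x for every f, and by Urysohn's
  lemma continuous functions separate points.\<close>

lemma fixed_point_criterion:
  assumes X: "compact_space X" "Hausdorff_space X" and act: "continuous_action G \<tau> X \<phi>"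
    and G: "topspace \<tau> = carrier G" "group G"
    and approx: "\<And>F \<Gamma> e. finite F \<Longrightarrow> finite \<Gamma> \<Longrightarrow> \<Gamma> \<subseteq> carrier G \<Longrightarrow> 0 < e \<Longrightarrow>
      (\<And>f. f \<in> F \<Longrightarrow> continuous_map X (top_of_set {0..1::real}) f) \<Longrightarrow>
      \<exists>x\<in>topspace X. \<forall>f\<in>F. \<forall>g\<in>\<Gamma>. \<bar>f (\<phi> g x) - f x\<bar> \<le> e"
  shows "\<exists>x\<in>topspace X. \<forall>g\<in>carrier G. \<phi> g x = x"
proof -
  interpret group_action G "topspace X" \<phi> using act by (simp add: continuous_action_def)
  define CF where "CF = {f. continuous_map X (top_of_set {0..1::real}) f}"
  define E where "E = (\<lambda>(f, g, n). {x\<in>topspace X. \<bar>f (\<phi> g x) - f x\<bar> \<le> 1 / Suc n})"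
  define P where "P = CF \<times> carrier G \<times> (UNIV :: nat set)"
  have real: "continuous_map X euclideanreal f" if "f \<in> CF" for f
    using that by (auto simp: CF_def continuous_map_in_subtopology)
  have "closedin X (E (f, g, n))" if "(f, g, n) \<in> P" for f g n
  proof -
    have f: "continuous_map X euclideanreal f" and g: "g \<in> carrier G" using that real by (auto simp: P_def)
    have "continuous_map X (prod_topology \<tau> X) (\<lambda>x. (g, x))"
      using g G by (intro continuous_map_pairedI) auto
    then have "continuous_map X X (\<lambda>x. \<phi> g x)"
      using continuous_map_compose[of X "prod_topology \<tau> X" "\<lambda>x. (g, x)" X "\<lambda>(g, x). \<phi> g x"] act
      by (simp add: continuous_action_def comp_def)
    then have "continuous_map X euclideanreal (\<lambda>x. \<bar>f (\<phi> g x) - f x\<bar>)"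
      using f continuous_map_compose[OF _ f] by (intro continuous_map_real_abs continuous_map_diff) (auto simp: comp_def)
    from closedin_continuous_map_preimage[OF this, of "{..1 / Suc n}"]
    show ?thesis by (simp add: E_def)
  qed
  moreover have "topspace X \<inter> (\<Inter>p\<in>Q. E p) \<noteq> {}" if Q: "finite Q" "Q \<subseteq> P" for Q
  proof -
    define e where "e = Min (insert 1 ((\<lambda>(f, g, n). 1 / real (Suc n)) ` Q))"
    have e: "0 < e" "\<And>f g n. (f, g, n) \<in> Q \<Longrightarrow> e \<le> 1 / Suc n"
      unfolding e_def using Q(1) by (auto simp: split_beta intro!: Min_le image_eqI)
    have "\<exists>x\<in>topspace X. \<forall>f\<in>fst ` Q. \<forall>g\<in>(fst \<circ> snd) ` Q. \<bar>f (\<phi> g x) - f x\<bar> \<le> e"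
      using Q e(1) by (intro approx) (auto simp: P_def CF_def)
    then obtain x where x: "x \<in> topspace X" "\<And>f g n. (f, g, n) \<in> Q \<Longrightarrow> \<bar>f (\<phi> g x) - f x\<bar> \<le> e" by force
    then have "x \<in> E p" if "p \<in> Q" for p using e(2) that by (cases p) (force simp: E_def)
    then show ?thesis using x by blast
  qed
  ultimately have "topspace X \<inter> (\<Inter>p\<in>P. E p) \<noteq> {}"
  proof -
    assume closed: "\<And>f g n. (f, g, n) \<in> P \<Longrightarrow> closedin X (E (f, g, n))"
      and fin: "\<And>Q. finite Q \<Longrightarrow> Q \<subseteq> P \<Longrightarrow> topspace X \<inter> (\<Inter>p\<in>Q. E p) \<noteq> {}"
    let ?\<U> = "insert (topspace X) (E ` P)"
    have "\<forall>C\<in>?\<U>. closedin X C" using closed by auto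
    moreover have "\<Inter>\<F> \<noteq> {}" if \<F>: "finite \<F>" "\<F> \<subseteq> insert (topspace X) (E ` P)" for \<F>
    proof -
      have "finite (\<F> - {topspace X})" "\<F> - {topspace X} \<subseteq> E ` P" using \<F> by auto
      then obtain Q where Q: "finite Q" "Q \<subseteq> P" "\<F> - {topspace X} = E ` Q" by (meson finite_subset_image)
      then have "topspace X \<inter> (\<Inter>p\<in>Q. E p) \<subseteq> \<Inter>\<F>" by blast
      then show ?thesis using fin[OF Q(1,2)] by blast
    qed
    ultimately have "(\<forall>C\<in>?\<U>. closedin X C) \<and> (\<forall>\<F>. finite \<F> \<and> \<F> \<subseteq> ?\<U> \<longrightarrow> \<Inter>\<F> \<noteq> {})" by blast
    then have "\<Inter>?\<U> \<noteq> {}" by (rule compact_space_fip[THEN iffD1, OF X(1), THEN spec, THEN mp])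
    then show ?thesis by simp
  qed
  then obtain x where x: "x \<in> topspace X" "\<And>p. p \<in> P \<Longrightarrow> x \<in> E p" by blast
  have "\<phi> g x = x" if g: "g \<in> carrier G" for g
  proof (rule ccontr)
    assume ne: "\<phi> g x \<noteq> x"
    have gx: "\<phi> g x \<in> topspace X" using element_image[OF g x(1)] by simp
    have "normal_space X" using X by (simp add: compact_Hausdorff_or_regular_imp_normal_space)
    then obtain f where f: "continuous_map X (top_of_set {0..1::real}) f" "f ` {x} \<subseteq> {0}" "f ` {\<phi> g x} \<subseteq> {1}"
      using Urysohn_lemma[of X "{x}" "{\<phi> g x}" 0 1] x(1) gx ne X(2)
      by (auto simp: closedin_Hausdorff_sing_eq disjnt_def)
    \<comment> \<open>n = 1 suffices: it bounds by 1/2 a difference that the separating function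
      makes equal to 1.\<close>
    have "(f, g, 1) \<in> P" using f g by (simp add: P_def CF_def)
    then have "\<bar>f (\<phi> g x) - f x\<bar> \<le> 1 / 2" using x(2) by (fastforce simp: E_def)
    then show False using f by simp
  qed
  then show ?thesis using x(1) by blast
qed

text \<open>The point is x = t p x0 with \<open>p\<close> good for all f and g at once. Replacing g
  by the permutation \<sigma> g that imitates it costs r, and concentration costs 4 r in passing
  from \<open>\<sigma> g \<circ> p\<close> back to \<open>p\<close>; hence r = e / 5.\<close>

lemma Aut_almost_fixed_point:
  fixes M :: "'a measure"
  assumes M: "standard_borel M" "nonatomic M" and X: "compact_space X" "topspace X \<noteq> {}"
    and act: "continuous_action (Aut M) (Aut_strong_topology M) X \<phi>"
    and F: "finite F" "\<And>f. f \<in> F \<Longrightarrow> continuous_map X (top_of_set {0..1::real}) f"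
    and \<Gamma>: "finite \<Gamma>" "\<Gamma> \<subseteq> carrier (Aut M)" and e: "0 < e"
  shows "\<exists>x\<in>topspace X. \<forall>f\<in>F. \<forall>g\<in>\<Gamma>. \<bar>f (\<phi> g x) - f x\<bar> \<le> e"
proof -
  let ?\<tau> = "Aut_strong_topology M"
  interpret group_action "Aut M" "topspace X" \<phi> using act by (simp add: continuous_action_def)
  interpret G: group "Aut M" by (rule group_Aut)
  define r where "r = e / 5"
  have r: "0 < r" using e by (simp add: r_def)
  obtain x0 where x0: "x0 \<in> topspace X" using X(2) by blast
  have real: "continuous_map X euclideanreal f" if "f \<in> F" for f
    using F(2)[OF that] by (auto simp: continuous_map_in_subtopology)
  have "\<exists>U. openin ?\<tau> U \<and> \<one>\<^bsub>Aut M\<^esub> \<in> U \<and> (\<forall>u\<in>U. \<forall>y\<in>topspace X. \<bar>f (\<phi> u y) - f y\<bar> < r)" if f: "f \<in> F" for f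
    by (rule uniform_displacement[OF X(1) act topspace_Aut_strong_topology group_Aut real[OF f] r]) blast
  then obtain U where U: "\<And>f. f \<in> F \<Longrightarrow> openin ?\<tau> (U f)" "\<And>f. f \<in> F \<Longrightarrow> \<one>\<^bsub>Aut M\<^esub> \<in> U f"
    "\<And>f u y. f \<in> F \<Longrightarrow> u \<in> U f \<Longrightarrow> y \<in> topspace X \<Longrightarrow> \<bar>f (\<phi> u y) - f y\<bar> < r" by metis
  define U0 where "U0 = topspace ?\<tau> \<inter> (\<Inter>f\<in>F. U f)"
  have U0: "openin ?\<tau> U0" "\<one>\<^bsub>Aut M\<^esub> \<in> U0"
    unfolding U0_def using F(1) U(1,2) openin_topspace[of ?\<tau>]
    by (auto simp: topspace_Aut_strong_topology intro!: openin_Int_Inter)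
  obtain \<A> d where \<A>: "finite \<A>" "\<A> \<subseteq> fmeasurable M" and d: "0 < d"
    and nbhd: "\<And>T. T \<in> mp_automorphisms M \<Longrightarrow> (\<And>A. A \<in> \<A> \<Longrightarrow> displacement M A T < d) \<Longrightarrow> aut_class M T \<in> U0"
    by (rule identity_neighbourhood[OF U0]) blast
  have "\<forall>g\<in>\<Gamma>. \<exists>S. S \<in> mp_automorphisms M \<and> g = aut_class M S" using \<Gamma>(2) by (auto simp: carrier_Aut)
  then obtain S where S: "\<And>g. g \<in> \<Gamma> \<Longrightarrow> S g \<in> mp_automorphisms M" "\<And>g. g \<in> \<Gamma> \<Longrightarrow> g = aut_class M (S g)" by metis
  have S_img: "finite (S ` \<Gamma>)" "S ` \<Gamma> \<subseteq> mp_automorphisms M" using \<Gamma>(1) S(1) by auto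
  obtain c N0 where c: "0 \<le> c" and model: "\<And>N. N0 \<le> N \<Longrightarrow> 
      \<exists>(I :: ('a set set \<times> nat) set) T. permutation_model M \<A> (S ` \<Gamma>) d c N I T"
    by (rule permutation_approximation[OF M \<A> S_img d]) blast
  \<comment> \<open>Hamming closeness is given with a weak inequality, while \<open>nbhd\<close>
    asks for a strict one.\<close>
  define \<delta> where "\<delta> = d / 2"
  have \<delta>: "0 < \<delta>" "\<delta> < d" using d by (auto simp: \<delta>_def)
  \<comment> \<open>As \<open>card I \<le> c * N\<close>, the left side of the concentration
    hypothesis is at most K N, and the right side is (r \<delta>)^2 N^2; this leads to the threshold
    for \<open>N\<close>.\<close>
  define K where "K = card F * (card \<Gamma> + 1) * c * 9"
  obtain N1 where N1: "K / (r * \<delta>)\<^sup>2 < real N1" using reals_Archimedean2 by blast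
  define N where "N = Suc (max N0 N1)"
  have N: "N0 \<le> N" "0 < real N" "K / (r * \<delta>)\<^sup>2 < real N" using N1 by (auto simp: N_def)
  obtain I :: "('a set set \<times> nat) set" and T where I: "finite I" "card I \<le> c * real N"
    and T: "\<And>\<sigma>. \<sigma> permutes I \<Longrightarrow> T \<sigma> \<in> mp_automorphisms M"
      "\<And>\<sigma> \<tau>. \<sigma> permutes I \<Longrightarrow> \<tau> permutes I \<Longrightarrow> T (\<sigma> \<circ> \<tau>) = compose (space M) (T \<sigma>) (T \<tau>)"
      "\<And>\<sigma> A. \<sigma> permutes I \<Longrightarrow> A \<in> \<A> \<Longrightarrow> displacement M A (T \<sigma>) \<le> card {i. \<sigma> i \<noteq> i} / real N"
    and appr: "\<forall>S\<in>S ` \<Gamma>. \<exists>\<sigma>. \<sigma> permutes I \<and> (\<forall>A\<in>\<A>. displacement M A (compose (space M) (T \<sigma>) (mp_inv M S)) < d)"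
    using model[OF N(1)] unfolding permutation_model_def by blast
  obtain \<sigma> where \<sigma>: "\<And>g. g \<in> \<Gamma> \<Longrightarrow> \<sigma> g permutes I"
    "\<And>g A. g \<in> \<Gamma> \<Longrightarrow> A \<in> \<A> \<Longrightarrow> displacement M A (compose (space M) (T (\<sigma> g)) (mp_inv M (S g))) < d"
  proof -
    have "\<forall>g\<in>\<Gamma>. \<exists>\<sigma>. \<sigma> permutes I \<and>
        (\<forall>A\<in>\<A>. displacement M A (compose (space M) (T \<sigma>) (mp_inv M (S g))) < d)"
      using appr by blast
    from bchoice[OF this] show ?thesis using that by blast
  qed
  define t where "t p = aut_class M (T p)" for p
  have t: "t p \<in> carrier (Aut M)" if "p permutes I" for p using T(1)[OF that] by (auto simp: t_def carrier_Aut)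
  have t_mult: "t (p \<circ> q) = t p \<otimes>\<^bsub>Aut M\<^esub> t q" if "p permutes I" "q permutes I" for p q
    using T(1,2) that by (simp add: t_def mult_Aut)
  have act_mult: "\<phi> (g \<otimes>\<^bsub>Aut M\<^esub> h) y = \<phi> g (\<phi> h y)" if "g \<in> carrier (Aut M)" "h \<in> carrier (Aut M)" "y \<in> topspace X" for g h y
    using composition_rule[OF that(3,1,2)] .
  have act_X: "\<phi> g y \<in> topspace X" if "g \<in> carrier (Aut M)" "y \<in> topspace X" for g y
    using element_image[OF that] by simp
  define f' where "f' f p = f (\<phi> (t p) x0)" for f :: "'b \<Rightarrow> real" and p
  have unif: "\<bar>f' f p - f' f q\<bar> \<le> r"
    if f: "f \<in> F" and p: "p permutes I" and q: "q permutes I" and close: "card {i. p i \<noteq> q i} \<le> \<delta> * N" for f p q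
  proof -
    \<comment> \<open>The quotient stands on the outer side: \<open>p = ?w \<circ> q\<close>, and
      \<open>?w\<close> moves exactly as many points as \<open>p\<close> and \<open>q\<close> differ
      at. The estimate for \<open>U0\<close> is then applied at the point that \<open>q\<close>
      makes of \<open>x0\<close>.\<close>
    let ?w = "p \<circ> inv_into UNIV q"
    have q': "inv_into UNIV q permutes I" using q by (rule permutes_inv)
    have w: "?w permutes I" using p q' by (rule permutes_compose[rotated])
    have "{i. ?w i \<noteq> i} = q ` {i. p i \<noteq> q i}"
    proof (intro equalityI subsetI)
      fix i assume "i \<in> {i. ?w i \<noteq> i}"
      then show "i \<in> q ` {i. p i \<noteq> q i}"
        using permutes_inverses(1)[OF q] by (intro image_eqI[of _ _ "inv_into UNIV q i"]) auto
    qed (auto simp: permutes_inverses(2)[OF q])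
    then have "card {i. ?w i \<noteq> i} = card {i. p i \<noteq> q i}"
      using card_image[OF permutes_inj_on[OF q]] by simp
    moreover have "\<delta> * N < d * N" using \<delta>(2) N(2) by simp
    then have "real (card {i. p i \<noteq> q i}) < d * N" using close by linarith
    ultimately have small: "card {i. ?w i \<noteq> i} / real N < d" using N(2) by (simp add: pos_divide_less_eq)
    have "t ?w \<in> U0" unfolding t_def
      using T(1)[OF w] le_less_trans[OF T(3)[OF w] small] by (rule nbhd)
    moreover have "p = ?w \<circ> q" using permutes_inverses(2)[OF q] by (auto simp: fun_eq_iff)
    then have "\<phi> (t p) x0 = \<phi> (t ?w) (\<phi> (t q) x0)"
      using act_mult[OF t[OF w] t[OF q] x0] t_mult[OF w q] by simp
    ultimately show ?thesis
      using U(3)[OF f, of "t ?w" "\<phi> (t q) x0"] act_X[OF t[OF q] x0] f by (simp add: f'_def U0_def less_imp_le)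
  qed
  have range: "0 \<le> f' f p \<and> f' f p \<le> 1" if "f \<in> F" "p permutes I" for f p
    using F(2)[OF that(1)] act_X[OF t[OF that(2)] x0]
    by (auto simp: f'_def continuous_map_in_subtopology image_subset_iff Pi_iff)
  have large: "card (f' ` F) * (card (\<sigma> ` \<Gamma>) + 1) * card I * 9 < (r * \<delta> * N)\<^sup>2"
  proof -
    have "real (card (f' ` F) * (card (\<sigma> ` \<Gamma>) + 1) * card I * 9) \<le> real (card F * (card \<Gamma> + 1) * card I * 9)"
      using F(1) \<Gamma>(1) by (intro of_nat_mono mult_right_mono mult_mono add_right_mono card_image_le) auto
    also have "\<dots> = card F * (card \<Gamma> + 1) * real (card I) * 9" by simp
    also have "\<dots> \<le> card F * (card \<Gamma> + 1) * (c * real N) * 9"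
      using I(2) by (intro mult_right_mono mult_left_mono) auto
    also have "\<dots> = K * real N" by (simp add: K_def)
    also have "\<dots> < ((r * \<delta>)\<^sup>2 * real N) * real N"
      using N(2,3) r \<delta>(1) by (intro mult_strict_right_mono) (simp_all add: pos_divide_less_eq mult.commute)
    also have "\<dots> = (r * \<delta> * N)\<^sup>2" by (simp add: power2_eq_square)
    finally show ?thesis by simp
  qed
  obtain p where p: "p permutes I" and conc: "\<And>h s. h \<in> f' ` F \<Longrightarrow> s \<in> \<sigma> ` \<Gamma> \<Longrightarrow> \<bar>h (s \<circ> p) - h p\<bar> \<le> 4 * r"
    by (rule permutation_concentration[of I "f' ` F" "\<sigma> ` \<Gamma>" \<delta> r N])
      (use I(1) F(1) \<Gamma>(1) \<sigma>(1) \<delta>(1) r N(2) range unif large in auto)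
  define x where "x = \<phi> (t p) x0"
  have x: "x \<in> topspace X" unfolding x_def by (rule act_X[OF t[OF p] x0])
  have "\<bar>f (\<phi> g x) - f x\<bar> \<le> e" if f: "f \<in> F" and g: "g \<in> \<Gamma>" for f g
  proof -
    \<comment> \<open>Here t (\<sigma> g) is \<open>?w\<close> times g with \<open>?w\<close> in
      \<open>U0\<close>, so the estimate is applied at the point \<phi> g x.\<close>
    let ?w = "aut_class M (compose (space M) (T (\<sigma> g)) (mp_inv M (S g)))"
    have gc: "g \<in> carrier (Aut M)" using g \<Gamma>(2) by blast
    note Sg = S(1)[OF g] and T\<sigma> = T(1)[OF \<sigma>(1)[OF g]]
    have "?w \<in> U0"
      using compose_automorphism[OF T\<sigma> mp_inv_automorphism[OF Sg]] \<sigma>(2)[OF g] by (rule nbhd)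
    then have w: "?w \<in> carrier (Aut M)" "?w \<in> U f" using f by (auto simp: U0_def topspace_Aut_strong_topology)
    have "?w = t (\<sigma> g) \<otimes>\<^bsub>Aut M\<^esub> inv\<^bsub>Aut M\<^esub> g"
      using S(2)[OF g] inv_Aut[OF Sg] mult_Aut[OF T\<sigma> mp_inv_automorphism[OF Sg]] by (simp add: t_def)
    then have "t (\<sigma> g) = ?w \<otimes>\<^bsub>Aut M\<^esub> g"
      using gc t[OF \<sigma>(1)[OF g]] by (simp add: G.m_assoc)
    then have "\<phi> (t (\<sigma> g \<circ> p)) x0 = \<phi> ?w (\<phi> g x)"
      using act_mult[OF t[OF \<sigma>(1)[OF g]] t[OF p] x0] t_mult[OF \<sigma>(1)[OF g] p] act_mult[OF w(1) gc x]
      by (simp add: x_def)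
    then have "\<bar>f' f (\<sigma> g \<circ> p) - f (\<phi> g x)\<bar> < r"
      using U(3)[OF f w(2) act_X[OF gc x]] by (simp add: f'_def)
    moreover have "\<bar>f' f (\<sigma> g \<circ> p) - f' f p\<bar> \<le> 4 * r" using conc f g by blast
    moreover have "f' f p = f x" by (simp add: f'_def x_def)
    ultimately show ?thesis unfolding r_def abs_le_iff abs_less_iff by linarith
  qed
  then show ?thesis using x by blast
qed

theorem corollary2p2:
  fixes M :: "'a measure"
  assumes "standard_borel M" and "sigma_finite_measure M" and "nonatomic M"
  shows "extremely_amenable TYPE('x) (Aut M) (Aut_strong_topology M)"
  unfolding extremely_amenable_def
proof (intro conjI allI impI topological_group_Aut)
  fix X :: "'x topology" and \<phi>
  assume X: "compact_space X \<and> Hausdorff_space X \<and> topspace X \<noteq> {} \<and>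
    continuous_action (Aut M) (Aut_strong_topology M) X \<phi>"
  show "\<exists>x\<in>topspace X. \<forall>g\<in>carrier (Aut M). \<phi> g x = x"
  proof (rule fixed_point_criterion[of X "Aut M" "Aut_strong_topology M"])
    show "\<exists>x\<in>topspace X. \<forall>f\<in>F. \<forall>g\<in>\<Gamma>. \<bar>f (\<phi> g x) - f x\<bar> \<le> e"
      if "finite F" "finite \<Gamma>" "\<Gamma> \<subseteq> carrier (Aut M)" "0 < e"
        "\<And>f. f \<in> F \<Longrightarrow> continuous_map X (top_of_set {0..1::real}) f" for F \<Gamma> e
      by (rule Aut_almost_fixed_point[OF assms(1,3)]) (use that X in blast)+
  qed (use X topspace_Aut_strong_topology group_Aut in blast)+
qed

end
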